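(* Let $k\ge 2$, $s\ge 4$. For a prime $p$, let $C_{p}(k,s)$ be the set of $\mathbf a=(a_1,\dots,a_s)$ (with $a_{j}\ne 0$ for all $j$) such that $a_1x_1^k+\dots+a_sx_s^k=0$ has a solution with all $x_j\in\mathbb Z_{p}^{\times}$. Define \[\delta_{p}=\lim_{A\rightarrow\infty}\frac{\#\{|\mathbf a|\le A: \mathbf a\in C_{p}(k,s)\}}{(2A)^{s}}\] and $\delta_{\infty}=1-2^{1-s}$. Then $\delta_{\infty}$ and $\delta_{p}$ are well-defined and positive, and are the densities of $\mathbf a$ such that the equation has a solution in $\mathbb R^{+}$ and in $\mathbb Z_{p}^{\times}$ respectively. Let $\mathfrak D_{s,k}=\delta_{\infty}\prod_{p}\delta_{p}$. Then \[\#\{\mathbf a\in \mathcal{C}'(k,s):|\mathbf a|\le A\}=\mathfrak D_{s,k}(2A)^{s}+O\left(\frac{A^{s}}{(\log A)^{s-3}}\right).\] Furthermore, for all sufficiently large primes $p$, \[\delta_{p}=1-\left(1-\frac{1}{p^{s}}\right)^{-1}\left(s\left(1-\frac{1}{p}\right)\frac{1}{p^{s-1}}+\frac{s(s-1)}{2}\left(1-\frac{1}{p}\right)^{2}\left(1-g_{p,k}^{-1}\right)\frac{1}{p^{s-2}}\right),\] where $g_{p,k}=\gcd(p-1,k)$.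
   Context: $\mathbf a$ denotes a tuple of nonzero integers, $|\mathbf a|=\max_j|a_j|$; counts over $|\mathbf a|\le A$ are over such tuples. $\mathbb R^+=\{x>0\}$, $\mathbb Z_p^\times=\{x\in\mathbb Q_p:|x|_p=1\}$. $\mathcal{C}'(k,s)$ is the set of $\mathbf a$ such that $a_1x_1^k+\dots+a_sx_s^k=0$ has a solution with all $x_j\in\mathbb R^+$ and, for each prime $p$, a solution with all $x_j\in\mathbb Z_p^\times$. *)

theory Defs
  imports Complex_Main "HOL-Library.Landau_Symbols" "HOL-Computational_Algebra.Primes"
begin

text \<open>Tuples \<open>a = (a_1,...,a_s)\<close> are integer lists of length s (index j ranges over j < s).\<close>

text \<open>p-adic integers, constructed as the inverse limit of the rings Z/p^n Z:
  a p-adic integer is a compatible sequence of residues x n in [0, p^n).\<close>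
definition padic_int :: "nat \<Rightarrow> (nat \<Rightarrow> int) \<Rightarrow> bool" where
  "padic_int p x \<longleftrightarrow> (\<forall>n. 0 \<le> x n \<and> x n < int p ^ n) \<and> (\<forall>n. x (Suc n) mod int p ^ n = x n)"

text \<open>A p-adic integer is a unit (|x|_p = 1) iff its residue mod p is nonzero.\<close>
definition padic_unit :: "nat \<Rightarrow> (nat \<Rightarrow> int) \<Rightarrow> bool" where
  "padic_unit p x \<longleftrightarrow> x 1 \<noteq> 0"

text \<open>Solvability of a_1 x_1^k + ... + a_s x_s^k = 0 with all x_j in Z_p^\<times>.
  Ring operations in the inverse limit are componentwise modulo p^n, so the
  p-adic value of the form is zero iff its n-th component vanishes mod p^n for all n.\<close>
definition padic_unit_solvable :: "nat \<Rightarrow> nat \<Rightarrow> int list \<Rightarrow> bool" where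
  "padic_unit_solvable p k a \<longleftrightarrow>
     (\<exists>x :: nat \<Rightarrow> nat \<Rightarrow> int. (\<forall>j<length a. padic_int p (x j) \<and> padic_unit p (x j)) \<and>
        (\<forall>n. (\<Sum>j<length a. a ! j * x j n ^ k) mod int p ^ n = 0))"

definition pos_real_solvable :: "nat \<Rightarrow> int list \<Rightarrow> bool" where
  "pos_real_solvable k a \<longleftrightarrow>
     (\<exists>x :: nat \<Rightarrow> real. (\<forall>j<length a. x j > 0) \<and> (\<Sum>j<length a. of_int (a ! j) * x j ^ k) = 0)"

definition box :: "nat \<Rightarrow> real \<Rightarrow> int list set" where
  "box s A = {a. length a = s \<and> (\<forall>b\<in>set a. b \<noteq> 0 \<and> of_int \<bar>b\<bar> \<le> A)}"

definition Cp :: "nat \<Rightarrow> nat \<Rightarrow> nat \<Rightarrow> int list set" where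
  "Cp p k s = {a. length a = s \<and> (\<forall>b\<in>set a. b \<noteq> 0) \<and> padic_unit_solvable p k a}"

definition Cprime :: "nat \<Rightarrow> nat \<Rightarrow> int list set" where
  "Cprime k s = {a. length a = s \<and> (\<forall>b\<in>set a. b \<noteq> 0) \<and> pos_real_solvable k a
                   \<and> (\<forall>p. prime p \<longrightarrow> padic_unit_solvable p k a)}"

definition Cinf :: "nat \<Rightarrow> nat \<Rightarrow> int list set" where
  "Cinf k s = {a. length a = s \<and> (\<forall>b\<in>set a. b \<noteq> 0) \<and> pos_real_solvable k a}"

definition count_ratio :: "nat \<Rightarrow> int list set \<Rightarrow> real \<Rightarrow> real" where
  "count_ratio s S A = real (card (box s A \<inter> S)) / (2 * A) ^ s"

definition delta_p :: "nat \<Rightarrow> nat \<Rightarrow> nat \<Rightarrow> real" where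
  "delta_p p k s = Lim at_top (count_ratio s (Cp p k s))"

definition delta_inf :: "nat \<Rightarrow> real" where
  "delta_inf s = 1 - 2 powr (1 - real s)"

definition euler_prod :: "nat \<Rightarrow> nat \<Rightarrow> real" where
  "euler_prod k s = lim (\<lambda>N. \<Prod>p\<in>{p. prime p \<and> p \<le> N}. delta_p p k s)"

definition frakD :: "nat \<Rightarrow> nat \<Rightarrow> real" where
  "frakD s k = delta_inf s * euler_prod k s"

end

theory Submission
  imports Defs "HOL-Number_Theory.Residue_Primitive_Roots"
begin

text \<open>
  By Hensel's lemma, solvability in \<open>p\<close>-adic units is decided by the residues of the coefficients
  modulo a fixed power of \<open>p\<close>, unless all of them are divisible by a high power of \<open>p\<close>. Hence
  every local condition is, up to a set of small density, periodic, and counting lattice points in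
  residue classes yields the local densities.

  For large \<open>p\<close> an elementary exponential sum bound shows that three coefficients prime to \<open>p\<close>
  already suffice for solvability, so failure at \<open>p\<close> forces \<open>s - 2\<close> coefficients to be divisible
  by \<open>p\<close>. The primes beyond a parameter \<open>Z\<close> therefore exclude a proportion of order at most
  \<open>Z\<close> to the power \<open>3 - s\<close>. The primes up to \<open>Z\<close> are combined by the Chinese remainder theorem
  into one condition whose modulus is exponential in \<open>Z\<close>, so that \<open>Z\<close> can be a small multiple
  of \<open>log A\<close>.
\<close>

section \<open>Counting tuples in residue classes\<close>


text \<open>The exponent s - 3 of the logarithm comes from summing p^(2-s) over p > Z, which gives
  at most Z^(3-s). The obstacle is uniformity: counting modulo Q costs a relative error of order
  Q/A, so Q must stay well below A, whereas a prime p <= Z needs a level p^l so large that tuples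
  with all entries divisible by p^l are negligible. Taking p^l as the first power of p above Z
  reconciles the two. These tuples have total proportion at most Z times Z^(-s), and since l = 2 for
  sqrt Z < p <= Z, the modulus is at most k^2 times the squared primorial of Z times Z^(sqrt Z),
  hence at most k^2 exp(10 Z). With Z about (log A)/20 this gives Q <= k^2 sqrt A. Primes beyond A
  exclude nothing, because they divide no nonzero entry of the box. The threshold 16 k^6 for large
  primes is where the main term (p-1)^3 of a ternary congruence beats the error (p-1) k^3
  p^(3/2).\<close>

definition tuples :: "nat \<Rightarrow> int set \<Rightarrow> int list set" where
  "tuples s X = {a. length a = s \<and> set a \<subseteq> X}"

text \<open>Membership in \<open>T\<close> depends only on residues modulo \<open>Q\<close>. Testing
  against the canonical reduction makes that reduction the representative of its class.
  \<open>T\<close> is not tied to a length, so one set serves every \<open>s\<close>.\<close>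

definition periodic :: "int \<Rightarrow> int list set \<Rightarrow> bool" where
  "periodic Q T \<longleftrightarrow> (\<forall>a. map (\<lambda>b. b mod Q) a \<in> T \<longleftrightarrow> a \<in> T)"

definition dens :: "nat \<Rightarrow> int \<Rightarrow> int list set \<Rightarrow> real" where
  "dens s Q T = real (card (tuples s {0..<Q} \<inter> T)) / of_int Q ^ s"

lemma finite_tuples: "finite X \<Longrightarrow> finite (tuples s X)"
  using finite_lists_length_eq[of X s] by (simp add: tuples_def conj_commute)

lemma card_tuples: "finite X \<Longrightarrow> card (tuples s X) = card X ^ s"
  using card_lists_length_eq[of X s] by (simp add: tuples_def conj_commute)

lemma tuples_0 [simp]: "tuples 0 X = {[]}"
  by (auto simp: tuples_def)

lemma tuples_Suc: "tuples (Suc s) X = (\<lambda>(x, a). x # a) ` (X \<times> tuples s X)"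
  by (auto simp: tuples_def length_Suc_conv image_iff)

lemma dens_nonneg: "Q > 0 \<Longrightarrow> dens s Q T \<ge> 0"
  by (simp add: dens_def)

lemma card_tuples_Int_le: "Q \<ge> 0 \<Longrightarrow> real (card (tuples s {0..<Q} \<inter> T)) \<le> of_int Q ^ s"
proof -
  assume "Q \<ge> 0"
  have "card (tuples s {0..<Q} \<inter> T) \<le> card (tuples s {0..<Q})"
    by (intro card_mono finite_tuples) auto
  also have "\<dots> = nat Q ^ s" by (simp add: card_tuples)
  finally have "real (card (tuples s {0..<Q} \<inter> T)) \<le> real (nat Q ^ s)"
    by (rule of_nat_mono)
  with \<open>Q \<ge> 0\<close> show ?thesis by simp
qed

lemma dens_le_1: "Q > 0 \<Longrightarrow> dens s Q T \<le> 1"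
  using card_tuples_Int_le[of Q s T] by (simp add: dens_def)

text \<open>A list with prescribed image is an independent choice at every position;
  \<open>map f a = r\<close> already fixes the length.\<close>

lemma card_map_fibre:
  assumes "finite X"
  shows "card {a. set a \<subseteq> X \<and> map f a = r} = prod_list (map (\<lambda>b. card {x\<in>X. f x = b}) r)"
proof (induction r)
  case Nil
  have "{a. set a \<subseteq> X \<and> map f a = []} = {[]}" by auto
  thus ?case by (simp only: list.map prod_list.Nil card.insert card.empty finite.emptyI) simp
next
  case (Cons b r)
  have "{a. set a \<subseteq> X \<and> map f a = b # r} =
        (\<lambda>(x, a). x # a) ` ({x\<in>X. f x = b} \<times> {a. set a \<subseteq> X \<and> map f a = r})"
    by (auto simp: image_iff)
  moreover have "inj_on (\<lambda>(x, a). x # a) ({x\<in>X. f x = b} \<times> {a. set a \<subseteq> X \<and> map f a = r})"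
    by (auto simp: inj_on_def)
  ultimately show ?case
    using Cons by (simp add: card_image card_cartesian_product)
qed

lemma card_tuples_periodic:
  assumes "finite X" "Q > 0" "periodic Q T"
  shows "card (tuples s X \<inter> T) =
    (\<Sum>r\<in>tuples s {0..<Q} \<inter> T. prod_list (map (\<lambda>b. card {x\<in>X. x mod Q = b}) r))"
proof -
  let ?F = "\<lambda>r. {a. set a \<subseteq> X \<and> map (\<lambda>b. b mod Q) a = r}"
  have fin: "finite (?F r)" for r
  proof (rule finite_subset)
    show "?F r \<subseteq> tuples (length r) X" by (auto simp: tuples_def)
  qed (use assms in \<open>auto intro: finite_tuples\<close>)
  have "tuples s X \<inter> T = (\<Union>r\<in>tuples s {0..<Q} \<inter> T. ?F r)"
    using assms by (auto simp: tuples_def periodic_def)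
  also have "card \<dots> = (\<Sum>r\<in>tuples s {0..<Q} \<inter> T. card (?F r))"
    using fin by (intro card_UN_disjoint) (auto intro!: finite_tuples)
  finally show ?thesis using assms(1) by (simp add: card_map_fibre)
qed

text \<open>The telescoping step needs the size of the product over the tail as well as its
  deviation, so the two-sided size bound is carried through the induction.\<close>

lemma prod_list_approx:
  fixes c :: "'a \<Rightarrow> real"
  assumes "\<And>b. b \<in> set r \<Longrightarrow> \<bar>c b - \<beta>\<bar> \<le> e" "\<And>b. b \<in> set r \<Longrightarrow> c b \<ge> 0" "\<beta> \<ge> 0" "e \<ge> 0"
  shows "\<bar>prod_list (map c r) - \<beta> ^ length r\<bar> \<le> (\<beta> + e) ^ length r - \<beta> ^ length r
    \<and> 0 \<le> prod_list (map c r) \<and> prod_list (map c r) \<le> (\<beta> + e) ^ length r"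
  using assms
proof (induction r)
  case Nil
  then show ?case by simp
next
  case (Cons b r)
  let ?P = "prod_list (map c r)" and ?n = "length r"
  have IH: "\<bar>?P - \<beta> ^ ?n\<bar> \<le> (\<beta> + e) ^ ?n - \<beta> ^ ?n" "0 \<le> ?P" "?P \<le> (\<beta> + e) ^ ?n"
    using Cons by auto
  have c: "\<bar>c b - \<beta>\<bar> \<le> e" "c b \<ge> 0" using Cons.prems by auto
  have "c b * ?P - \<beta> * \<beta> ^ ?n = (c b - \<beta>) * ?P + \<beta> * (?P - \<beta> ^ ?n)"
    by (simp add: algebra_simps)
  also have "\<bar>\<dots>\<bar> \<le> \<bar>c b - \<beta>\<bar> * ?P + \<beta> * \<bar>?P - \<beta> ^ ?n\<bar>"
    using IH(2) \<open>\<beta> \<ge> 0\<close> abs_triangle_ineq[of "(c b - \<beta>) * ?P" "\<beta> * (?P - \<beta> ^ ?n)"]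
    by (simp add: abs_mult)
  also have "\<dots> \<le> e * (\<beta> + e) ^ ?n + \<beta> * ((\<beta> + e) ^ ?n - \<beta> ^ ?n)"
    using IH c Cons.prems by (intro add_mono mult_mono) auto
  also have "\<dots> = (\<beta> + e) ^ Suc ?n - \<beta> ^ Suc ?n"
    by (simp add: algebra_simps)
  finally have 1: "\<bar>c b * ?P - \<beta> ^ Suc ?n\<bar> \<le> (\<beta> + e) ^ Suc ?n - \<beta> ^ Suc ?n" by simp
  moreover have "c b \<le> \<beta> + e" using c by linarith
  hence "c b * ?P \<le> (\<beta> + e) * (\<beta> + e) ^ ?n"
    using IH c Cons.prems by (intro mult_mono) auto
  ultimately show ?case using IH c by simp
qed

lemma power_diff_le_real:
  fixes x y :: real
  assumes "0 \<le> y" "y \<le> x"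
  shows "x ^ s - y ^ s \<le> real s * (x - y) * x ^ (s - 1)"
proof (cases s)
  case (Suc n)
  have "x ^ Suc n - y ^ Suc n = (x - y) * (\<Sum>p<Suc n. x ^ p * y ^ (n - p))"
    by (rule diff_power_eq_sum)
  also have "\<dots> \<le> (x - y) * (\<Sum>p<Suc n. x ^ n)"
  proof (intro mult_left_mono sum_mono)
    fix p assume "p \<in> {..<Suc n}"
    have "x ^ p * y ^ (n - p) \<le> x ^ p * x ^ (n - p)"
      using assms by (intro mult_left_mono power_mono) auto
    thus "x ^ p * y ^ (n - p) \<le> x ^ n" using \<open>p \<in> _\<close> by (simp flip: power_add)
  qed (use assms in auto)
  finally show ?thesis using Suc by (simp add: algebra_simps)
qed auto

text \<open>\<open>\<alpha>\<close> is the expected size of \<open>X\<close> (A or 2A), so each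
  residue class has \<alpha>/Q elements up to 2. Each of at most Q^s residue tuples then carries an
  error of order (\<alpha>/Q)^(s-1), which adds up to Q \<alpha>^(s-1).\<close>

lemma count_periodic:
  fixes \<alpha> :: real and Q :: int
  assumes X: "finite X" and Q: "Q > 0" and per: "periodic Q T" and \<alpha>: "of_int Q \<le> \<alpha>"
    and cnt: "\<And>r. r \<in> {0..<Q} \<Longrightarrow> \<bar>real (card {x\<in>X. x mod Q = r}) - \<alpha> / of_int Q\<bar> \<le> 2"
  shows "\<bar>real (card (tuples s X \<inter> T)) - dens s Q T * \<alpha> ^ s\<bar>
    \<le> 2 * real s * 3 ^ s * of_int Q * \<alpha> ^ (s - 1)"
proof -
  let ?c = "\<lambda>b. real (card {x\<in>X. x mod Q = b})"
  let ?R = "tuples s {0..<Q} \<inter> T"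
  define \<beta> where "\<beta> = \<alpha> / of_int Q"
  have \<beta>: "\<beta> \<ge> 1" using \<alpha> Q by (simp add: \<beta>_def)
  have prod_eq: "real (prod_list (map f r)) = prod_list (map (\<lambda>b. real (f b)) r)" for f and r :: "int list"
    by (induction r) auto
  have "real (card (tuples s X \<inter> T)) - dens s Q T * \<alpha> ^ s
      = (\<Sum>r\<in>?R. prod_list (map ?c r) - \<beta> ^ s)"
    using Q by (simp add: card_tuples_periodic[OF X Q per] prod_eq sum_subtractf dens_def \<beta>_def
        power_divide)
  also have "\<bar>\<dots>\<bar> \<le> (\<Sum>r\<in>?R. \<bar>prod_list (map ?c r) - \<beta> ^ s\<bar>)" by (rule sum_abs)
  also have "\<dots> \<le> (\<Sum>r\<in>?R. 2 * real s * 3 ^ (s - 1) * \<beta> ^ (s - 1))"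
  proof (rule sum_mono)
    fix r assume r: "r \<in> ?R"
    have "\<bar>prod_list (map ?c r) - \<beta> ^ length r\<bar> \<le> (\<beta> + 2) ^ length r - \<beta> ^ length r"
    proof (rule conjunct1[OF prod_list_approx])
      fix b assume "b \<in> set r"
      hence "b \<in> {0..<Q}" using r by (auto simp: tuples_def)
      thus "\<bar>?c b - \<beta>\<bar> \<le> 2" using cnt unfolding \<beta>_def by blast
    qed (use \<beta> in auto)
    also have "length r = s" using r by (auto simp: tuples_def)
    also have "(\<beta> + 2) ^ s - \<beta> ^ s \<le> real s * (\<beta> + 2 - \<beta>) * (\<beta> + 2) ^ (s - 1)"
      using \<beta> by (intro power_diff_le_real) auto
    \<comment> \<open>Here \<open>Q \<le> \<alpha>\<close> enters: it gives
      \<open>\<beta> \<ge> 1\<close>, hence \<open>\<beta> + 2 \<le> 3 * \<beta>\<close>.\<close>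
    also have "\<dots> \<le> real s * (\<beta> + 2 - \<beta>) * (3 * \<beta>) ^ (s - 1)"
      using \<beta> by (intro mult_left_mono power_mono) auto
    finally show "\<bar>prod_list (map ?c r) - \<beta> ^ s\<bar> \<le> 2 * real s * 3 ^ (s - 1) * \<beta> ^ (s - 1)"
      by (simp add: power_mult_distrib mult_ac)
  qed
  also have "\<dots> = real (card ?R) * (2 * real s * 3 ^ (s - 1) * \<beta> ^ (s - 1))" by simp
  also have "\<dots> \<le> of_int Q ^ s * (2 * real s * 3 ^ (s - 1) * \<beta> ^ (s - 1))"
    using card_tuples_Int_le[of Q s T] Q \<beta> by (intro mult_right_mono) auto
  also have "\<dots> = 2 * real s * 3 ^ (s - 1) * of_int Q * \<alpha> ^ (s - 1)"
    using Q by (cases s) (auto simp: \<beta>_def power_divide)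
  also have "\<dots> \<le> 2 * real s * 3 ^ s * of_int Q * \<alpha> ^ (s - 1)"
    using Q \<alpha> by (intro mult_right_mono mult_left_mono power_increasing) auto
  finally show ?thesis .
qed

lemma card_cong_atLeastAtMost:
  fixes A :: real and Q :: int
  assumes "A \<ge> 0" "Q > 0" "r \<in> {0..<Q}"
  shows "\<bar>real (card {x\<in>{1..\<lfloor>A\<rfloor>}. x mod Q = r}) - A / of_int Q\<bar> \<le> 1"
proof -
  define n where "n = (\<lfloor>A\<rfloor> - r) div Q"
  \<comment> \<open>The class of 0 starts at \<open>Q\<close> rather than at 0, since 0 lies outside
    the range.\<close>
  define l where "l = (if r = 0 then 1 else (0::int))"
  have "{x\<in>{1..\<lfloor>A\<rfloor>}. x mod Q = r} = (\<lambda>i. r + i * Q) ` {l..n}" (is "?L = ?R")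
  proof (intro equalityI subsetI)
    fix x assume x: "x \<in> ?L"
    have x_eq: "x - r = (x div Q) * Q"
      using x by (auto simp: minus_mod_eq_div_mult)
    have "x div Q = (x - r) div Q" using x_eq assms by simp
    also have "\<dots> \<le> n" unfolding n_def using x assms by (intro zdiv_mono1) auto
    finally have "x div Q \<le> n" .
    moreover have "x div Q \<ge> l"
    proof (cases "r = 0")
      case True
      have "x div Q \<noteq> 0" using x x_eq True by auto
      moreover have "x div Q \<ge> 0" using x assms by (simp add: pos_imp_zdiv_nonneg_iff)
      ultimately show ?thesis by (simp add: l_def)
    next
      case False
      thus ?thesis using x assms by (simp add: l_def pos_imp_zdiv_nonneg_iff)
    qed
    moreover have "x = r + (x div Q) * Q" using x_eq by simp
    ultimately show "x \<in> ?R" by auto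
  next
    fix x assume "x \<in> ?R"
    then obtain i where i: "x = r + i * Q" "l \<le> i" "i \<le> n" by (elim imageE) auto
    have "i * Q \<le> n * Q" using i assms by simp
    also have "\<dots> \<le> \<lfloor>A\<rfloor> - r" unfolding n_def
      using assms(2) by (simp add: minus_mod_eq_div_mult [symmetric])
    finally have "x \<le> \<lfloor>A\<rfloor>" using i by simp
    moreover have "x \<ge> 1"
    proof (cases "r = 0")
      case True
      hence "i * Q > 0" using i(2) assms(2) by (simp add: l_def)
      thus ?thesis using i True by simp
    next
      case False
      hence "i * Q \<ge> 0" using i(2) assms(2) by (simp add: l_def)
      thus ?thesis using i False assms by auto
    qed
    moreover have "x mod Q = r" using i assms by simp
    ultimately show "x \<in> ?L" by simp
  qed
  moreover have "inj_on (\<lambda>i. r + i * Q) {l..n}" using assms by (auto simp: inj_on_def)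
  ultimately have card: "card {x\<in>{1..\<lfloor>A\<rfloor>}. x mod Q = r} = nat (n + 1 - l)"
    by (simp add: card_image)
  have n1: "real_of_int n * Q \<le> A - r" 
  proof -
    have "n * Q \<le> \<lfloor>A\<rfloor> - r" unfolding n_def
      using assms(2) by (simp add: minus_mod_eq_div_mult [symmetric])
    hence "real_of_int (n * Q) \<le> real_of_int (\<lfloor>A\<rfloor> - r)" by (rule of_int_le_iff[THEN iffD2])
    thus ?thesis by simp linarith
  qed
  have n2: "A - r < real_of_int (n + 1) * Q"
  proof -
    have "\<lfloor>A\<rfloor> - r < (n + 1) * Q" unfolding n_def
      using assms(2) by (simp add: distrib_right minus_mod_eq_div_mult [symmetric])
    hence "\<lfloor>A\<rfloor> - r + 1 \<le> (n + 1) * Q" by simp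
    hence "real_of_int (\<lfloor>A\<rfloor> - r + 1) \<le> real_of_int ((n + 1) * Q)" by (rule of_int_le_iff[THEN iffD2])
    thus ?thesis by simp linarith
  qed
  have "- 1 < real_of_int n + 1 "
  proof -
    have "real_of_int (n + 1) * Q > - real_of_int Q" using n2 assms by auto
    hence "real_of_int (n + 2) * Q > 0" by (simp add: algebra_simps)
    thus ?thesis using assms by (simp add: zero_less_mult_iff)
  qed
  hence n0: "n \<ge> -1" by linarith
  have Q0: "real_of_int Q > 0" using assms by simp
  have a: "real_of_int n \<le> A / Q - real_of_int r / Q" "A / Q - real_of_int r / Q < real_of_int n + 1"
    using n1 n2 Q0 by (simp_all add: field_simps)
  have r: "0 \<le> real_of_int r / Q" "real_of_int r / Q < 1" "r = 0 \<Longrightarrow> real_of_int r / Q = 0"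
    using assms by auto
  have "n \<ge> 0" if "r = 0" using that assms by (simp add: n_def pos_imp_zdiv_nonneg_iff)
  hence "real (nat (n + 1 - l)) = real_of_int (n + 1 - l)" using n0 by (simp add: l_def)
  thus ?thesis using card a r by (auto simp: l_def abs_le_iff split: if_splits)
qed

text \<open>The flags select signs, so that one count covers the full box and the two one-signed
  orthants that the real condition excludes.\<close>

definition signed_range :: "bool \<Rightarrow> bool \<Rightarrow> real \<Rightarrow> int set" where
  "signed_range P N A = (if P then {1..\<lfloor>A\<rfloor>} else {}) \<union> (if N then {-\<lfloor>A\<rfloor>..-1} else {})"

lemma finite_signed_range [simp]: "finite (signed_range P N A)"
  by (simp add: signed_range_def)

lemma card_cong_signed_range:
  fixes A :: real and Q :: int
  assumes "A \<ge> 0" "Q > 0" "r \<in> {0..<Q}"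
  shows "\<bar>real (card {x\<in>signed_range P N A. x mod Q = r}) - (of_bool P + of_bool N) * A / of_int Q\<bar> \<le> 2"
proof -
  let ?P = "{x\<in>{1..\<lfloor>A\<rfloor>}. x mod Q = r}" and ?N = "{x\<in>{-\<lfloor>A\<rfloor>..-1}. x mod Q = r}"
  have 1: "\<bar>real (card ?P) - A / of_int Q\<bar> \<le> 1"
    by (rule card_cong_atLeastAtMost) fact+
  \<comment> \<open>Negation carries the class of r to that of -r and reduces the negative half to
    the positive one. Each half contributes an error of at most 1.\<close>
  have "?N = uminus ` {x\<in>{1..\<lfloor>A\<rfloor>}. x mod Q = (- r) mod Q}" (is "_ = _ ` ?N'")
  proof (intro equalityI subsetI)
    fix x assume "x \<in> ?N"
    moreover from this have "(- x) mod Q = (- r) mod Q" using mod_minus_eq[of x Q] by simp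
    ultimately have "- x \<in> ?N'" by auto
    thus "x \<in> uminus ` ?N'" by (metis (no_types, lifting) image_eqI minus_minus)
  next
    fix x assume "x \<in> uminus ` ?N'"
    then obtain y where y: "x = - y" "y \<in> ?N'" by auto
    hence "y mod Q = (- r) mod Q" by auto
    hence "(- y) mod Q = r mod Q"
      using mod_minus_eq[of y Q] mod_minus_eq[of "- r" Q] by simp
    thus "x \<in> ?N" using y assms by auto
  qed
  hence "card ?N = card ?N'" by (simp add: card_image)
  moreover have "\<bar>real (card ?N') - A / of_int Q\<bar> \<le> 1"
    using assms by (intro card_cong_atLeastAtMost) auto
  ultimately have 2: "\<bar>real (card ?N) - A / of_int Q\<bar> \<le> 1" by simp
  have fin: "finite ?P" "finite ?N" by (rule finite_Collect_conjI; simp)+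
  have eq: "{x\<in>signed_range P N A. x mod Q = r} = (if P then ?P else {}) \<union> (if N then ?N else {})"
    by (auto simp: signed_range_def)
  have "card {x\<in>signed_range P N A. x mod Q = r} = card (if P then ?P else {}) + card (if N then ?N else {})"
    unfolding eq using fin by (intro card_Un_disjoint) (auto split: if_splits)
  hence eq': "real (card {x\<in>signed_range P N A. x mod Q = r}) = of_bool P * real (card ?P) + of_bool N * real (card ?N)"
    by simp
  show ?thesis unfolding eq' using 1 2 by (cases P; cases N) (simp_all add: abs_le_iff)
qed

lemma count_periodic_signed:
  fixes A :: real
  assumes "Q > 0" "periodic Q T" "of_int Q \<le> A" "P \<or> N"
  shows "\<bar>real (card (tuples s (signed_range P N A) \<inter> T)) - dens s Q T * ((of_bool P + of_bool N) * A) ^ s\<bar>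
    \<le> 2 * real s * 6 ^ s * of_int Q * A ^ (s - 1)"
proof -
  have A: "A > 0" using assms(1,3) by (meson less_le_trans of_int_0_less_iff)
  let ?c = "of_bool P + of_bool N :: real"
  have c: "1 \<le> ?c" "?c \<le> 2" using assms(4) by auto
  have "\<bar>real (card (tuples s (signed_range P N A) \<inter> T)) - dens s Q T * (?c * A) ^ s\<bar>
    \<le> 2 * real s * 3 ^ s * of_int Q * (?c * A) ^ (s - 1)"
  proof (rule count_periodic)
    have "1 * A \<le> ?c * A" using A c by (intro mult_right_mono) auto
    thus "of_int Q \<le> ?c * A" using assms(3) by simp
    show "\<bar>real (card {x\<in>signed_range P N A. x mod Q = r}) - ?c * A / of_int Q\<bar> \<le> 2"
      if "r \<in> {0..<Q}" for r
      using A assms(1) that by (intro card_cong_signed_range) auto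
  qed (use assms in auto)
  also have "\<dots> \<le> 2 * real s * 3 ^ s * of_int Q * (2 * A) ^ (s - 1)"
    using A c assms(1) by (intro mult_left_mono power_mono mult_right_mono) auto
  also have "\<dots> = 2 * real s * of_int Q * A ^ (s - 1) * (3 ^ s * 2 ^ (s - 1))"
    by (simp add: power_mult_distrib mult_ac)
  also have "\<dots> \<le> 2 * real s * of_int Q * A ^ (s - 1) * (3 ^ s * 2 ^ s)"
    using A assms(1) by (intro mult_left_mono power_increasing) auto
  also have "\<dots> = 2 * real s * 6 ^ s * of_int Q * A ^ (s - 1)"
    using power_mult_distrib[of "3::real" 2 s] by simp
  finally show ?thesis .
qed

lemma box_eq: "box s A = tuples s (signed_range True True A)"
proof -
  have "b \<noteq> 0 \<and> real_of_int \<bar>b\<bar> \<le> A \<longleftrightarrow> b \<in> signed_range True True A" for b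
  proof -
    have "real_of_int \<bar>b\<bar> \<le> A \<longleftrightarrow> \<bar>b\<bar> \<le> \<lfloor>A\<rfloor>" by (simp add: le_floor_iff)
    thus ?thesis by (auto simp: signed_range_def)
  qed
  thus ?thesis by (auto simp: box_def tuples_def)
qed

lemma finite_box [simp]: "finite (box s A)"
  by (simp add: box_eq finite_tuples)

text \<open>Since 0 is excluded, there are at most 2 floor(A/d) multiples. The bound has no additive
  error and so remains good for \<open>d\<close> of the size of A, as in a sum over primes up to
  A.\<close>

lemma card_dvd_signed_range:
  assumes "A \<ge> 0" "d > 0"
  shows "real (card {x\<in>signed_range True True A. d dvd x}) \<le> 2 * A / of_int d"
proof -
  have "{x\<in>signed_range True True A. d dvd x} \<subseteq> (\<lambda>i. d * i) ` ({-(\<lfloor>A\<rfloor> div d)..\<lfloor>A\<rfloor> div d} - {0})"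
  proof
    fix x assume x: "x \<in> {x\<in>signed_range True True A. d dvd x}"
    then obtain i where i: "x = d * i" by blast
    have "x \<noteq> 0" "\<bar>x\<bar> \<le> \<lfloor>A\<rfloor>" using x by (auto simp: signed_range_def)
    hence "i \<noteq> 0" "d * \<bar>i\<bar> \<le> \<lfloor>A\<rfloor>" using i assms by (auto simp: abs_mult)
    hence "\<bar>i\<bar> \<le> \<lfloor>A\<rfloor> div d"
      using assms zdiv_mono1[of "d * \<bar>i\<bar>" "\<lfloor>A\<rfloor>" d] by simp
    thus "x \<in> (\<lambda>i. d * i) ` ({-(\<lfloor>A\<rfloor> div d)..\<lfloor>A\<rfloor> div d} - {0})"
      unfolding i using \<open>i \<noteq> 0\<close> by (intro imageI) auto
  qed
  hence "card {x\<in>signed_range True True A. d dvd x} \<le> card ({-(\<lfloor>A\<rfloor> div d)..\<lfloor>A\<rfloor> div d} - {0})"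
    by (meson card_image_le card_mono finite_Diff finite_atLeastAtMost_int finite_imageI order_trans)
  also have "\<dots> = nat (2 * (\<lfloor>A\<rfloor> div d))"
    using assms by (subst card_Diff_singleton) (auto simp: pos_imp_zdiv_nonneg_iff)
  finally have "real (card {x\<in>signed_range True True A. d dvd x}) \<le> real (nat (2 * (\<lfloor>A\<rfloor> div d)))"
    by (rule of_nat_mono)
  also have "\<dots> = 2 * of_int (\<lfloor>A\<rfloor> div d)"
    using assms by (simp add: pos_imp_zdiv_nonneg_iff)
  also have "\<dots> \<le> 2 * (A / of_int d)"
  proof -
    have "of_int (\<lfloor>A\<rfloor> div d) \<le> real_of_int \<lfloor>A\<rfloor> / of_int d" by (simp add: real_of_int_div4)
    also have "\<dots> \<le> A / of_int d" using assms by (intro divide_right_mono) auto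
    finally show ?thesis by simp
  qed
  finally show ?thesis by simp
qed

lemma card_box_all_dvd:
  assumes "A \<ge> 0" "d > 0"
  shows "real (card (box s A \<inter> {a. \<forall>b\<in>set a. d dvd b})) \<le> (2 * A / of_int d) ^ s"
proof -
  have "box s A \<inter> {a. \<forall>b\<in>set a. d dvd b} = tuples s {x\<in>signed_range True True A. d dvd x}"
    by (auto simp: box_eq tuples_def)
  hence "real (card (box s A \<inter> {a. \<forall>b\<in>set a. d dvd b}))
      = real (card {x\<in>signed_range True True A. d dvd x}) ^ s"
    by (simp add: card_tuples)
  also have "\<dots> \<le> (2 * A / of_int d) ^ s"
    using card_dvd_signed_range[OF assms] by (intro power_mono) auto
  finally show ?thesis .
qed

lemma card_signed_range_le: "A \<ge> 0 \<Longrightarrow> real (card (signed_range True True A)) \<le> 2 * A"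
  using card_dvd_signed_range[of A 1] by simp

text \<open>At least \<open>d\<close> of the t + d entries fail \<open>P\<close>; the factor 2^(t+d)
  bounds the number of position patterns.\<close>

lemma card_tuples_few:
  assumes "finite X"
  shows "card {a\<in>tuples (t + d) X. length (filter P a) \<le> t}
    \<le> 2 ^ (t + d) * card X ^ t * card {x\<in>X. \<not> P x} ^ d"
proof (induction "t + d" arbitrary: t d)
  case 0
  have "{a\<in>tuples 0 X. length (filter P a) \<le> 0} = {[]}" by auto
  then show ?case using 0 by simp
next
  case (Suc n)
  let ?X0 = "{x\<in>X. \<not> P x}"
  let ?C = "\<lambda>t d. {a\<in>tuples (t + d) X. length (filter P a) \<le> t}"
  have fin: "finite (?C t d)" for t d using assms finite_tuples by simp
  consider "t = 0" | "d = 0" | t' d' where "t = Suc t'" "d = Suc d'" by (metis not0_implies_Suc)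
  thus ?case
  proof cases
    case 1
    have "?C t d = tuples d ?X0" using 1 by (auto simp: tuples_def filter_empty_conv)
    thus ?thesis using 1 assms by (simp add: card_tuples)
  next
    case 2
    have "card (?C t d) \<le> card (tuples t X)"
      using 2 assms by (intro card_mono finite_tuples) auto
    also have "\<dots> \<le> 2 ^ t * card X ^ t" using assms by (simp add: card_tuples)
    finally show ?thesis using 2 by simp
  next
    case 3
    \<comment> \<open>A failing head uses up one of the \<open>d\<close> forced failures, any other
      head one of the \<open>t\<close> allowed successes; in the second set the head is simply left
      unrestricted in \<open>X\<close>.\<close>
    have "?C t d \<subseteq> (\<lambda>(x, a). x # a) ` (?X0 \<times> ?C t d') \<union> (\<lambda>(x, a). x # a) ` (X \<times> ?C t' d)"
    proof
      fix a assume a: "a \<in> ?C t d"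
      then obtain x b where "a = x # b" "length b = t + d'" using 3
        by (auto simp: tuples_def length_Suc_conv)
      thus "a \<in> (\<lambda>(x, a). x # a) ` (?X0 \<times> ?C t d') \<union> (\<lambda>(x, a). x # a) ` (X \<times> ?C t' d)"
        using a 3 by (cases "P x") (auto simp: tuples_def)
    qed
    hence "card (?C t d) \<le> card ((\<lambda>(x, a). x # a) ` (?X0 \<times> ?C t d') \<union> (\<lambda>(x, a). x # a) ` (X \<times> ?C t' d))"
      using assms fin by (intro card_mono) auto
    also have "\<dots> \<le> card (?X0 \<times> ?C t d') + card (X \<times> ?C t' d)"
      using assms fin by (intro order.trans[OF card_Un_le] add_mono card_image_le) auto
    also have "\<dots> \<le> card ?X0 * (2 ^ n * card X ^ t * card ?X0 ^ d') + card X * (2 ^ n * card X ^ t' * card ?X0 ^ d)"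
      unfolding card_cartesian_product using 3 Suc.hyps(1)[of t d'] Suc.hyps(1)[of t' d] Suc.hyps(2)
      by (intro add_mono mult_left_mono) auto
    also have "\<dots> = 2 ^ (t + d) * card X ^ t * card ?X0 ^ d"
      using 3 Suc.hyps(2) by (simp flip: Suc.hyps(2) add: algebra_simps)
    finally show ?thesis .
  qed
qed

text \<open>Two free entries and s - 2 multiples of \<open>d\<close>: this is the source of the
  exponent s - 2 at large primes.\<close>

lemma card_box_few_nondvd:
  assumes "A \<ge> 0" "d > 0" "s \<ge> 2"
  shows "real (card (box s A \<inter> {a. length (filter (\<lambda>b. \<not> d dvd b) a) \<le> 2})) \<le> (4 * A) ^ s / of_int d ^ (s - 2)"
proof -
  let ?X = "signed_range True True A"
  have s: "2 + (s - 2) = s" using assms by simp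
  have "box s A \<inter> {a. length (filter (\<lambda>b. \<not> d dvd b) a) \<le> 2} =
        {a\<in>tuples s ?X. length (filter (\<lambda>b. \<not> d dvd b) a) \<le> 2}"
    by (auto simp: box_eq)
  hence "card (box s A \<inter> {a. length (filter (\<lambda>b. \<not> d dvd b) a) \<le> 2})
     \<le> 2 ^ s * card ?X ^ 2 * card {x\<in>?X. \<not> \<not> d dvd x} ^ (s - 2)"
    using card_tuples_few[of ?X 2 "s - 2" "\<lambda>b. \<not> d dvd b"] unfolding s by simp
  hence "real (card (box s A \<inter> {a. length (filter (\<lambda>b. \<not> d dvd b) a) \<le> 2}))
     \<le> real (2 ^ s * card ?X ^ 2 * card {x\<in>?X. d dvd x} ^ (s - 2))" by (simp only: of_nat_le_iff not_not)
  also have "\<dots> \<le> 2 ^ s * (2 * A) ^ 2 * (2 * A / of_int d) ^ (s - 2)"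
    using card_dvd_signed_range[OF assms(1,2)] card_signed_range_le[OF assms(1)]
    unfolding of_nat_mult of_nat_power
    by (intro mult_mono power_mono mult_nonneg_nonneg) auto
  also have "\<dots> = 2 ^ s * (2 * A) ^ (2 + (s - 2)) / of_int d ^ (s - 2)"
    unfolding power_divide power_add by simp
  also have "2 ^ s * (2 * A) ^ (2 + (s - 2)) = (4 * A) ^ s" unfolding s
    by (subst power_mult_distrib [symmetric]) simp
  finally show ?thesis .
qed

section \<open>Hensel lifting\<close>


text \<open>The target \<open>c\<close> is arbitrary because splitting off one coefficient, as in
  \<open>unit_rep_Cons\<close>, shifts it.\<close>

definition unit_rep :: "nat \<Rightarrow> nat \<Rightarrow> int \<Rightarrow> int list \<Rightarrow> int \<Rightarrow> bool" where
  "unit_rep p k M a c \<longleftrightarrow>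
     (\<exists>x :: nat \<Rightarrow> int. (\<forall>j<length a. \<not> int p dvd x j) \<and> M dvd (\<Sum>j<length a. a ! j * x j ^ k) - c)"

lemma unit_rep_Nil [simp]: "unit_rep p k M [] c \<longleftrightarrow> M dvd c"
  by (simp add: unit_rep_def)

lemma unit_rep_Cons:
  "unit_rep p k M (u # a) c \<longleftrightarrow> (\<exists>y. \<not> int p dvd y \<and> unit_rep p k M a (c - u * y ^ k))"
proof
  assume "unit_rep p k M (u # a) c"
  then obtain x where x: "\<And>j. j < Suc (length a) \<Longrightarrow> \<not> int p dvd x j"
      "M dvd (\<Sum>j<Suc (length a). (u # a) ! j * x j ^ k) - c"
    by (auto simp: unit_rep_def)
  have "M dvd (\<Sum>j<length a. a ! j * x (Suc j) ^ k) - (c - u * x 0 ^ k)"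
    using x(2) by (simp add: sum.lessThan_Suc_shift algebra_simps del: sum.lessThan_Suc)
  hence "unit_rep p k M a (c - u * x 0 ^ k)"
    unfolding unit_rep_def using x(1) by (intro exI[of _ "\<lambda>j. x (Suc j)"]) auto
  with x(1)[of 0] show "\<exists>y. \<not> int p dvd y \<and> unit_rep p k M a (c - u * y ^ k)" by auto
next
  assume "\<exists>y. \<not> int p dvd y \<and> unit_rep p k M a (c - u * y ^ k)"
  then obtain y x where y: "\<not> int p dvd y" and x: "\<And>j. j < length a \<Longrightarrow> \<not> int p dvd x j"
      "M dvd (\<Sum>j<length a. a ! j * x j ^ k) - (c - u * y ^ k)"
    by (auto simp: unit_rep_def)
  have "M dvd (\<Sum>j<Suc (length a). (u # a) ! j * case_nat y x j ^ k) - c"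
    using x(2) by (simp add: sum.lessThan_Suc_shift algebra_simps del: sum.lessThan_Suc)
  moreover have "\<forall>j<Suc (length a). \<not> int p dvd case_nat y x j"
    using x(1) y by (auto split: nat.split)
  ultimately show "unit_rep p k M (u # a) c"
    unfolding unit_rep_def by (intro exI[of _ "case_nat y x"]) auto
qed

lemma unit_rep_mod: "unit_rep p k M (map (\<lambda>b. b mod M) a) c \<longleftrightarrow> unit_rep p k M a c"
proof -
  have "M dvd (\<Sum>j<length a. map (\<lambda>b. b mod M) a ! j * x j ^ k) - c
    \<longleftrightarrow> M dvd (\<Sum>j<length a. a ! j * x j ^ k) - c" for x :: "nat \<Rightarrow> int"
  proof -
    have "[(\<Sum>j<length a. map (\<lambda>b. b mod M) a ! j * x j ^ k) = (\<Sum>j<length a. a ! j * x j ^ k)] (mod M)"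
      by (intro cong_sum cong_mult) (auto simp: cong_def)
    hence "[(\<Sum>j<length a. map (\<lambda>b. b mod M) a ! j * x j ^ k) - c = (\<Sum>j<length a. a ! j * x j ^ k) - c] (mod M)"
      by (intro cong_diff) auto
    thus ?thesis by (simp only: cong_def dvd_eq_mod_eq_0)
  qed
  thus ?thesis by (simp add: unit_rep_def)
qed

text \<open>Second-order Taylor expansion whose remainder is an integer multiple of h^2, which keeps
  the Hensel argument inside the integers.\<close>

lemma power_add_expand:
  fixes y h :: int
  shows "\<exists>W. (y + h) ^ Suc k = y ^ Suc k + int (Suc k) * y ^ k * h + h ^ 2 * W"
proof (induction k)
  case 0
  show ?case by (intro exI[of _ 0]) simp
next
  case (Suc k)
  then obtain W where W: "(y + h) ^ Suc k = y ^ Suc k + int (Suc k) * y ^ k * h + h ^ 2 * W" by blast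
  have "(y + h) ^ Suc (Suc k) = (y + h) * (y ^ Suc k + int (Suc k) * y ^ k * h + h ^ 2 * W)"
    using W by simp
  also have "\<dots> = y ^ Suc (Suc k) + int (Suc (Suc k)) * y ^ Suc k * h
      + h ^ 2 * (int (Suc k) * y ^ k + (y + h) * W)"
    by (simp add: algebra_simps power2_eq_square)
  finally show ?case by blast
qed

lemma padic_int_const:
  assumes "p > 1"
  shows "padic_int p (\<lambda>n. c mod int p ^ n)" "padic_unit p (\<lambda>n. c mod int p ^ n) \<longleftrightarrow> \<not> int p dvd c"
proof -
  have "c mod int p ^ Suc n mod int p ^ n = c mod int p ^ n" for n
    by (intro mod_mod_cancel) simp
  thus "padic_int p (\<lambda>n. c mod int p ^ n)" using assms by (auto simp only: padic_int_def) auto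
qed (auto simp: padic_unit_def dvd_eq_mod_eq_0)

text \<open>Newton correction. With \<tau> the exact power of \<open>p\<close> in \<open>k\<close>,
  the derivative a k y^(k-1) has valuation \<tau>, so moving \<open>y\<close> by multiples of
  p^(m-\<tau>) moves the form in steps of p^m up to a quadratic error. One digit is chosen to gain
  one power of \<open>p\<close>.\<close>

lemma hensel_step:
  fixes a y R :: int
  assumes p: "prime p" and k: "k = p ^ \<tau> * k'" "\<not> p dvd k'" and a: "\<not> int p dvd a" and y: "\<not> int p dvd y"
    and m: "m \<ge> 2 * \<tau> + 1" and dvd: "int p ^ m dvd a * y ^ k + R"
  shows "\<exists>y'. int p ^ (m - \<tau>) dvd y' - y \<and> int p ^ Suc m dvd a * y' ^ k + R"
proof -
  have "k > 0" using k p by (auto intro!: Nat.gr0I simp: prime_gt_0_nat)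
  then obtain k1 where k1: "k = Suc k1" using gr0_conv_Suc by blast
  have pint: "prime (int p)" using p by simp
  obtain f where f: "a * y ^ k + R = int p ^ m * f" using dvd by blast
  \<comment> \<open>The unit part of the derivative; its inverse \<open>u\<close> modulo
    \<open>p\<close> determines the correction digit \<open>t\<close>.\<close>
  define c where "c = a * int k' * y ^ k1"
  have "\<not> int p dvd c" using a y k(2) pint
    by (auto simp: c_def prime_dvd_mult_iff dest: prime_dvd_power[OF pint])
  hence "coprime c (int p)" using pint by (metis coprime_commute prime_imp_coprime)
  then obtain u where u: "[c * u = 1] (mod int p)" using cong_solve_coprime_int by blast
  define t where "t = - f * u"
  have "[c * t = - f * (c * u)] (mod int p)" by (simp add: t_def algebra_simps)
  also have "[- f * (c * u) = - f * 1] (mod int p)" using u by (intro cong_mult) auto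
  finally have "int p dvd c * t - - f" by (simp add: cong_iff_dvd_diff)
  hence t: "int p dvd f + c * t" by (simp add: algebra_simps)
  define h where "h = int p ^ (m - \<tau>) * t"
  obtain W where W: "(y + h) ^ k = y ^ k + int k * y ^ k1 * h + h ^ 2 * W"
    using power_add_expand[of y h k1] k1 by auto
  have "int p ^ \<tau> * int p ^ (m - \<tau>) = int p ^ m" using m by (simp flip: power_add)
  hence kh: "int k * y ^ k1 * h * a = int p ^ m * (c * t)"
    unfolding h_def c_def k(1) by (simp add: mult_ac)
  have "a * (y + h) ^ k + R = (a * y ^ k + R) + int k * y ^ k1 * h * a + h ^ 2 * (W * a)"
    unfolding W by (simp add: algebra_simps)
  also have "\<dots> = int p ^ m * (f + c * t) + h ^ 2 * (W * a)"
    unfolding f kh by (simp add: algebra_simps)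
  finally have eq: "a * (y + h) ^ k + R = int p ^ m * (f + c * t) + h ^ 2 * (W * a)" .
  have "int p ^ Suc m dvd int p ^ m * (f + c * t)" using t by (simp add: mult_dvd_mono mult.commute)
  \<comment> \<open>The quadratic term is harmless because 2(m - \<tau>) \<ge> m + 1, which is
    exactly m \<ge> 2\<tau> + 1.\<close>
  moreover have "int p ^ Suc m dvd h ^ 2"
  proof -
    have "int p ^ Suc m dvd int p ^ (2 * (m - \<tau>))" using m by (intro le_imp_power_dvd) auto
    also have "int p ^ (2 * (m - \<tau>)) dvd h ^ 2"
      by (simp add: h_def power_mult_distrib power_mult mult.commute)
    finally show ?thesis .
  qed
  ultimately have "int p ^ Suc m dvd a * (y + h) ^ k + R" unfolding eq by auto
  thus ?thesis by (intro exI[of _ "y + h"]) (auto simp: h_def)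
qed

text \<open>\<open>R\<close> collects the other terms, whose variables stay fixed while a single
  variable is lifted. Consecutive iterates differ by multiples of p^(m+i-\<tau>), an exponent of at
  least i + 1, so their truncations form a compatible sequence.\<close>

lemma hensel_padic:
  fixes a y R :: int
  assumes p: "prime p" and k: "k = p ^ \<tau> * k'" "\<not> p dvd k'" and a: "\<not> int p dvd a" and y: "\<not> int p dvd y"
    and m: "m \<ge> 2 * \<tau> + 1" and dvd: "int p ^ m dvd a * y ^ k + R"
  shows "\<exists>z. padic_int p z \<and> padic_unit p z \<and> (\<forall>n. int p ^ n dvd a * z n ^ k + R)"
proof -
  have p1: "p > 1" using p prime_gt_1_nat by blast
  have "\<exists>Y. \<forall>i. (int p ^ (m + i) dvd a * Y i ^ k + R \<and> \<not> int p dvd Y i)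
      \<and> int p ^ (m + i - \<tau>) dvd Y (Suc i) - Y i"
  proof (rule dependent_nat_choice)
    show "\<exists>x. int p ^ (m + 0) dvd a * x ^ k + R \<and> \<not> int p dvd x" using dvd y by auto
  next
    fix x i assume x: "int p ^ (m + i) dvd a * x ^ k + R \<and> \<not> int p dvd x"
    then obtain x' where x': "int p ^ (m + i - \<tau>) dvd x' - x" "int p ^ Suc (m + i) dvd a * x' ^ k + R"
      using hensel_step[OF p k a, of x "m + i" R] m by auto
    have "int p ^ 1 dvd int p ^ (m + i - \<tau>)" using m by (intro le_imp_power_dvd) auto
    hence "int p dvd x' - x" using x'(1) by (metis dvd_trans power_one_right)
    hence "\<not> int p dvd x'" using x by (metis dvd_diff_right_iff)
    thus "\<exists>x'. (int p ^ (m + Suc i) dvd a * x' ^ k + R \<and> \<not> int p dvd x')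
        \<and> int p ^ (m + i - \<tau>) dvd x' - x" using x' by auto
  qed
  then obtain Y where Y: "\<And>i. int p ^ (m + i) dvd a * Y i ^ k + R" "\<And>i. \<not> int p dvd Y i"
      "\<And>i. int p ^ (m + i - \<tau>) dvd Y (Suc i) - Y i" by blast
  define z where "z = (\<lambda>n. Y n mod int p ^ n)"
  have "padic_int p z"
    unfolding padic_int_def
  proof (intro conjI allI)
    fix n
    show "0 \<le> z n" "z n < int p ^ n" using p1 by (auto simp: z_def)
    have "int p ^ n dvd int p ^ (m + n - \<tau>)" using m by (intro le_imp_power_dvd) auto
    hence "int p ^ n dvd Y (Suc n) - Y n" using Y(3) dvd_trans by blast
    hence "Y (Suc n) mod int p ^ n = Y n mod int p ^ n" by (simp add: mod_eq_dvd_iff)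
    thus "z (Suc n) mod int p ^ n = z n" by (simp add: z_def mod_mod_cancel)
  qed
  moreover have "padic_unit p z" using Y(2)[of 1]
    by (auto simp: padic_unit_def z_def dvd_eq_mod_eq_0)
  moreover have "int p ^ n dvd a * z n ^ k + R" for n
  proof -
    have "int p ^ n dvd a * Y n ^ k + R"
      using Y(1)[of n] by (meson dvd_trans le_add2 le_imp_power_dvd)
    moreover have "[a * z n ^ k + R = a * Y n ^ k + R] (mod int p ^ n)"
      unfolding z_def by (intro cong_add cong_mult cong_pow) (auto simp: cong_def)
    ultimately show ?thesis by (simp add: cong_def dvd_eq_mod_eq_0)
  qed
  ultimately show ?thesis by blast
qed

text \<open>A periodic inner approximation to the p-adically solvable tuples. If some entry avoids
  p^l, the common power p^v of the entries has v < l; after division by p^v, a congruence modulo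
  p^(2\<tau>+l) with \<tau> = \<open>multiplicity p k\<close> still holds to the 2\<tau> + 1 digits
  that Hensel lifting needs.\<close>

definition approx_set :: "nat \<Rightarrow> nat \<Rightarrow> nat \<Rightarrow> int list set" where
  "approx_set p k l = {a. \<not> (\<forall>b\<in>set a. int p ^ l dvd b) \<and>
      unit_rep p k (int p ^ (2 * multiplicity p k + l)) a 0}"

lemma periodic_approx_set: "periodic (int p ^ (2 * multiplicity p k + l)) (approx_set p k l)"
proof -
  have "int p ^ l dvd b mod int p ^ (2 * multiplicity p k + l) \<longleftrightarrow> int p ^ l dvd b" for b
    by (intro dvd_mod_iff) (simp add: le_imp_power_dvd)
  thus ?thesis by (simp add: periodic_def approx_set_def unit_rep_mod)
qed

lemma approx_set_solvable:
  assumes p: "prime p" and k: "k > 0" and a: "a \<in> approx_set p k l"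
  shows "padic_unit_solvable p k a"
proof -
  define \<tau> where "\<tau> = multiplicity p k"
  have p1: "p > 1" using p prime_gt_1_nat by blast
  obtain k' where k': "k = p ^ \<tau> * k'" "\<not> p dvd k'"
    unfolding \<tau>_def using multiplicity_decompose'[of k p] k p1 by (metis gr0I nat_dvd_1_iff_1 less_irrefl)
  have nd: "\<not> (\<forall>b\<in>set a. int p ^ l dvd b)"
    and ur: "unit_rep p k (int p ^ (2 * \<tau> + l)) a 0"
    using a by (auto simp: approx_set_def \<tau>_def)
  define D where "D = (\<lambda>v. \<forall>b\<in>set a. int p ^ v dvd b)"
  \<comment> \<open>\<open>v\<close> is the exact common power of \<open>p\<close> in the entries.
    Some entry becomes a unit after division by p^v, and its variable is the one to be
    lifted.\<close>
  obtain v where v: "v < l" "D v" "\<not> D (Suc v)"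
    using ex_least_nat_less[of "\<lambda>v. \<not> D v" l] nd by (auto simp: D_def)
  obtain i where i: "i < length a" "\<not> int p ^ Suc v dvd a ! i"
    using v(3) by (auto simp: D_def in_set_conv_nth)
  define a' where "a' = (\<lambda>j. a ! j div int p ^ v)"
  have a': "a ! j = int p ^ v * a' j" if "j < length a" for j
    using v(2) that by (auto simp: D_def a'_def)
  have ai: "\<not> int p dvd a' i"
    using i a'[OF i(1)] p1 by (auto simp: mult.commute)
  obtain x where x: "\<And>j. j < length a \<Longrightarrow> \<not> int p dvd x j"
      "int p ^ (2 * \<tau> + l) dvd (\<Sum>j<length a. a ! j * x j ^ k)"
    using ur by (auto simp: unit_rep_def)
  define R where "R = (\<Sum>j\<in>{..<length a} - {i}. a' j * x j ^ k)"
  have "(\<Sum>j<length a. a ! j * x j ^ k) = int p ^ v * (\<Sum>j<length a. a' j * x j ^ k)"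
    unfolding sum_distrib_left by (intro sum.cong) (auto simp: a' mult_ac)
  also have "(\<Sum>j<length a. a' j * x j ^ k) = a' i * x i ^ k + R"
    unfolding R_def using i by (intro sum.remove) auto
  finally have "int p ^ v * int p ^ (2 * \<tau> + l - v) dvd int p ^ v * (a' i * x i ^ k + R)"
    using x(2) v(1) by (simp flip: power_add)
  hence "int p ^ (2 * \<tau> + l - v) dvd a' i * x i ^ k + R" using p1 by simp
  moreover have "2 * \<tau> + l - v \<ge> 2 * \<tau> + 1" using v(1) by simp
  ultimately obtain z where z: "padic_int p z" "padic_unit p z" "\<And>n. int p ^ n dvd a' i * z n ^ k + R"
    using hensel_padic[OF p k' ai x(1)[OF i(1)], of "2 * \<tau> + l - v" R] by blast
  \<comment> \<open>Every variable except number \<open>i\<close> remains an ordinary integer,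
    embedded as a p-adic one.\<close>
  define X where "X = (\<lambda>j n. if j = i then z n else x j mod int p ^ n)"
  have "padic_int p (X j) \<and> padic_unit p (X j)" if "j < length a" for j
  proof (cases "j = i")
    case True
    thus ?thesis using z by (simp add: X_def)
  next
    case False
    thus ?thesis using padic_int_const[OF p1] x(1)[OF that] by (simp add: X_def)
  qed
  moreover have "(\<Sum>j<length a. a ! j * X j n ^ k) mod int p ^ n = 0" for n
  proof -
    have "(\<Sum>j<length a. a ! j * X j n ^ k) = int p ^ v * (\<Sum>j<length a. a' j * X j n ^ k)"
      unfolding sum_distrib_left by (intro sum.cong) (auto simp: a' mult_ac)
    also have "(\<Sum>j<length a. a' j * X j n ^ k)
        = a' i * X i n ^ k + (\<Sum>j\<in>{..<length a} - {i}. a' j * X j n ^ k)"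
      using i by (intro sum.remove) auto
    also have "a' i * X i n ^ k = a' i * z n ^ k" by (simp add: X_def)
    finally have eq: "(\<Sum>j<length a. a ! j * X j n ^ k)
      = int p ^ v * (a' i * z n ^ k + (\<Sum>j\<in>{..<length a} - {i}. a' j * X j n ^ k))" .
    have "[(\<Sum>j\<in>{..<length a} - {i}. a' j * X j n ^ k) = R] (mod int p ^ n)"
      unfolding R_def X_def by (intro cong_sum cong_mult cong_pow) (auto simp: cong_def)
    hence "[a' i * z n ^ k + (\<Sum>j\<in>{..<length a} - {i}. a' j * X j n ^ k) = a' i * z n ^ k + R] (mod int p ^ n)"
      by (intro cong_add) auto
    hence "int p ^ n dvd a' i * z n ^ k + (\<Sum>j\<in>{..<length a} - {i}. a' j * X j n ^ k)"
      using z(3)[of n] by (simp add: cong_def dvd_eq_mod_eq_0)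
    thus ?thesis unfolding eq by auto
  qed
  ultimately show ?thesis unfolding padic_unit_solvable_def by blast
qed

lemma padic_int_cong:
  assumes "padic_int p x" "m \<le> n"
  shows "x n mod int p ^ m = x m"
  using assms(2)
proof (induction n rule: dec_induct)
  case base
  have "0 \<le> x m" "x m < int p ^ m" using assms(1) by (auto simp: padic_int_def)
  thus ?case by simp
next
  case (step n)
  have "x (Suc n) mod int p ^ m = (x (Suc n) mod int p ^ n) mod int p ^ m"
    using step.hyps by (simp add: mod_mod_cancel le_imp_power_dvd)
  also have "x (Suc n) mod int p ^ n = x n" using assms(1) by (auto simp: padic_int_def)
  finally show ?case using step.IH by simp
qed

text \<open>By truncating a p-adic solution: the approximation misses only tuples divisible by p^l
  throughout. For \<open>l = 0\<close> every tuple is of that kind.\<close>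

lemma solvable_approx_set:
  assumes "padic_unit_solvable p k a"
  shows "a \<in> approx_set p k l \<or> (\<forall>b\<in>set a. int p ^ l dvd b)"
proof (cases "l = 0")
  case False
  define n where "n = 2 * multiplicity p k + l"
  obtain x where x: "\<And>j. j < length a \<Longrightarrow> padic_int p (x j) \<and> padic_unit p (x j)"
      "(\<Sum>j<length a. a ! j * x j n ^ k) mod int p ^ n = 0"
    using assms by (auto simp: padic_unit_solvable_def)
  have "\<not> int p dvd x j n" if "j < length a" for j
    using x(1)[OF that] padic_int_cong[of p "x j" 1 n] False
    by (auto simp: n_def padic_unit_def dvd_eq_mod_eq_0)
  hence "unit_rep p k (int p ^ n) a 0"
    unfolding unit_rep_def using x(2) by (intro exI[of _ "\<lambda>j. x j n"]) auto
  thus ?thesis by (auto simp: approx_set_def n_def)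
qed auto

text \<open>The tuple (1, ..., 1, -(s-1)) with all variables equal to 1 works for every
  \<open>p\<close> and \<open>k\<close>. This is what makes the local densities positive.\<close>

lemma approx_set_nonempty:
  assumes "prime p" "s \<ge> 2"
  shows "\<exists>a \<in> approx_set p k 1. length a = s"
proof -
  define a where "a = replicate (s - 1) 1 @ [- int (s - 1)]"
  have "\<not> int p ^ 1 dvd 1" using assms(1) by (auto simp: prime_gt_1_nat dest: prime_gt_1_nat)
  moreover have "1 \<in> set a" using assms(2) by (auto simp: a_def)
  moreover have "unit_rep p k M a 0" for M
  proof -
    have s: "length a = Suc (s - 1)" by (simp add: a_def)
    have "(\<Sum>j<length a. a ! j * 1 ^ k) = 0"
      unfolding s by (simp add: a_def nth_append)
    thus ?thesis unfolding unit_rep_def using assms(1)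
      by (intro exI[of _ "\<lambda>_. 1"]) (auto dest: prime_gt_1_nat)
  qed
  ultimately have "a \<in> approx_set p k 1" unfolding approx_set_def by blast
  moreover have "length a = s" using assms(2) by (simp add: a_def)
  ultimately show ?thesis by blast
qed

section \<open>Exponential sums over power residues\<close>


text \<open>The multiples of \<open>k\<close> modulo \<open>m\<close> form the subgroup generated by
  gcd(m, k).\<close>

lemma card_multiples_mod:
  fixes m k :: nat
  assumes "m > 0"
  shows "card ((\<lambda>i. i * k mod m) ` {..<m}) = m div gcd m k"
proof -
  define d where "d = gcd m k"
  have d: "d dvd m" "d dvd k" "d > 0" using assms by (auto simp: d_def)
  have "(\<lambda>i. i * k mod m) ` {..<m} = (\<lambda>i. i * d) ` {..<m div d}"
  proof (intro equalityI subsetI)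
    fix j assume "j \<in> (\<lambda>i. i * k mod m) ` {..<m}"
    then obtain i where i: "j = i * k mod m" by blast
    have "d dvd j" unfolding i using d by (simp add: dvd_mod)
    moreover have "j < m" unfolding i using assms by simp
    ultimately have "j = (j div d) * d" "j div d < m div d"
      using d by (auto simp: div_less_mono)
    thus "j \<in> (\<lambda>i. i * d) ` {..<m div d}" by blast
  next
    fix j assume "j \<in> (\<lambda>i. i * d) ` {..<m div d}"
    then obtain i where i: "j = i * d" "i < m div d" by blast
    have "j < m div d * d" unfolding i(1) using i(2) d(3) by (rule mult_less_mono1)
    hence "j < m" unfolding dvd_div_mult_self[OF d(1)] .
    have "gcd k m dvd j" using i by (simp add: d_def gcd.commute)
    then obtain x where x: "[k * x = j] (mod m)" using cong_solve_dvd_nat by blast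
    have "(x mod m) * k mod m = j"
      using x \<open>j < m\<close> by (simp add: cong_def mult.commute mod_mult_right_eq)
    thus "j \<in> (\<lambda>i. i * k mod m) ` {..<m}" using assms by force
  qed
  moreover have "inj_on (\<lambda>i. i * d) {..<m div d}" using d by (auto simp: inj_on_def)
  ultimately show ?thesis by (simp add: card_image d_def)
qed

text \<open>A primitive root turns the k-th power map into multiplication by \<open>k\<close> on
  exponents modulo p - 1.\<close>

lemma card_power_residues_nat:
  fixes p k :: nat
  assumes p: "prime p"
  shows "card ((\<lambda>x. x ^ k mod p) ` {0<..<p}) = (p - 1) div gcd (p - 1) k"
proof -
  have p1: "p > 1" using p prime_gt_1_nat by blast
  obtain g where g: "residue_primroot p g" using prime_primitive_root_exists[OF p1 p] by blast
  have bij: "bij_betw (\<lambda>i. g ^ i mod p) {..<p - 1} {0<..<p}"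
    using residue_primroot_is_generator[OF p1 g] p by (simp add: totient_prime totatives_prime)
  have ord: "ord p g = p - 1" "coprime p g" using g p by (auto simp: residue_primroot_def totient_prime)
  have "(\<lambda>x. x ^ k mod p) ` {0<..<p} = (\<lambda>x. x ^ k mod p) ` (\<lambda>i. g ^ i mod p) ` {..<p - 1}"
    using bij by (simp add: bij_betw_def)
  also have "\<dots> = (\<lambda>i. g ^ i mod p) ` (\<lambda>i. i * k mod (p - 1)) ` {..<p - 1}"
  proof -
    have "(g ^ i mod p) ^ k mod p = g ^ (i * k mod (p - 1)) mod p" for i
    proof -
      have "(g ^ i mod p) ^ k mod p = g ^ (i * k) mod p" by (simp add: power_mod power_mult)
      also have "\<dots> = g ^ (i * k mod (p - 1)) mod p"
        using order_divides_expdiff[of p g "i * k" "i * k mod (p - 1)"] ord by (simp add: cong_def)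
      finally show ?thesis .
    qed
    thus ?thesis by (simp add: image_image)
  qed
  finally have "card ((\<lambda>x. x ^ k mod p) ` {0<..<p})
      = card ((\<lambda>i. g ^ i mod p) ` (\<lambda>i. i * k mod (p - 1)) ` {..<p - 1})" by simp
  also have "\<dots> = card ((\<lambda>i. i * k mod (p - 1)) ` {..<p - 1})"
    using bij p1 by (intro card_image) (auto simp: bij_betw_def intro: inj_on_subset)
  also have "\<dots> = (p - 1) div gcd (p - 1) k" using p1 by (intro card_multiples_mod) simp
  finally show ?thesis .
qed

lemma card_power_residues:
  fixes p k :: nat
  assumes p: "prime p"
  shows "card ((\<lambda>x. x ^ k mod int p) ` {1..<int p}) = (p - 1) div gcd (p - 1) k"
proof -
  have "{1..<int p} = int ` {0<..<p}"
    using image_int_atLeastLessThan[of 1 p] by (simp add: atLeastSucLessThan_greaterThanLessThan)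
  hence "(\<lambda>x. x ^ k mod int p) ` {1..<int p} = int ` (\<lambda>x. x ^ k mod p) ` {0<..<p}"
    by (simp add: image_image zmod_int)
  thus ?thesis using card_power_residues_nat[OF p] by (simp add: card_image)
qed

lemma bij_betw_mult_mod:
  fixes p :: nat and h :: int
  assumes p: "prime p" and h: "\<not> int p dvd h"
  shows "bij_betw (\<lambda>x. h * x mod int p) {1..<int p} {1..<int p}"
proof -
  have pint: "prime (int p)" using p by simp
  have cop: "coprime h (int p)" using pint h by (metis coprime_commute prime_imp_coprime)
  have "inj_on (\<lambda>x. h * x mod int p) {1..<int p}"
  proof (rule inj_onI)
    fix x y assume xy: "x \<in> {1..<int p}" "y \<in> {1..<int p}" "h * x mod int p = h * y mod int p"
    hence "[x = y] (mod int p)" using cop cong_mult_lcancel[of h "int p" x y] by (simp add: cong_def)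
    thus "x = y" using xy by (simp add: cong_def)
  qed
  moreover have "(\<lambda>x. h * x mod int p) ` {1..<int p} \<subseteq> {1..<int p}"
  proof (rule image_subsetI)
    fix x assume x: "x \<in> {1..<int p}"
    hence "\<not> int p dvd x" using zdvd_not_zless[of x "int p"] by auto
    hence "h * x mod int p \<noteq> 0" using h pint by (auto simp: prime_dvd_mult_iff dvd_eq_mod_eq_0 [symmetric])
    moreover have "0 \<le> h * x mod int p" "h * x mod int p < int p" using p by (auto simp: prime_gt_0_nat)
    ultimately show "h * x mod int p \<in> {1..<int p}" by auto
  qed
  ultimately show ?thesis by (simp add: bij_betw_def endo_inj_surj)
qed

lemma not_dvd_residue: "x \<in> {1..<int p} \<Longrightarrow> \<not> int p dvd x"
  using zdvd_not_zless[of x "int p"] by auto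

text \<open>All nonempty fibres of the k-th power map are translates of the fibre over 1, so
  counting the p - 1 nonzero residues by fibres shows that each has gcd(p-1, k) elements.\<close>

lemma card_power_fibre_le:
  fixes p k :: nat and c :: int
  assumes p: "prime p" and k: "k > 0"
  shows "card {x\<in>{1..<int p}. x ^ k mod int p = c} \<le> k"
proof (cases "\<exists>y\<in>{1..<int p}. y ^ k mod int p = c")
  case False
  hence "{x\<in>{1..<int p}. x ^ k mod int p = c} = {}" by auto
  thus ?thesis by (metis card.empty le0)
next
  case True
  have p1: "p > 1" using p prime_gt_1_nat by blast
  let ?F = "\<lambda>c. {x\<in>{1..<int p}. x ^ k mod int p = c}"
  let ?H = "(\<lambda>x. x ^ k mod int p) ` {1..<int p}"
  have fib: "card (?F c') = card (?F 1)" if c': "c' \<in> ?H" for c'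
  proof -
    obtain h where h: "h \<in> {1..<int p}" "c' = h ^ k mod int p" using c' by blast
    have nd: "\<not> int p dvd h" using h not_dvd_residue by blast
    have cop: "coprime (h ^ k) (int p)" using nd p
      by (metis coprime_commute coprime_power_left_iff prime_imp_coprime prime_int_nat_transfer of_nat_dvd_iff prime_nat_int_transfer)
    have bij: "bij_betw (\<lambda>x. h * x mod int p) {1..<int p} {1..<int p}"
      by (rule bij_betw_mult_mod[OF p nd])
    have eq: "(h * x mod int p) ^ k mod int p = c' \<longleftrightarrow> x ^ k mod int p = 1" for x
    proof -
      have "(h * x mod int p) ^ k mod int p = c' \<longleftrightarrow> [h ^ k * x ^ k = h ^ k * 1] (mod int p)"
        by (simp add: h cong_def power_mod power_mult_distrib)
      also have "\<dots> \<longleftrightarrow> [x ^ k = 1] (mod int p)" by (rule cong_mult_lcancel[OF cop])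
      also have "\<dots> \<longleftrightarrow> x ^ k mod int p = 1" using p1 by (simp add: cong_def)
      finally show ?thesis .
    qed
    have "?F c' = (\<lambda>x. h * x mod int p) ` ?F 1"
    proof (intro equalityI subsetI)
      fix y assume y: "y \<in> ?F c'"
      hence "y \<in> (\<lambda>x. h * x mod int p) ` {1..<int p}" using bij by (simp add: bij_betw_def)
      then obtain x where x: "x \<in> {1..<int p}" "y = h * x mod int p" by blast
      hence "x \<in> ?F 1" using eq[of x] y by simp
      thus "y \<in> (\<lambda>x. h * x mod int p) ` ?F 1" using x(2) by blast
    next
      fix y assume "y \<in> (\<lambda>x. h * x mod int p) ` ?F 1"
      then obtain x where x: "x \<in> ?F 1" "y = h * x mod int p" by blast
      hence "y \<in> {1..<int p}" using bij by (auto simp: bij_betw_def)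
      thus "y \<in> ?F c'" using x eq[of x] by simp
    qed
    moreover have "inj_on (\<lambda>x. h * x mod int p) (?F 1)"
      using bij by (auto simp: bij_betw_def intro: inj_on_subset)
    ultimately show ?thesis by (simp add: card_image)
  qed
  have "int p - 1 = (\<Sum>x\<in>{1..<int p}. 1)" using p1 by simp
  also have "\<dots> = (\<Sum>y\<in>?H. int (card (?F y)) * 1)"
    by (rule sum_fun_comp) auto
  also have "\<dots> = (\<Sum>y\<in>?H. int (card (?F 1)))" by (intro sum.cong refl) (simp only: fib)
  also have "\<dots> = int (card ?H * card (?F 1))" by simp
  finally have "p - 1 = card ?H * card (?F 1)" using p1 by (simp add: of_nat_diff flip: of_nat_mult)
  hence *: "p - 1 = (p - 1) div gcd (p - 1) k * card (?F 1)" using card_power_residues[OF p] by simp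
  also have "p - 1 = (p - 1) div gcd (p - 1) k * gcd (p - 1) k" by simp
  finally have "(p - 1) div gcd (p - 1) k * gcd (p - 1) k = (p - 1) div gcd (p - 1) k * card (?F 1)"
    by simp
  moreover have "(p - 1) div gcd (p - 1) k \<noteq> 0" using p1 by (simp add: dvd_div_eq_0_iff)
  ultimately have "gcd (p - 1) k = card (?F 1)" by (subst (asm) mult_left_cancel) auto
  moreover have "gcd (p - 1) k \<le> k" using k by simp
  moreover have "card (?F c) = card (?F 1)" using True by (intro fib) auto
  ultimately show ?thesis by simp
qed

section \<open>Additive characters and power sums modulo a prime\<close>

definition echar :: "nat \<Rightarrow> int \<Rightarrow> complex" where
  "echar p n = cis (2 * pi * of_int n / real p)"

lemma echar_add: "echar p (m + n) = echar p m * echar p n"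
  by (simp add: echar_def cis_mult add_divide_distrib distrib_left)

lemma cnj_echar: "cnj (echar p n) = echar p (- n)"
  by (simp add: echar_def cis_cnj)

lemma norm_echar [simp]: "norm (echar p n) = 1"
  by (simp add: echar_def)

lemma echar_mult_nat: "echar p (int m * n) = echar p n ^ m"
  by (simp add: echar_def DeMoivre mult_ac)

lemma echar_period: "p > 0 \<Longrightarrow> echar p (int p * n) = 1"
proof -
  assume "p > 0"
  hence "2 * pi * of_int (int p * n) / real p = 2 * pi * of_int n" by simp
  hence "echar p (int p * n) = cis (2 * pi * of_int n)" by (simp only: echar_def)
  also have "\<dots> = 1" by (rule cis_multiple_2pi) simp
  finally show ?thesis .
qed

lemma echar_mod: "p > 0 \<Longrightarrow> echar p (n mod int p) = echar p n"
proof -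
  assume p: "p > 0"
  have "echar p n = echar p (int p * (n div int p) + n mod int p)" by simp
  also have "\<dots> = echar p (n mod int p)" using echar_period[OF p] by (simp only: echar_add mult_1)
  finally show ?thesis ..
qed

lemma echar_cong: "p > 0 \<Longrightarrow> [m = n] (mod int p) \<Longrightarrow> echar p m = echar p n"
  by (metis cong_def echar_mod)

lemma echar_neq_1:
  assumes "p > 0" "\<not> int p dvd n"
  shows "echar p n \<noteq> 1"
proof
  assume "echar p n = 1"
  define m where "m = nat (n mod int p)"
  have m: "int m = n mod int p" using assms by (simp add: m_def)
  have "int m < int p" "int m \<noteq> 0" unfolding m using assms by (auto simp: dvd_eq_mod_eq_0)
  have inj: "inj_on (\<lambda>k. cis (2 * pi * real k / real p)) {..<p}"
    using bij_betw_roots_unity[OF assms(1)] by (simp add: bij_betw_def)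
  have "echar p (int m) = 1"
    unfolding m using \<open>echar p n = 1\<close> echar_mod[OF assms(1)] by metis
  hence "cis (2 * pi * real m / real p) = cis (2 * pi * real 0 / real p)"
    by (simp add: echar_def)
  from inj_onD[OF inj this] show False using \<open>int m < int p\<close> \<open>int m \<noteq> 0\<close> by simp
qed

lemma sum_echar:
  assumes "p > 0"
  shows "(\<Sum>t\<in>{0..<int p}. echar p (t * n)) = (if int p dvd n then of_nat p else 0)"
proof -
  have "(\<Sum>t\<in>{0..<int p}. echar p (t * n)) = (\<Sum>t<p. echar p (int t * n))"
    by (rule sum.reindex_bij_witness[of _ int nat]) auto
  also have "\<dots> = (\<Sum>t<p. echar p n ^ t)" by (simp add: echar_mult_nat)
  also have "\<dots> = (if int p dvd n then of_nat p else 0)"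
  proof (cases "int p dvd n")
    case True
    hence "echar p n = 1" using echar_period[OF assms] by auto
    thus ?thesis using True by simp
  next
    case False
    have "echar p n ^ p = 1" using echar_period[OF assms, of n] by (simp add: echar_mult_nat)
    thus ?thesis using False echar_neq_1[OF assms False] by (simp add: geometric_sum)
  qed
  finally show ?thesis .
qed

text \<open>Only nonzero residues are summed, because the variables have to be units.\<close>

definition power_sum :: "nat \<Rightarrow> nat \<Rightarrow> int \<Rightarrow> complex" where
  "power_sum p k a = (\<Sum>x\<in>{1..<int p}. echar p (a * x ^ k))"

lemma power_sum_cong: "p > 0 \<Longrightarrow> [a = b] (mod int p) \<Longrightarrow> power_sum p k a = power_sum p k b"
  unfolding power_sum_def by (intro sum.cong echar_cong cong_mult) auto

text \<open>The substitution of h x for x permutes the nonzero residues.\<close>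

lemma power_sum_mult_power:
  assumes p: "prime p" and h: "\<not> int p dvd h"
  shows "power_sum p k (a * h ^ k) = power_sum p k a"
proof -
  have p0: "p > 0" using p prime_gt_0_nat by blast
  have "power_sum p k a = (\<Sum>x\<in>{1..<int p}. echar p (a * (h * x mod int p) ^ k))"
    unfolding power_sum_def by (rule sum.reindex_bij_betw[OF bij_betw_mult_mod[OF p h], symmetric])
  also have "\<dots> = (\<Sum>x\<in>{1..<int p}. echar p (a * h ^ k * x ^ k))"
  proof (intro sum.cong refl echar_cong p0)
    fix x
    have "[(h * x mod int p) ^ k = (h * x) ^ k] (mod int p)" by (intro cong_pow) (simp add: cong_def)
    hence "[a * (h * x mod int p) ^ k = a * (h * x) ^ k] (mod int p)" by (intro cong_mult) auto
    thus "[a * (h * x mod int p) ^ k = a * h ^ k * x ^ k] (mod int p)"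
      by (simp add: power_mult_distrib mult_ac)
  qed
  finally show ?thesis by (simp add: power_sum_def)
qed

text \<open>Second moment: expanding the square, orthogonality keeps \<open>p\<close> times the
  number of pairs with equal k-th powers, and each x has at most \<open>k\<close> partners.\<close>

lemma sum_norm_power_sum:
  assumes p: "prime p" and k: "k > 0"
  shows "(\<Sum>b\<in>{0..<int p}. norm (power_sum p k b) ^ 2) \<le> real k * real p * (real p - 1)"
proof -
  have p0: "p > 0" using p prime_gt_0_nat by blast
  let ?U = "{1..<int p}"
  have "complex_of_real (\<Sum>b\<in>{0..<int p}. norm (power_sum p k b) ^ 2)
      = (\<Sum>b\<in>{0..<int p}. power_sum p k b * cnj (power_sum p k b))"
    by (simp add: complex_norm_square del: of_real_power)
  also have "\<dots> = (\<Sum>b\<in>{0..<int p}. \<Sum>x\<in>?U. \<Sum>y\<in>?U. echar p (b * (x ^ k - y ^ k)))"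
    by (simp add: power_sum_def sum_product cnj_echar flip: echar_add) (simp add: algebra_simps)
  also have "\<dots> = (\<Sum>x\<in>?U. \<Sum>y\<in>?U. \<Sum>b\<in>{0..<int p}. echar p (b * (x ^ k - y ^ k)))"
    by (subst sum.swap) (intro sum.cong refl sum.swap)
  also have "\<dots> = (\<Sum>x\<in>?U. \<Sum>y\<in>?U. if int p dvd x ^ k - y ^ k then of_nat p else 0)"
    by (simp add: sum_echar[OF p0])
  also have "\<dots> = of_real (\<Sum>x\<in>?U. \<Sum>y\<in>?U. if int p dvd x ^ k - y ^ k then real p else 0)"
    by (simp add: if_distrib cong: if_cong)
  finally have "(\<Sum>b\<in>{0..<int p}. norm (power_sum p k b) ^ 2)
      = (\<Sum>x\<in>?U. \<Sum>y\<in>?U. if int p dvd x ^ k - y ^ k then real p else 0)"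
    using of_real_eq_iff by blast
  also have "\<dots> \<le> (\<Sum>x\<in>?U. real k * real p)"
  proof (rule sum_mono)
    fix x assume "x \<in> ?U"
    have "(\<Sum>y\<in>?U. if int p dvd x ^ k - y ^ k then real p else 0)
        = real (card {y\<in>?U. int p dvd x ^ k - y ^ k}) * real p"
      by (simp add: sum.If_cases Int_def)
    also have "{y\<in>?U. int p dvd x ^ k - y ^ k} = {y\<in>?U. y ^ k mod int p = x ^ k mod int p}"
      by (auto simp: mod_eq_dvd_iff [symmetric])
    also have "real (card \<dots>) * real p \<le> real k * real p"
      using card_power_fibre_le[OF p k] by (intro mult_right_mono) auto
    finally show "(\<Sum>y\<in>?U. if int p dvd x ^ k - y ^ k then real p else 0) \<le> real k * real p" .
  qed
  also have "\<dots> = real k * real p * (real p - 1)" using p0 by (simp add: of_nat_diff)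
  finally show ?thesis .
qed

text \<open>Since \<open>power_sum\<close> is constant on cosets of the group of \<open>k\<close>-th powers, the mean
  value over all frequencies already controls each individual nonzero frequency.\<close>

lemma norm_power_sum_le:
  assumes p: "prime p" and k: "k > 0" and a: "\<not> int p dvd a"
  shows "norm (power_sum p k a) \<le> real k * sqrt (real p)"
proof -
  have p1: "p > 1" using p prime_gt_1_nat by blast
  have pint: "prime (int p)" using p by simp
  let ?U = "{1..<int p}" and ?f = "\<lambda>b. norm (power_sum p k b) ^ 2"
  let ?\<phi> = "\<lambda>h. a * h ^ k mod int p"
  have "(real p - 1) * ?f a = (\<Sum>h\<in>?U. ?f a)" using p1 by (simp add: of_nat_diff)
  also have "\<dots> = (\<Sum>h\<in>?U. ?f (?\<phi> h))"
  proof (intro sum.cong refl)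
    fix h assume "h \<in> ?U"
    have "power_sum p k a = power_sum p k (a * h ^ k)"
      using power_sum_mult_power[OF p not_dvd_residue[OF \<open>h \<in> ?U\<close>]] by simp
    also have "\<dots> = power_sum p k (?\<phi> h)" using p1 by (intro power_sum_cong) (auto simp: cong_def)
    finally show "?f a = ?f (?\<phi> h)" by simp
  qed
  \<comment> \<open>Regrouping by the frequency a h^k. A given frequency arises from at most
    \<open>k\<close> values of h, since these form a fibre of the k-th power map.\<close>
  also have "\<dots> = (\<Sum>b\<in>{0..<int p}. real (card {h\<in>?U. ?\<phi> h = b}) * ?f b)"
    using p1 by (intro sum_fun_comp) auto
  also have "\<dots> \<le> (\<Sum>b\<in>{0..<int p}. real k * ?f b)"
  proof (intro sum_mono mult_right_mono)
    fix b
    show "real (card {h\<in>?U. ?\<phi> h = b}) \<le> real k"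
    proof (cases "\<exists>h\<in>?U. ?\<phi> h = b")
      case False
      hence "{h\<in>?U. ?\<phi> h = b} = {}" by auto
      thus ?thesis by (metis card.empty of_nat_0 of_nat_0_le_iff)
    next
      case True
      then obtain h0 where h0: "?\<phi> h0 = b" by blast
      have cop: "coprime a (int p)" using a pint by (metis coprime_commute prime_imp_coprime)
      have "?\<phi> h = b \<longleftrightarrow> h ^ k mod int p = h0 ^ k mod int p" for h
        using cong_mult_lcancel[OF cop, of "h ^ k" "h0 ^ k"] h0 by (auto simp: cong_def)
      thus ?thesis using card_power_fibre_le[OF p k, of "h0 ^ k mod int p"] by simp
    qed
  qed auto
  also have "\<dots> = real k * (\<Sum>b\<in>{0..<int p}. ?f b)" by (simp add: sum_distrib_left)
  also have "\<dots> \<le> real k * (real k * real p * (real p - 1))"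
    using sum_norm_power_sum[OF p k] by (intro mult_left_mono) auto
  finally have "(real p - 1) * ?f a \<le> (real p - 1) * (real k ^ 2 * real p)"
    by (simp add: power2_eq_square mult_ac)
  hence "?f a \<le> real k ^ 2 * real p" using p1 by (subst (asm) mult_le_cancel_left_pos) auto
  hence "?f a \<le> (real k * sqrt (real p)) ^ 2" by (simp add: power_mult_distrib)
  thus ?thesis by (rule power2_le_imp_le) simp
qed

text \<open>The circle method over the field with p elements. Summing over all frequencies counts
  each solution \<open>p\<close> times; the zero frequency gives (p-1)^3 and each of the other p - 1
  at most (k sqrt p)^3. A vanishing count forces (p-1)^2 \<le> k^3 p^(3/2), and with p - 1 \<ge> p/2
  this yields p \<le> 16 k^6.\<close>

lemma ternary_unit_solvable:
  assumes p: "prime p" and k: "k > 0" and large: "p > 16 * k ^ 6"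
    and abc: "\<not> int p dvd a" "\<not> int p dvd b" "\<not> int p dvd c"
  shows "\<exists>x y z. \<not> int p dvd x \<and> \<not> int p dvd y \<and> \<not> int p dvd z \<and>
    int p dvd a * x ^ k + b * y ^ k + c * z ^ k - d"
proof (rule ccontr)
  assume contr: "\<not> ?thesis"
  have p1: "p > 1" using p prime_gt_1_nat by blast
  have pint: "prime (int p)" using p by simp
  let ?U = "{1..<int p}" and ?S = "power_sum p k"
  let ?F = "\<lambda>x y z. a * x ^ k + b * y ^ k + c * z ^ k - d"
  \<comment> \<open>The contribution of frequency \<open>t\<close>: the sum over the three variables
    factors into power sums.\<close>
  let ?G = "\<lambda>t. ?S (t * a) * ?S (t * b) * ?S (t * c) * echar p (- t * d)"
  have G: "?G t = (\<Sum>x\<in>?U. \<Sum>y\<in>?U. \<Sum>z\<in>?U. echar p (t * ?F x y z))" for t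
  proof -
    have "(\<Sum>x\<in>?U. \<Sum>y\<in>?U. \<Sum>z\<in>?U. echar p (t * ?F x y z))
      = (\<Sum>x\<in>?U. \<Sum>y\<in>?U. \<Sum>z\<in>?U. ((echar p (t * a * x ^ k) * echar p (t * b * y ^ k))
          * echar p (t * c * z ^ k)) * echar p (- t * d))"
      by (simp flip: echar_add add: algebra_simps)
    also have "\<dots> = ?G t"
      unfolding power_sum_def by (simp only: flip: sum_distrib_left sum_distrib_right)
    finally show ?thesis by simp
  qed
  have "(\<Sum>t\<in>{0..<int p}. ?G t) = (\<Sum>t\<in>{0..<int p}. \<Sum>x\<in>?U. \<Sum>y\<in>?U. \<Sum>z\<in>?U. echar p (t * ?F x y z))"
    by (simp only: G)
  also have "\<dots> = (\<Sum>x\<in>?U. \<Sum>t\<in>{0..<int p}. \<Sum>y\<in>?U. \<Sum>z\<in>?U. echar p (t * ?F x y z))"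
    by (rule sum.swap)
  also have "\<dots> = (\<Sum>x\<in>?U. \<Sum>y\<in>?U. \<Sum>t\<in>{0..<int p}. \<Sum>z\<in>?U. echar p (t * ?F x y z))"
    by (rule sum.cong[OF refl], rule sum.swap)
  also have "\<dots> = (\<Sum>x\<in>?U. \<Sum>y\<in>?U. \<Sum>z\<in>?U. \<Sum>t\<in>{0..<int p}. echar p (t * ?F x y z))"
    by (rule sum.cong[OF refl], rule sum.cong[OF refl], rule sum.swap)
  also have "\<dots> = (\<Sum>x\<in>?U. \<Sum>y\<in>?U. \<Sum>z\<in>?U. 0)"
  proof (intro sum.cong refl)
    fix x y z assume "x \<in> ?U" "y \<in> ?U" "z \<in> ?U"
    hence "\<not> int p dvd ?F x y z" using contr not_dvd_residue by blast
    thus "(\<Sum>t\<in>{0..<int p}. echar p (t * ?F x y z)) = 0" using p1 by (subst sum_echar) auto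
  qed
  finally have "(\<Sum>t\<in>{0..<int p}. ?G t) = 0" by simp
  moreover have "{0..<int p} = insert 0 ?U" using p1 by auto
  ultimately have sum0: "?G 0 + (\<Sum>t\<in>?U. ?G t) = 0" by simp
  have G0: "?G 0 = (of_nat p - 1) ^ 3"
  proof -
    have "?S 0 = of_nat p - 1" using p1 by (simp add: power_sum_def echar_def of_nat_diff)
    moreover have "echar p 0 = 1" by (simp add: echar_def)
    ultimately show ?thesis by (simp add: power3_eq_cube)
  qed
  have "(of_nat p - 1) ^ 3 = - (\<Sum>t\<in>?U. ?G t)"
    using eq_neg_iff_add_eq_0[THEN iffD2, OF sum0] unfolding G0 .
  hence "norm ((of_nat p - 1 :: complex) ^ 3) = norm (\<Sum>t\<in>?U. ?G t)"
    by (simp only: norm_minus_cancel)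
  also have "\<dots> \<le> (\<Sum>t\<in>?U. norm (?G t))" by (rule norm_sum)
  also have "\<dots> \<le> (\<Sum>t\<in>?U. (real k * sqrt (real p)) ^ 3)"
  proof (rule sum_mono)
    fix t assume "t \<in> ?U"
    hence t: "\<not> int p dvd t" by (rule not_dvd_residue)
    have "norm (?S (t * w)) \<le> real k * sqrt (real p)" if "\<not> int p dvd w" for w
      using that t pint by (intro norm_power_sum_le[OF p k]) (auto simp: prime_dvd_mult_iff)
    hence "norm (?S (t * a)) * norm (?S (t * b)) * norm (?S (t * c))
       \<le> real k * sqrt (real p) * (real k * sqrt (real p)) * (real k * sqrt (real p))"
      using abc by (intro mult_mono mult_nonneg_nonneg) auto
    thus "norm (?G t) \<le> (real k * sqrt (real p)) ^ 3"
      by (simp add: norm_mult power3_eq_cube)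
  qed
  also have "\<dots> = (real p - 1) * (real k * sqrt (real p)) ^ 3" using p1 by (simp add: of_nat_diff)
  also have "norm ((of_nat p - 1 :: complex) ^ 3) = (real p - 1) ^ 3"
  proof -
    have "(of_nat p - 1 :: complex) = of_real (real p - 1)" by simp
    hence "norm (of_nat p - 1 :: complex) = real p - 1"
      using p1 by (metis norm_of_real abs_of_nonneg diff_ge_0_iff_ge less_imp_le of_nat_1 of_nat_le_iff)
    thus ?thesis by (simp add: norm_power)
  qed
  finally have "(real p - 1) * (real p - 1) ^ 2 \<le> (real p - 1) * (real k * sqrt (real p)) ^ 3"
    by (simp add: power3_eq_cube power2_eq_square)
  hence le: "(real p - 1) ^ 2 \<le> (real k * sqrt (real p)) ^ 3"
    using p1 by (subst (asm) mult_le_cancel_left_pos) auto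
  have "(real p / 2) ^ 2 \<le> (real p - 1) ^ 2" using p1 by (intro power_mono) auto
  also note le
  finally have "real p ^ 2 \<le> 4 * real k ^ 3 * sqrt (real p) ^ 3"
    by (simp add: power_mult_distrib power_divide)
  moreover have "real p ^ 2 = sqrt (real p) * sqrt (real p) ^ 3"
    by (simp add: power2_eq_square power3_eq_cube)
  ultimately have "sqrt (real p) * sqrt (real p) ^ 3 \<le> (4 * real k ^ 3) * sqrt (real p) ^ 3" by simp
  hence "sqrt (real p) \<le> 4 * real k ^ 3" using p1 by (subst (asm) mult_le_cancel_right_pos) auto
  hence "real p \<le> (4 * real k ^ 3) ^ 2" by (rule sqrt_le_D)
  also have "\<dots> = real (16 * k ^ 6)" by (simp add: power_mult_distrib flip: power_mult)
  finally show False using large by linarith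
qed

section \<open>Local densities\<close>


lemma unit_rep_cong:
  assumes "[c = c'] (mod M)"
  shows "unit_rep p k M a c \<longleftrightarrow> unit_rep p k M a c'"
proof -
  have "M dvd S - c \<longleftrightarrow> M dvd S - c'" for S
    using cong_diff[OF cong_refl assms, of S] by (simp only: cong_def dvd_eq_mod_eq_0)
  thus ?thesis by (simp add: unit_rep_def)
qed

text \<open>Modulo \<open>p\<close> a coefficient divisible by \<open>p\<close> contributes nothing,
  and its variable can take any unit value.\<close>

lemma unit_rep_filter:
  assumes "p > 1"
  shows "unit_rep p k (int p) (filter (\<lambda>b. \<not> int p dvd b) a) c \<longleftrightarrow> unit_rep p k (int p) a c"
proof (induction a arbitrary: c)
  case Nil
  show ?case by simp
next
  case (Cons u a)
  show ?case
  proof (cases "int p dvd u")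
    case False
    thus ?thesis by (simp add: unit_rep_Cons Cons)
  next
    case True
    have "unit_rep p k (int p) a (c - u * y ^ k) \<longleftrightarrow> unit_rep p k (int p) a c" for y
      using True by (intro unit_rep_cong) (auto simp: cong_iff_dvd_diff)
    moreover have "\<exists>y. \<not> int p dvd y" using assms by (intro exI[of _ 1]) auto
    ultimately show ?thesis using True by (simp add: unit_rep_Cons Cons)
  qed
qed

lemma unit_rep_exists:
  assumes "p > 1"
  shows "\<exists>c. unit_rep p k M a c"
  using assms by (intro exI[of _ "\<Sum>j<length a. a ! j * 1 ^ k"])
    (auto simp: unit_rep_def intro!: exI[of _ "\<lambda>_. 1"])

text \<open>Unit coefficients beyond the third get arbitrary unit values; three of them absorb
  whatever residue remains.\<close>

lemma unit_rep_three:
  assumes p: "prime p" and k: "k > 0" and large: "p > 16 * k ^ 6"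
    and len: "length (filter (\<lambda>b. \<not> int p dvd b) a) \<ge> 3"
  shows "unit_rep p k (int p) a c"
proof -
  have p1: "p > 1" using p prime_gt_1_nat by blast
  define w where "w = filter (\<lambda>b. \<not> int p dvd b) a"
  obtain u v t w' where w: "w = u # v # t # w'"
    using len unfolding w_def [symmetric] by (auto simp: Suc_le_length_iff numeral_3_eq_3)
  have "set w \<subseteq> {b. \<not> int p dvd b}" by (auto simp: w_def)
  hence nd: "\<not> int p dvd u" "\<not> int p dvd v" "\<not> int p dvd t" by (auto simp: w)
  obtain c' where c': "unit_rep p k (int p) w' c'" using unit_rep_exists[OF p1] by blast
  obtain x y z where xyz: "\<not> int p dvd x" "\<not> int p dvd y" "\<not> int p dvd z"
      "int p dvd u * x ^ k + v * y ^ k + t * z ^ k - (c - c')"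
    using ternary_unit_solvable[OF p k large nd] by blast
  have "[c - u * x ^ k - v * y ^ k - t * z ^ k = c'] (mod int p)"
  proof -
    have "c' - (c - u * x ^ k - v * y ^ k - t * z ^ k) = u * x ^ k + v * y ^ k + t * z ^ k - (c - c')"
      by simp
    hence "int p dvd c' - (c - u * x ^ k - v * y ^ k - t * z ^ k)" using xyz(4) by (simp only:)
    thus ?thesis by (intro cong_sym[of c']) (simp only: cong_iff_dvd_diff)
  qed
  hence "unit_rep p k (int p) w' (c - u * x ^ k - v * y ^ k - t * z ^ k)"
    using c' unit_rep_cong by blast
  hence "unit_rep p k (int p) w c" unfolding w unit_rep_Cons using xyz by blast
  thus ?thesis using unit_rep_filter[OF p1] by (simp add: w_def)
qed

lemma multiplicity_large_prime:
  fixes p k :: nat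
  assumes "k > 0" "p > 16 * k ^ 6"
  shows "multiplicity p k = 0"
proof -
  have "k ^ 1 \<le> k ^ 6" using assms(1) by (intro power_increasing) auto
  hence "k < p" using assms(2) by simp
  hence "\<not> p dvd k" using assms(1) by (auto dest: dvd_imp_le)
  thus ?thesis by (rule not_dvd_imp_multiplicity_0)
qed

text \<open>Beyond the threshold \<open>p\<close> does not divide \<open>k\<close>, so level
  \<open>l = 1\<close> and the modulus \<open>p\<close> itself suffice for lifting.\<close>

lemma not_solvable_imp_few:
  assumes p: "prime p" and k: "k > 0" and large: "p > 16 * k ^ 6"
    and a: "\<not> padic_unit_solvable p k a"
  shows "length (filter (\<lambda>b. \<not> int p dvd b) a) \<le> 2"
proof (rule ccontr)
  assume "\<not> ?thesis"
  hence len: "length (filter (\<lambda>b. \<not> int p dvd b) a) \<ge> 3" by simp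
  hence "unit_rep p k (int p) a 0" by (intro unit_rep_three p k large)
  moreover have "filter (\<lambda>b. \<not> int p dvd b) a \<noteq> []" using len by auto
  ultimately have "a \<in> approx_set p k 1"
    using multiplicity_large_prime[OF k large] by (auto simp: approx_set_def filter_empty_conv)
  thus False using approx_set_solvable[OF p k] a by blast
qed

definition approx_dens :: "nat \<Rightarrow> nat \<Rightarrow> nat \<Rightarrow> nat \<Rightarrow> real" where
  "approx_dens s p k l = dens s (int p ^ (2 * multiplicity p k + l)) (approx_set p k l)"

lemma approx_dens_nonneg: "p > 0 \<Longrightarrow> approx_dens s p k l \<ge> 0"
  by (simp add: approx_dens_def dens_nonneg)

lemma approx_dens_le_1: "p > 0 \<Longrightarrow> approx_dens s p k l \<le> 1"
  by (simp add: approx_dens_def dens_le_1)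

lemma approx_dens_1_pos:
  assumes "prime p" "s \<ge> 2"
  shows "approx_dens s p k 1 > 0"
proof -
  have p0: "p > 0" using assms prime_gt_0_nat by blast
  let ?Q = "int p ^ (2 * multiplicity p k + 1)"
  obtain a where a: "a \<in> approx_set p k 1" "length a = s" using approx_set_nonempty[OF assms] by blast
  have "map (\<lambda>b. b mod ?Q) a \<in> approx_set p k 1"
    using a(1) periodic_approx_set[of p k 1] unfolding periodic_def by blast
  moreover have "map (\<lambda>b. b mod ?Q) a \<in> tuples s {0..<?Q}" using a(2) p0 by (auto simp: tuples_def)
  ultimately have "tuples s {0..<?Q} \<inter> approx_set p k 1 \<noteq> {}" by blast
  hence "card (tuples s {0..<?Q} \<inter> approx_set p k 1) > 0"
    by (subst card_gt_0_iff) (auto intro: finite_tuples)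
  thus ?thesis using p0 by (simp add: approx_dens_def dens_def)
qed

section \<open>Existence and size of the local densities\<close>

lemma box_Int_Cp: "box s A \<inter> Cp p k s = box s A \<inter> {a. padic_unit_solvable p k a}"
  by (auto simp: box_def Cp_def)

lemma Int_split_card_bounds:
  assumes "finite B" "B \<inter> T \<subseteq> C" "B \<inter> C \<subseteq> T \<union> D"
  shows "card (B \<inter> T) \<le> card (B \<inter> C)" "card (B \<inter> C) \<le> card (B \<inter> T) + card (B \<inter> D)"
proof -
  show "card (B \<inter> T) \<le> card (B \<inter> C)" using assms by (intro card_mono) auto
  have "card (B \<inter> C) \<le> card ((B \<inter> T) \<union> (B \<inter> D))" using assms by (intro card_mono) auto
  also have "\<dots> \<le> card (B \<inter> T) + card (B \<inter> D)" by (rule card_Un_le)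
  finally show "card (B \<inter> C) \<le> card (B \<inter> T) + card (B \<inter> D)" .
qed

lemma count_box_periodic:
  assumes "Q > 0" "periodic Q T" "of_int Q \<le> A"
  shows "\<bar>real (card (box s A \<inter> T)) - dens s Q T * (2 * A) ^ s\<bar>
    \<le> 2 * real s * 6 ^ s * of_int Q * A ^ (s - 1)"
  using count_periodic_signed[OF assms, of True True s] by (simp add: box_eq)

lemma count_ratio_periodic:
  assumes "Q > 0" "periodic Q T" "of_int Q \<le> A" "s > 0"
  shows "\<bar>count_ratio s T A - dens s Q T\<bar> \<le> 2 * real s * 3 ^ s * of_int Q / A"
proof -
  have A: "A > 0" using assms(1,3) by (meson less_le_trans of_int_0_less_iff)
  hence "count_ratio s T A - dens s Q T = (real (card (box s A \<inter> T)) - dens s Q T * (2 * A) ^ s) / (2 * A) ^ s"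
    by (simp add: count_ratio_def diff_divide_distrib)
  also have "\<bar>\<dots>\<bar> = \<bar>real (card (box s A \<inter> T)) - dens s Q T * (2 * A) ^ s\<bar> / (2 * A) ^ s"
    using A by simp
  also have "\<dots> \<le> (2 * real s * 6 ^ s * of_int Q * A ^ (s - 1)) / (2 * A) ^ s"
    using A count_box_periodic[OF assms(1-3)] by (intro divide_right_mono) auto
  also have "\<dots> = 2 * real s * 3 ^ s * of_int Q / A"
  proof -
    have "(6::real) ^ s = 3 ^ s * 2 ^ s" by (simp flip: power_mult_distrib)
    moreover have "A ^ s = A * A ^ (s - 1)" using assms(4) by (cases s) auto
    ultimately show ?thesis using A by (simp add: power_mult_distrib field_simps)
  qed
  finally show ?thesis .
qed

text \<open>The solvable tuples lie between the periodic set at level \<open>l\<close> and its union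
  with the tuples divisible by p^l throughout, whose proportion is at most p^(-ls). The quantity
  \<open>e\<close> is the error of counting a periodic set in the box.\<close>

lemma count_ratio_Cp_bounds:
  assumes p: "prime p" and k: "k > 0" and s: "s > 0"
    and A: "real p ^ (2 * multiplicity p k + l) \<le> A"
  defines "e \<equiv> 2 * real s * 3 ^ s * real p ^ (2 * multiplicity p k + l) / A"
  shows "approx_dens s p k l - e \<le> count_ratio s (Cp p k s) A"
    "count_ratio s (Cp p k s) A \<le> approx_dens s p k l + 1 / real p ^ (l * s) + e"
proof -
  have p0: "p > 0" using p prime_gt_0_nat by blast
  hence "real p ^ (2 * multiplicity p k + l) > 0" by simp
  hence A0: "A > 0" using A by linarith
  let ?T = "approx_set p k l" and ?D = "{a. \<forall>b\<in>set a. int p ^ l dvd b}"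
  let ?Q = "int p ^ (2 * multiplicity p k + l)"
  have ratio: "\<bar>count_ratio s ?T A - approx_dens s p k l\<bar> \<le> e"
    using count_ratio_periodic[of ?Q ?T A s] periodic_approx_set[of p k l] p0 A s
    by (simp add: approx_dens_def e_def)
  have b: "card (box s A \<inter> ?T) \<le> card (box s A \<inter> Cp p k s)"
       "card (box s A \<inter> Cp p k s) \<le> card (box s A \<inter> ?T) + card (box s A \<inter> ?D)"
    unfolding box_Int_Cp
    using approx_set_solvable[OF p k] solvable_approx_set[of p k _ l]
    by (intro Int_split_card_bounds; blast intro: finite_box)+
  have D: "real (card (box s A \<inter> ?D)) \<le> (2 * A) ^ s / real p ^ (l * s)"
    using card_box_all_dvd[of A "int p ^ l" s] A0 p0 by (simp add: power_divide power_mult)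
  have "count_ratio s ?T A \<le> count_ratio s (Cp p k s) A"
    unfolding count_ratio_def using b(1) A0 by (intro divide_right_mono) auto
  thus "approx_dens s p k l - e \<le> count_ratio s (Cp p k s) A" using ratio by linarith
  have "count_ratio s (Cp p k s) A \<le> (real (card (box s A \<inter> ?T)) + real (card (box s A \<inter> ?D))) / (2 * A) ^ s"
    unfolding count_ratio_def using b(2) A0 by (intro divide_right_mono) auto
  also have "\<dots> \<le> (real (card (box s A \<inter> ?T)) + (2 * A) ^ s / real p ^ (l * s)) / (2 * A) ^ s"
    using D A0 by (intro divide_right_mono) auto
  also have "\<dots> = count_ratio s ?T A + 1 / real p ^ (l * s)"
    using A0 by (simp add: count_ratio_def add_divide_distrib)
  finally show "count_ratio s (Cp p k s) A \<le> approx_dens s p k l + 1 / real p ^ (l * s) + e"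
    using ratio by linarith
qed

text \<open>Asymptotic lower bounds t_l and upper bounds t_l + \<epsilon>_l that close up force a
  limit, namely the supremum of the lower bounds, and place it in every one of these
  intervals.\<close>

lemma tendsto_of_approximations:
  fixes f :: "real \<Rightarrow> real" and t \<epsilon> :: "nat \<Rightarrow> real"
  assumes \<epsilon>: "\<epsilon> \<longlonglongrightarrow> 0"
    and low: "\<And>l \<eta>. \<eta> > 0 \<Longrightarrow> eventually (\<lambda>A. t l - \<eta> \<le> f A) at_top"
    and up: "\<And>l \<eta>. \<eta> > 0 \<Longrightarrow> eventually (\<lambda>A. f A \<le> t l + \<epsilon> l + \<eta>) at_top"
  shows "\<exists>L. (f \<longlongrightarrow> L) at_top \<and> (\<forall>l. t l \<le> L \<and> L \<le> t l + \<epsilon> l)"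
proof -
  have le: "t l \<le> t m + \<epsilon> m" for l m
  proof (rule field_le_epsilon)
    fix e :: real assume "e > 0"
    hence ev: "eventually (\<lambda>A. t l - e / 2 \<le> f A \<and> f A \<le> t m + \<epsilon> m + e / 2) at_top"
      by (intro eventually_conj low up) auto
    obtain A where "t l - e / 2 \<le> f A \<and> f A \<le> t m + \<epsilon> m + e / 2"
      using eventually_happens'[OF trivial_limit_at_top_linorder ev] by blast
    thus "t l \<le> t m + \<epsilon> m + e" by linarith
  qed
  define L where "L = (SUP l. t l)"
  have bdd: "bdd_above (range t)" using le by (intro bdd_aboveI[of _ "t 0 + \<epsilon> 0"]) auto
  have L: "t l \<le> L" "L \<le> t l + \<epsilon> l" for l
    unfolding L_def using bdd le by (auto intro: cSUP_upper cSUP_least)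
  have "(f \<longlongrightarrow> L) at_top"
  proof (rule tendstoI)
    fix e :: real assume e: "e > 0"
    have "eventually (\<lambda>l. dist (\<epsilon> l) 0 < e / 3) sequentially"
      using \<epsilon> e by (intro tendstoD) auto
    then obtain l where l: "\<bar>\<epsilon> l\<bar> < e / 3" by (auto simp: eventually_sequentially)
    have "eventually (\<lambda>A. t l - e / 3 \<le> f A) at_top" "eventually (\<lambda>A. f A \<le> t l + \<epsilon> l + e / 3) at_top"
      using e by (auto intro: low up)
    thus "eventually (\<lambda>A. dist (f A) L < e) at_top"
    proof eventually_elim
      case (elim A)
      thus ?case using l L[of l] by (simp add: dist_real_def abs_less_iff)
    qed
  qed
  thus ?thesis using L by blast
qed

lemma eventually_const_divide_le:
  fixes c \<eta> :: real
  assumes "\<eta> > 0"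
  shows "eventually (\<lambda>A. c / A \<le> \<eta>) at_top"
proof -
  have "((\<lambda>A. c / A) \<longlongrightarrow> 0) at_top" by (intro tendsto_divide_0[OF tendsto_const] filterlim_at_top_imp_at_infinity filterlim_ident)
  hence "eventually (\<lambda>A. c / A < \<eta>) at_top" using assms by (rule order_tendstoD(2))
  thus ?thesis by eventually_elim simp
qed

text \<open>Justifies the total operator \<open>Lim\<close> in the definition of
  \<open>delta_p\<close> and gives the rate at which the periodic densities approach it; the rate is
  used again for the product over small primes.\<close>

lemma delta_p_approx:
  assumes p: "prime p" and k: "k > 0" and s: "s > 0"
  shows "(count_ratio s (Cp p k s) \<longlongrightarrow> delta_p p k s) at_top"
    "approx_dens s p k l \<le> delta_p p k s" "delta_p p k s \<le> approx_dens s p k l + 1 / real p ^ (l * s)"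
proof -
  have p1: "p > 1" using p prime_gt_1_nat by blast
  have "\<exists>L. (count_ratio s (Cp p k s) \<longlongrightarrow> L) at_top \<and>
     (\<forall>l. approx_dens s p k l \<le> L \<and> L \<le> approx_dens s p k l + 1 / real p ^ (l * s))"
  proof (rule tendsto_of_approximations)
    have "(\<lambda>l. (1 / real p ^ s) ^ l) \<longlonglongrightarrow> 0"
      using p1 s by (intro LIMSEQ_realpow_zero) (auto intro!: one_less_power)
    thus "(\<lambda>l. 1 / real p ^ (l * s)) \<longlonglongrightarrow> 0"
      by (simp add: power_divide mult.commute flip: power_mult)
  next
    fix l :: nat and \<eta> :: real assume \<eta>: "\<eta> > 0"
    let ?c = "2 * real s * 3 ^ s * real p ^ (2 * multiplicity p k + l)"
    have ev: "eventually (\<lambda>A. real p ^ (2 * multiplicity p k + l) \<le> A) at_top" by (rule eventually_ge_at_top)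
    show "eventually (\<lambda>A. approx_dens s p k l - \<eta> \<le> count_ratio s (Cp p k s) A) at_top"
      using ev eventually_const_divide_le[OF \<eta>, of ?c]
    proof eventually_elim
      case (elim A)
      thus ?case using count_ratio_Cp_bounds(1)[OF p k s elim(1)] by linarith
    qed
    show "eventually (\<lambda>A. count_ratio s (Cp p k s) A \<le> approx_dens s p k l + 1 / real p ^ (l * s) + \<eta>) at_top"
      using ev eventually_const_divide_le[OF \<eta>, of ?c]
    proof eventually_elim
      case (elim A)
      thus ?case using count_ratio_Cp_bounds(2)[OF p k s elim(1)] by linarith
    qed
  qed
  then obtain L where L: "(count_ratio s (Cp p k s) \<longlongrightarrow> L) at_top"
     "\<And>l. approx_dens s p k l \<le> L \<and> L \<le> approx_dens s p k l + 1 / real p ^ (l * s)" by blast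
  have "delta_p p k s = L" unfolding delta_p_def using L(1) by (intro tendsto_Lim) auto
  thus "(count_ratio s (Cp p k s) \<longlongrightarrow> delta_p p k s) at_top"
    "approx_dens s p k l \<le> delta_p p k s" "delta_p p k s \<le> approx_dens s p k l + 1 / real p ^ (l * s)"
    using L by auto
qed

lemma delta_p_pos: "prime p \<Longrightarrow> k > 0 \<Longrightarrow> s \<ge> 2 \<Longrightarrow> delta_p p k s > 0"
  using approx_dens_1_pos[of p s k] delta_p_approx(2)[of p k s 1] by simp

lemma periodic_UNIV [simp]: "periodic Q UNIV"
  by (simp add: periodic_def)

lemma dens_1_UNIV [simp]: "dens s 1 UNIV = 1"
  by (simp add: dens_def card_tuples)

lemma count_ratio_UNIV_tendsto: "s > 0 \<Longrightarrow> (count_ratio s UNIV \<longlongrightarrow> 1) at_top"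
proof (rule tendstoI)
  fix e :: real assume s: "s > 0" and e: "e > 0"
  have "eventually (\<lambda>A. 1 \<le> (A::real)) at_top" by (rule eventually_ge_at_top)
  moreover have "eventually (\<lambda>A. 2 * real s * 3 ^ s / A \<le> e / 2) at_top"
    using e by (intro eventually_const_divide_le) auto
  ultimately show "eventually (\<lambda>A. dist (count_ratio s UNIV A) 1 < e) at_top"
  proof eventually_elim
    case (elim A)
    have "\<bar>count_ratio s UNIV A - dens s 1 UNIV\<bar> \<le> 2 * real s * 3 ^ s * of_int 1 / A"
      using elim s by (intro count_ratio_periodic) auto
    thus ?case using elim(2) e unfolding dist_real_def dens_1_UNIV by simp
  qed
qed

lemma delta_p_le_1:
  assumes p: "prime p" and k: "k > 0" and s: "s > 0"
  shows "delta_p p k s \<le> 1"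
proof (rule tendsto_le[OF _ count_ratio_UNIV_tendsto[OF s] delta_p_approx(1)[OF assms]])
  show "eventually (\<lambda>A. count_ratio s (Cp p k s) A \<le> count_ratio s UNIV A) at_top"
    using eventually_ge_at_top[of 0]
  proof eventually_elim
    case (elim A)
    thus ?case unfolding count_ratio_def by (intro divide_right_mono of_nat_mono card_mono) auto
  qed
qed simp

lemma card_box_not_solvable:
  assumes p: "prime p" and k: "k > 0" and large: "p > 16 * k ^ 6" and s: "s \<ge> 2" and A: "A \<ge> 0"
  shows "real (card (box s A \<inter> {a. \<not> padic_unit_solvable p k a})) \<le> (4 * A) ^ s / real p ^ (s - 2)"
proof -
  have p0: "p > 0" using p prime_gt_0_nat by blast
  have "card (box s A \<inter> {a. \<not> padic_unit_solvable p k a})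
      \<le> card (box s A \<inter> {a. length (filter (\<lambda>b. \<not> int p dvd b) a) \<le> 2})"
    using not_solvable_imp_few[OF p k large] by (intro card_mono) auto
  hence "real (card (box s A \<inter> {a. \<not> padic_unit_solvable p k a}))
      \<le> real (card (box s A \<inter> {a. length (filter (\<lambda>b. \<not> int p dvd b) a) \<le> 2}))" by (rule of_nat_mono)
  also have "\<dots> \<le> (4 * A) ^ s / of_int (int p) ^ (s - 2)"
    using p0 s A by (intro card_box_few_nondvd) auto
  finally show ?thesis by simp
qed

text \<open>The bound on the proportion of failing tuples is uniform in A and hence survives the
  limit; 2^s is the quotient of (4A)^s by (2A)^s.\<close>

lemma delta_p_ge:
  assumes p: "prime p" and k: "k > 0" and large: "p > 16 * k ^ 6" and s: "s \<ge> 2"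
  shows "1 - delta_p p k s \<le> 2 ^ s / real p ^ (s - 2)"
proof -
  have s0: "s > 0" using s by simp
  have "((\<lambda>A. count_ratio s UNIV A - count_ratio s (Cp p k s) A) \<longlongrightarrow> 1 - delta_p p k s) at_top"
    by (intro tendsto_diff count_ratio_UNIV_tendsto delta_p_approx(1) p k s0)
  moreover have "eventually (\<lambda>A. count_ratio s UNIV A - count_ratio s (Cp p k s) A \<le> 2 ^ s / real p ^ (s - 2)) at_top"
    using eventually_gt_at_top[of 0]
  proof eventually_elim
    case (elim A)
    let ?N = "{a. \<not> padic_unit_solvable p k a}"
    have "card (box s A \<inter> UNIV) = card (box s A \<inter> Cp p k s) + card (box s A \<inter> ?N)"
    proof -
      have "box s A \<inter> UNIV = (box s A \<inter> Cp p k s) \<union> (box s A \<inter> ?N)" unfolding box_Int_Cp by blast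
      moreover have "(box s A \<inter> Cp p k s) \<inter> (box s A \<inter> ?N) = {}" by (auto simp: Cp_def)
      ultimately show ?thesis by (metis card_Un_disjoint finite_Int finite_box)
    qed
    hence "count_ratio s UNIV A - count_ratio s (Cp p k s) A = real (card (box s A \<inter> ?N)) / (2 * A) ^ s"
      by (simp add: count_ratio_def add_divide_distrib)
    also have "\<dots> \<le> ((4 * A) ^ s / real p ^ (s - 2)) / (2 * A) ^ s"
      using card_box_not_solvable[OF p k large s] elim by (intro divide_right_mono) auto
    also have "\<dots> = 2 ^ s / real p ^ (s - 2)"
    proof -
      have "(4 * A) ^ s = 2 ^ s * (2 * A) ^ s" by (subst power_mult_distrib [symmetric]) simp
      thus ?thesis using elim by simp
    qed
    finally show ?case .
  qed
  ultimately show ?thesis by (rule tendsto_upperbound) simp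
qed

section \<open>Independence of the local conditions at distinct primes\<close>

lemma periodic_dvd:
  assumes "periodic Q T" "Q dvd R"
  shows "periodic R T"
proof -
  have "map (\<lambda>b. b mod Q) (map (\<lambda>b. b mod R) a) = map (\<lambda>b. b mod Q) a" for a
    using assms(2) by (simp add: mod_mod_cancel)
  thus ?thesis using assms(1) unfolding periodic_def by metis
qed

text \<open>The Chinese remainder theorem entry by entry: reduction modulo both factors is a
  bijection from residue tuples onto pairs of residue tuples.\<close>

lemma dens_Int_coprime:
  assumes Q: "Q1 > 0" "Q2 > 0" "coprime Q1 Q2" and per: "periodic Q1 T1" "periodic Q2 T2"
  shows "dens s (Q1 * Q2) (T1 \<inter> T2) = dens s Q1 T1 * dens s Q2 T2"
proof -
  define h where "h = (\<lambda>r. (map (\<lambda>b. b mod Q1) r, map (\<lambda>b. b mod Q2) r))"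
  let ?R = "tuples s {0..<Q1 * Q2} \<inter> (T1 \<inter> T2)"
  let ?R1 = "tuples s {0..<Q1} \<inter> T1" and ?R2 = "tuples s {0..<Q2} \<inter> T2"
  have unique: "x = y" if "x \<in> {0..<Q1 * Q2}" "y \<in> {0..<Q1 * Q2}" "x mod Q1 = y mod Q1" "x mod Q2 = y mod Q2" for x y
  proof -
    have "Q1 dvd x - y" "Q2 dvd x - y" using that by (auto simp: mod_eq_dvd_iff)
    hence "Q1 * Q2 dvd x - y" using Q(3) by (simp add: divides_mult)
    hence "x mod (Q1 * Q2) = y mod (Q1 * Q2)" by (simp add: mod_eq_dvd_iff)
    thus ?thesis using that by simp
  qed
  have "\<exists>z. z \<in> {0..<Q1 * Q2} \<and> z mod Q1 = x mod Q1 \<and> z mod Q2 = y mod Q2" for x y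
  proof -
    obtain z where z: "[z = x] (mod Q1)" "[z = y] (mod Q2)"
      using binary_chinese_remainder_int[OF Q(3)] by blast
    have "z mod (Q1 * Q2) \<in> {0..<Q1 * Q2}" using Q by simp
    moreover have "z mod (Q1 * Q2) mod Q1 = x mod Q1" "z mod (Q1 * Q2) mod Q2 = y mod Q2"
      using z by (simp_all add: mod_mod_cancel cong_def)
    ultimately show ?thesis by blast
  qed
  then obtain f where f: "\<And>x y. f x y \<in> {0..<Q1 * Q2}" "\<And>x y. f x y mod Q1 = x mod Q1"
      "\<And>x y. f x y mod Q2 = y mod Q2" by metis
  have "bij_betw h ?R (?R1 \<times> ?R2)"
    unfolding bij_betw_def
  proof
    show "inj_on h ?R"
    proof (rule inj_onI)
      fix r r' assume r: "r \<in> ?R" "r' \<in> ?R" and eq: "h r = h r'"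
      show "r = r'"
      proof (rule nth_equalityI)
        show len: "length r = length r'" using r by (simp add: tuples_def)
        fix i assume i: "i < length r"
        have "r ! i mod Q1 = r' ! i mod Q1" "r ! i mod Q2 = r' ! i mod Q2"
          using eq i len by (auto simp: h_def list_eq_iff_nth_eq)
        moreover have "r ! i \<in> set r" "r' ! i \<in> set r'" using i len by auto
        hence "r ! i \<in> {0..<Q1 * Q2}" "r' ! i \<in> {0..<Q1 * Q2}" using r by (auto simp: tuples_def)
        ultimately show "r ! i = r' ! i" using unique by blast
      qed
    qed
    show "h ` ?R = ?R1 \<times> ?R2"
    proof (intro equalityI subsetI)
      fix w assume "w \<in> h ` ?R"
      then obtain r where r: "r \<in> ?R" "w = h r" by blast
      have "map (\<lambda>b. b mod Q1) r \<in> T1" "map (\<lambda>b. b mod Q2) r \<in> T2"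
        using r per unfolding periodic_def by blast+
      moreover have "map (\<lambda>b. b mod Q1) r \<in> tuples s {0..<Q1}" "map (\<lambda>b. b mod Q2) r \<in> tuples s {0..<Q2}"
        using r(1) Q by (auto simp: tuples_def)
      ultimately show "w \<in> ?R1 \<times> ?R2" unfolding r(2) h_def by blast
    next
      fix w assume w: "w \<in> ?R1 \<times> ?R2"
      then obtain r1 r2 where r: "w = (r1, r2)" "r1 \<in> ?R1" "r2 \<in> ?R2" by blast
      have len: "length r1 = s" "length r2 = s" using r by (auto simp: tuples_def)
      define r where "r = map2 f r1 r2"
      have m1: "map (\<lambda>b. b mod Q1) r = r1"
      proof (rule nth_equalityI)
        fix i assume "i < length (map (\<lambda>b. b mod Q1) r)"
        hence i: "i < s" using len by (simp add: r_def)
        hence "r1 ! i \<in> set r1" using len by simp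
        hence "r1 ! i \<in> {0..<Q1}" using r by (auto simp: tuples_def)
        thus "map (\<lambda>b. b mod Q1) r ! i = r1 ! i" using i len by (simp add: r_def f)
      qed (simp add: r_def len)
      have m2: "map (\<lambda>b. b mod Q2) r = r2"
      proof (rule nth_equalityI)
        fix i assume "i < length (map (\<lambda>b. b mod Q2) r)"
        hence i: "i < s" using len by (simp add: r_def)
        hence "r2 ! i \<in> set r2" using len by simp
        hence "r2 ! i \<in> {0..<Q2}" using r by (auto simp: tuples_def)
        thus "map (\<lambda>b. b mod Q2) r ! i = r2 ! i" using i len by (simp add: r_def f)
      qed (simp add: r_def len)
      have "r \<in> T1" "r \<in> T2" using per m1 m2 r unfolding periodic_def by auto
      moreover have "set r \<subseteq> {0..<Q1 * Q2}" unfolding r_def using f(1) by auto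
      moreover have "length r = s" by (simp add: r_def len)
      ultimately have "r \<in> ?R" by (simp add: tuples_def)
      moreover have "h r = w" using m1 m2 r by (simp add: h_def)
      ultimately show "w \<in> h ` ?R" by blast
    qed
  qed
  hence "card ?R = card (?R1 \<times> ?R2)" by (rule bij_betw_same_card)
  thus ?thesis by (simp add: dens_def card_cartesian_product power_mult_distrib)
qed

lemma dens_INT_primes:
  fixes e :: "nat \<Rightarrow> nat"
  assumes "finite P" "\<And>p. p \<in> P \<Longrightarrow> prime p"
    "\<And>p. p \<in> P \<Longrightarrow> periodic (int p ^ e p) (T p)"
  shows "periodic (\<Prod>p\<in>P. int p ^ e p) (\<Inter>p\<in>P. T p) \<and>
    dens s (\<Prod>p\<in>P. int p ^ e p) (\<Inter>p\<in>P. T p) = (\<Prod>p\<in>P. dens s (int p ^ e p) (T p))"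
  using assms
proof (induction P rule: finite_induct)
  case empty
  show ?case by simp
next
  case (insert p P)
  let ?Q1 = "int p ^ e p" and ?Q2 = "\<Prod>p\<in>P. int p ^ e p"
  have "coprime ?Q1 ?Q2"
  proof (rule prod_coprime_right)
    fix q assume "q \<in> P"
    hence "coprime p q" using insert by (intro primes_coprime) auto
    thus "coprime (int p ^ e p) (int q ^ e q)" by simp
  qed
  moreover have "?Q1 > 0" "?Q2 > 0" using insert.prems(1) prime_gt_0_nat by (auto intro!: prod_pos)
  moreover have "periodic ?Q1 (T p)" using insert.prems by simp
  moreover have IH: "periodic ?Q2 (\<Inter>p\<in>P. T p)"
      "dens s ?Q2 (\<Inter>p\<in>P. T p) = (\<Prod>p\<in>P. dens s (int p ^ e p) (T p))"
    using insert by auto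
  ultimately have "dens s (?Q1 * ?Q2) (T p \<inter> (\<Inter>p\<in>P. T p)) = dens s ?Q1 (T p) * dens s ?Q2 (\<Inter>p\<in>P. T p)"
    by (intro dens_Int_coprime)
  moreover have "periodic (?Q1 * ?Q2) (T p \<inter> (\<Inter>p\<in>P. T p))"
    using periodic_dvd[of ?Q1 "T p" "?Q1 * ?Q2"] periodic_dvd[OF IH(1), of "?Q1 * ?Q2"] insert.prems
    by (simp add: periodic_def)
  ultimately show ?case using insert.hyps IH by simp
qed

section \<open>The local density at large primes\<close>


text \<open>The equation is homogeneous in its coefficients, so a common factor \<open>p\<close> can
  be cancelled.\<close>

lemma solvable_scale:
  assumes "p > 0"
  shows "padic_unit_solvable p k (map ((*) (int p)) a) \<longleftrightarrow> padic_unit_solvable p k a"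
proof -
  have eq: "(\<Sum>j<length a. map ((*) (int p)) a ! j * x j n ^ k) = int p * (\<Sum>j<length a. a ! j * x j n ^ k)"
    for x :: "nat \<Rightarrow> nat \<Rightarrow> int" and n
    unfolding sum_distrib_left by (intro sum.cong) auto
  show ?thesis
  proof
    assume "padic_unit_solvable p k a"
    thus "padic_unit_solvable p k (map ((*) (int p)) a)"
      unfolding padic_unit_solvable_def length_map eq dvd_eq_mod_eq_0 [symmetric] by (meson dvd_mult)
  next
    assume "padic_unit_solvable p k (map ((*) (int p)) a)"
    then obtain x where x: "\<And>j. j < length a \<Longrightarrow> padic_int p (x j) \<and> padic_unit p (x j)"
        "\<And>n. int p ^ n dvd int p * (\<Sum>j<length a. a ! j * x j n ^ k)"
      unfolding padic_unit_solvable_def length_map eq dvd_eq_mod_eq_0 [symmetric] by blast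
    have "int p ^ n dvd (\<Sum>j<length a. a ! j * x j n ^ k)" for n
    proof -
      \<comment> \<open>Cancelling \<open>p\<close> costs one digit, so the congruence is read off
        at level n + 1 and carried to level n by compatibility.\<close>
      have "int p ^ n dvd (\<Sum>j<length a. a ! j * x j (Suc n) ^ k)"
        using x(2)[of "Suc n"] assms by simp
      moreover have "[(\<Sum>j<length a. a ! j * x j (Suc n) ^ k) = (\<Sum>j<length a. a ! j * x j n ^ k)] (mod int p ^ n)"
      proof (intro cong_sum cong_mult cong_pow cong_refl)
        fix j assume "j \<in> {..<length a}"
        hence "padic_int p (x j)" using x(1) by simp
        thus "[x j (Suc n) = x j n] (mod int p ^ n)"
          using padic_int_cong[of p "x j" n "Suc n"] padic_int_cong[of p "x j" n n] by (simp add: cong_def)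
      qed
      ultimately show ?thesis by (simp only: cong_def dvd_eq_mod_eq_0)
    qed
    thus "padic_unit_solvable p k a"
      unfolding padic_unit_solvable_def dvd_eq_mod_eq_0 [symmetric] using x(1) by blast
  qed
qed

text \<open>Solvable tuples with an entry prime to \<open>p\<close> are those of the level-one
  approximation; the others are \<open>p\<close> times a solvable tuple in the box of size
  A/p.\<close>

lemma card_box_Cp_split:
  assumes p: "prime p" and k: "k > 0"
  shows "card (box s A \<inter> Cp p k s) = card (box s A \<inter> approx_set p k 1) + card (box s (A / real p) \<inter> Cp p k s)"
proof -
  have p0: "p > 0" using p prime_gt_0_nat by blast
  let ?f = "map ((*) (int p))"
  have abs: "real_of_int \<bar>int p * b\<bar> \<le> A \<longleftrightarrow> real_of_int \<bar>b\<bar> \<le> A / real p" for b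
    using p0 by (simp add: abs_mult field_simps)
  have "box s A \<inter> Cp p k s = (box s A \<inter> approx_set p k 1) \<union> ?f ` (box s (A / real p) \<inter> Cp p k s)"
  proof (intro equalityI subsetI)
    fix a assume a: "a \<in> box s A \<inter> Cp p k s"
    show "a \<in> (box s A \<inter> approx_set p k 1) \<union> ?f ` (box s (A / real p) \<inter> Cp p k s)"
    proof (cases "\<forall>b\<in>set a. int p dvd b")
      case False
      have "padic_unit_solvable p k a" using a by (simp add: Cp_def)
      from solvable_approx_set[OF this, of 1] show ?thesis using False a by auto
    next
      case True
      define a' where "a' = map (\<lambda>b. b div int p) a"
      have fa: "a = ?f a'" unfolding a'_def using True by (simp add: map_idI)
      have nz: "b \<noteq> 0 \<and> real_of_int \<bar>b\<bar> \<le> A / real p" if "b \<in> set a'" for b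
      proof -
        have "int p * b \<in> set a" using that fa by (metis imageI list.set_map)
        hence "int p * b \<noteq> 0" "real_of_int \<bar>int p * b\<bar> \<le> A" using a by (auto simp: box_def)
        thus ?thesis using abs[of b] by auto
      qed
      have "length a' = s" using a by (simp add: a'_def box_def)
      moreover have "padic_unit_solvable p k a'" using a fa solvable_scale[OF p0] by (simp add: Cp_def)
      ultimately have "a' \<in> box s (A / real p) \<inter> Cp p k s" using nz by (auto simp: box_def Cp_def)
      thus ?thesis using fa by blast
    qed
  next
    fix a assume "a \<in> (box s A \<inter> approx_set p k 1) \<union> ?f ` (box s (A / real p) \<inter> Cp p k s)"
    thus "a \<in> box s A \<inter> Cp p k s"
    proof
      assume "a \<in> box s A \<inter> approx_set p k 1"
      thus ?thesis using approx_set_solvable[OF p k, of a 1] by (auto simp: box_def Cp_def)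
    next
      assume "a \<in> ?f ` (box s (A / real p) \<inter> Cp p k s)"
      then obtain a' where a': "a = ?f a'" "a' \<in> box s (A / real p) \<inter> Cp p k s" by blast
      have "a \<in> box s A" unfolding box_def
      proof (intro CollectI conjI ballI)
        show "length a = s" using a' by (simp add: box_def)
        fix b assume "b \<in> set a"
        then obtain c where c: "b = int p * c" "c \<in> set a'" using a' by auto
        hence "c \<noteq> 0" "real_of_int \<bar>c\<bar> \<le> A / real p" using a' by (auto simp: box_def)
        thus "b \<noteq> 0" "real_of_int \<bar>b\<bar> \<le> A" using c abs[of c] p0 by auto
      qed
      moreover have "padic_unit_solvable p k a" using a' solvable_scale[OF p0] by (simp add: Cp_def)
      ultimately show ?thesis by (simp add: box_Int_Cp)
    qed
  qed
  moreover have "(box s A \<inter> approx_set p k 1) \<inter> ?f ` (box s (A / real p) \<inter> Cp p k s) = {}"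
    by (auto simp: approx_set_def)
  ultimately have "card (box s A \<inter> Cp p k s)
      = card (box s A \<inter> approx_set p k 1) + card (?f ` (box s (A / real p) \<inter> Cp p k s))"
    by (metis card_Un_disjoint finite_Int finite_box finite_imageI)
  also have "card (?f ` (box s (A / real p) \<inter> Cp p k s)) = card (box s (A / real p) \<inter> Cp p k s)"
    using p0 by (intro card_image inj_on_subset[OF inj_mapI]) (auto simp: inj_on_def)
  finally show ?thesis .
qed

text \<open>Self-similarity under division by \<open>p\<close> becomes a linear equation for the
  density. It accounts for the factor (1 - p^(-s))^(-1) of the closed formula.\<close>

lemma delta_p_recursion:
  assumes p: "prime p" and k: "k > 0" and s: "s > 0"
  shows "delta_p p k s = approx_dens s p k 1 + delta_p p k s / real p ^ s"
proof -
  have p0: "p > 0" using p prime_gt_0_nat by blast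
  let ?T = "approx_set p k 1" and ?Q = "int p ^ (2 * multiplicity p k + 1)"
  have "(count_ratio s ?T \<longlongrightarrow> approx_dens s p k 1) at_top"
  proof (rule tendstoI)
    fix e :: real assume e: "e > 0"
    have "eventually (\<lambda>A. real_of_int ?Q \<le> A) at_top" by (rule eventually_ge_at_top)
    moreover have "eventually (\<lambda>A. 2 * real s * 3 ^ s * of_int ?Q / A \<le> e / 2) at_top"
      using e by (intro eventually_const_divide_le) auto
    ultimately show "eventually (\<lambda>A. dist (count_ratio s ?T A) (approx_dens s p k 1) < e) at_top"
    proof eventually_elim
      case (elim A)
      have "\<bar>count_ratio s ?T A - dens s ?Q ?T\<bar> \<le> 2 * real s * 3 ^ s * of_int ?Q / A"
        using elim s p0 periodic_approx_set[of p k 1] by (intro count_ratio_periodic) auto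
      thus ?case using elim(2) e unfolding dist_real_def approx_dens_def by linarith
    qed
  qed
  moreover have "((\<lambda>A. count_ratio s (Cp p k s) (A / real p)) \<longlongrightarrow> delta_p p k s) at_top"
  proof (rule filterlim_compose[OF delta_p_approx(1)[OF assms]])
    have "filterlim (\<lambda>A::real. inverse (real p) * A) at_top at_top"
      using p0 by (intro filterlim_tendsto_pos_mult_at_top[OF tendsto_const] filterlim_ident) auto
    thus "filterlim (\<lambda>A::real. A / real p) at_top at_top" by (simp add: divide_inverse mult.commute)
  qed
  ultimately have "((\<lambda>A. count_ratio s ?T A + count_ratio s (Cp p k s) (A / real p) / real p ^ s)
     \<longlongrightarrow> approx_dens s p k 1 + delta_p p k s / real p ^ s) at_top"
    using p0 by (intro tendsto_intros) auto
  moreover have "eventually (\<lambda>A. count_ratio s ?T A + count_ratio s (Cp p k s) (A / real p) / real p ^ s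
      = count_ratio s (Cp p k s) A) at_top"
    using eventually_gt_at_top[of 0]
  proof eventually_elim
    case (elim A)
    have "(2 * (A / real p)) ^ s * real p ^ s = (2 * A) ^ s"
      using p0 by (subst power_mult_distrib [symmetric]) simp
    thus ?case using p0 elim unfolding count_ratio_def card_box_Cp_split[OF p k, of s A]
      by (simp add: add_divide_distrib)
  qed
  ultimately have "(count_ratio s (Cp p k s) \<longlongrightarrow> approx_dens s p k 1 + delta_p p k s / real p ^ s) at_top"
    by (rule Lim_transform_eventually)
  thus ?thesis using delta_p_approx(1)[OF assms] by (intro tendsto_unique[of at_top]) auto
qed

text \<open>Once the sequence of nonzero entries is prescribed, only their positions remain to be
  chosen. \<open>X\<close> will be the residues modulo \<open>p\<close>, with 0 standing for the
  multiples of \<open>p\<close>.\<close>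

lemma card_filter_fibre:
  assumes "finite X" "0 \<in> X" "set w \<subseteq> X - {0}"
  shows "card {r\<in>tuples s X. filter (\<lambda>b. b \<noteq> 0) r = w} = s choose length w"
  using assms(3)
proof (induction s arbitrary: w)
  case 0
  have "{r\<in>tuples 0 X. filter (\<lambda>b. b \<noteq> 0) r = w} = (if w = [] then {[]} else {})" by auto
  thus ?case by (cases w) simp_all
next
  case (Suc s)
  let ?F = "\<lambda>s w. {r\<in>tuples s X. filter (\<lambda>b. b \<noteq> 0) r = w}"
  have fin: "finite (?F s w)" for w using assms(1) finite_tuples by simp
  show ?case
  proof (cases w)
    case Nil
    have "?F (Suc s) w = (#) 0 ` ?F s w" unfolding tuples_Suc Nil using assms(2) by (auto simp: image_iff split: if_splits)
    thus ?thesis using Suc.IH[of w] Suc.prems Nil by (simp add: card_image)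
  next
    case (Cons u w')
    have u: "u \<noteq> 0" "u \<in> X" using Suc.prems Cons by auto
    have "?F (Suc s) w = (#) 0 ` ?F s w \<union> (#) u ` ?F s w'"
    proof (intro equalityI subsetI)
      fix r assume "r \<in> ?F (Suc s) w"
      then obtain x r' where r: "r = x # r'" "r' \<in> tuples s X" "filter (\<lambda>b. b \<noteq> 0) (x # r') = w"
        by (auto simp: tuples_Suc)
      show "r \<in> (#) 0 ` ?F s w \<union> (#) u ` ?F s w'"
        using r unfolding Cons by (cases "x = 0") auto
    next
      fix r assume "r \<in> (#) 0 ` ?F s w \<union> (#) u ` ?F s w'"
      thus "r \<in> ?F (Suc s) w" unfolding Cons using assms(2) u by (auto simp: tuples_def)
    qed
    moreover have "(#) 0 ` ?F s w \<inter> (#) u ` ?F s w' = {}" using u by auto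
    ultimately have "card (?F (Suc s) w) = card ((#) 0 ` ?F s w) + card ((#) u ` ?F s w')"
      by (simp only: card_Un_disjoint[OF finite_imageI[OF fin] finite_imageI[OF fin]])
    also have "\<dots> = card (?F s w) + card (?F s w')" by (simp add: card_image)
    finally show ?thesis using Suc.IH[of w] Suc.IH[of w'] Suc.prems Cons by simp
  qed
qed

text \<open>For given u the admissible v are -u times a k-th power, which form a coset of
  (p-1)/gcd(p-1, k) elements.\<close>

lemma card_unit_pairs:
  assumes p: "prime p"
  shows "card {(u, v) \<in> {1..<int p} \<times> {1..<int p}. unit_rep p k (int p) [u, v] 0}
    = (p - 1) * ((p - 1) div gcd (p - 1) k)"
proof -
  have p1: "p > 1" using p prime_gt_1_nat by blast
  have pint: "prime (int p)" using p by simp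
  let ?U = "{1..<int p}" and ?H = "(\<lambda>x. x ^ k mod int p) ` {1..<int p}"
  have fib: "card {v\<in>?U. unit_rep p k (int p) [u, v] 0} = (p - 1) div gcd (p - 1) k" if u: "u \<in> ?U" for u
  proof -
    have nd: "\<not> int p dvd - u" using not_dvd_residue[OF u] by simp
    have bij: "bij_betw (\<lambda>x. - u * x mod int p) ?U ?U" by (rule bij_betw_mult_mod[OF p nd])
    have HU: "?H \<subseteq> ?U"
    proof (rule image_subsetI)
      fix x assume "x \<in> ?U"
      hence "\<not> int p dvd x ^ k" using not_dvd_residue prime_dvd_power[OF pint] by blast
      hence "x ^ k mod int p \<noteq> 0" by (simp add: dvd_eq_mod_eq_0)
      moreover have "0 \<le> x ^ k mod int p" "x ^ k mod int p < int p" using p1 by auto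
      ultimately show "x ^ k mod int p \<in> ?U" by simp
    qed
    have "{v\<in>?U. unit_rep p k (int p) [u, v] 0} = (\<lambda>x. - u * x mod int p) ` ?H"
    proof (intro equalityI subsetI)
      fix v assume v: "v \<in> {v\<in>?U. unit_rep p k (int p) [u, v] 0}"
      then obtain x y where xy: "\<not> int p dvd x" "\<not> int p dvd y" "int p dvd - (u * x ^ k) - v * y ^ k"
        by (auto simp: unit_rep_Cons)
      have "coprime y (int p)" using xy(2) pint by (metis coprime_commute prime_imp_coprime)
      \<comment> \<open>\<open>z\<close> inverts \<open>y\<close>: division by y^k brings the
        congruence to the form v = -u (x z)^k.\<close>
      then obtain z where z: "[y * z = 1] (mod int p)" using cong_solve_coprime_int by blast
      have "\<not> int p dvd z"
        using z pint cong_dvd_iff[OF z] p1 by (metis cong_dvd_iff dvd_mult not_prime_unit)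
      hence "\<not> int p dvd x * z" using xy(1) pint by (simp add: prime_dvd_mult_iff)
      hence "x * z mod int p \<noteq> 0" by (simp add: dvd_eq_mod_eq_0)
      moreover have "0 \<le> x * z mod int p" "x * z mod int p < int p" using p1 by auto
      ultimately have m: "x * z mod int p \<in> ?U" by simp
      have "[v * y ^ k = - u * x ^ k] (mod int p)"
        using xy(3) by (intro cong_sym[of "- u * x ^ k"]) (simp add: cong_iff_dvd_diff)
      hence "[v * y ^ k * z ^ k = - u * x ^ k * z ^ k] (mod int p)" by (rule cong_mult[OF _ cong_refl])
      moreover have "[v * (y * z) ^ k = v * 1 ^ k] (mod int p)" by (intro cong_mult cong_refl cong_pow z)
      ultimately have "[v = - u * (x * z) ^ k] (mod int p)"
        by (simp add: power_mult_distrib mult.assoc) (metis cong_sym cong_trans)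
      moreover have "[- u * (x * z) ^ k = - u * ((x * z mod int p) ^ k mod int p)] (mod int p)"
        by (intro cong_mult cong_refl) (simp add: cong_def power_mod)
      ultimately have "[v = - u * ((x * z mod int p) ^ k mod int p)] (mod int p)" by (rule cong_trans)
      moreover have "v mod int p = v" using v by simp
      ultimately have "v = - u * ((x * z mod int p) ^ k mod int p) mod int p" by (simp only: cong_def)
      thus "v \<in> (\<lambda>x. - u * x mod int p) ` ?H" using m by blast
    next
      fix v assume "v \<in> (\<lambda>x. - u * x mod int p) ` ?H"
      then obtain x where x: "x \<in> ?U" "v = - u * (x ^ k mod int p) mod int p" by blast
      have "v \<in> ?U" using x HU bij unfolding bij_betw_def by blast
      moreover have "[u * x ^ k + v * 1 ^ k = 0] (mod int p)"
      proof -
        have "[v = - u * (x ^ k mod int p)] (mod int p)" unfolding x(2) by (simp add: cong_def)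
        also have "[- u * (x ^ k mod int p) = - u * x ^ k] (mod int p)"
          by (intro cong_mult cong_refl) (simp add: cong_def)
        finally have "[u * x ^ k + v = u * x ^ k + - u * x ^ k] (mod int p)" by (intro cong_add cong_refl)
        thus ?thesis by simp
      qed
      hence "int p dvd - (u * x ^ k + v * 1 ^ k)" by (simp only: cong_0_iff dvd_minus_iff)
      hence "int p dvd 0 - u * x ^ k - v * 1 ^ k" by simp
      hence "unit_rep p k (int p) [u, v] 0"
        unfolding unit_rep_Cons unit_rep_Nil using not_dvd_residue[OF x(1)] not_dvd_residue[of 1 p] p1
        by (intro exI[of _ x] conjI exI[of _ 1]) auto
      ultimately show "v \<in> {v\<in>?U. unit_rep p k (int p) [u, v] 0}" by blast
    qed
    moreover have "inj_on (\<lambda>x. - u * x mod int p) ?H"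
      using bij HU by (auto simp: bij_betw_def intro: inj_on_subset)
    ultimately show ?thesis using card_power_residues[OF p] by (simp add: card_image)
  qed
  have "{(u, v) \<in> ?U \<times> ?U. unit_rep p k (int p) [u, v] 0}
      = (SIGMA u:?U. {v\<in>?U. unit_rep p k (int p) [u, v] 0})" by auto
  hence "card {(u, v) \<in> ?U \<times> ?U. unit_rep p k (int p) [u, v] 0}
      = card (SIGMA u:?U. {v\<in>?U. unit_rep p k (int p) [u, v] 0})" by (rule arg_cong)
  also have "\<dots> = (\<Sum>u\<in>?U. card {v\<in>?U. unit_rep p k (int p) [u, v] 0})"
    by (rule card_SigmaI) (auto intro: finite_subset[of _ ?U])
  also have "\<dots> = (\<Sum>u\<in>?U. (p - 1) div gcd (p - 1) k)" by (intro sum.cong refl fib)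
  finally show ?thesis using p1 by (simp add: nat_diff_distrib)
qed

text \<open>Past the threshold a residue tuple fails exactly when it has no nonzero entry, just one,
  or just two that form an unsolvable pair. The three cases give the three subtracted terms.\<close>

lemma card_approx_set_1:
  assumes p: "prime p" and k: "k > 0" and large: "p > 16 * k ^ 6"
  shows "real (card (tuples s {0..<int p} \<inter> approx_set p k 1)) =
    real p ^ s - 1 - real s * (real p - 1)
      - real (s choose 2) * ((real p - 1) ^ 2 * (1 - 1 / real (gcd (p - 1) k)))"
proof -
  have p1: "p > 1" using p prime_gt_1_nat by blast
  have pint: "prime (int p)" using p by simp
  let ?X = "{0..<int p}" and ?U = "{1..<int p}" and ?T = "approx_set p k 1"
  let ?G = "{(u, v) \<in> ?U \<times> ?U. unit_rep p k (int p) [u, v] 0}"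
  let ?F = "\<lambda>w. {r\<in>tuples s ?X. filter (\<lambda>b. b \<noteq> 0) r = w}"
  define N where "N = ?U \<times> ?U - ?G"
  \<comment> \<open>The sequences of nonzero entries that failing tuples can have; the zeros are put
    back by \<open>card_filter_fibre\<close>.\<close>
  define Bad where "Bad = {[]} \<union> (\<lambda>u. [u]) ` ?U \<union> (\<lambda>(u, v). [u, v]) ` N"
  have mult0: "multiplicity p k = 0" by (rule multiplicity_large_prime[OF k large])
  have finN: "finite N" by (simp add: N_def)
  have finBad: "finite Bad" using finN by (simp add: Bad_def)
  have "tuples s ?X - ?T = (\<Union>w\<in>Bad. ?F w)"
  proof -
    have "r \<notin> ?T \<longleftrightarrow> filter (\<lambda>b. b \<noteq> 0) r \<in> Bad" if r: "r \<in> tuples s ?X" for r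
    proof -
      define w where "w = filter (\<lambda>b. b \<noteq> 0) r"
      have wU: "set w \<subseteq> ?U" using r by (auto simp: w_def tuples_def)
      have "filter (\<lambda>b. \<not> int p dvd b) r = w"
        unfolding w_def
      proof (rule filter_cong[OF refl])
        fix b assume "b \<in> set r"
        hence "b \<in> ?X" using r by (auto simp: tuples_def)
        thus "(\<not> int p dvd b) = (b \<noteq> 0)" using not_dvd_residue[of b p] by (cases "b = 0") auto
      qed
      note w = this
      have T: "r \<in> ?T \<longleftrightarrow> w \<noteq> [] \<and> unit_rep p k (int p) w 0"
        unfolding approx_set_def mem_Collect_eq mult0 using unit_rep_filter[OF p1, of k r 0] w
        by (auto simp: filter_empty_conv)
      consider "w = []" | u where "w = [u]" | u v where "w = [u, v]" | "length w \<ge> 3"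
        by (cases w; cases "tl w"; cases "tl (tl w)") auto
      hence "(w = [] \<or> \<not> unit_rep p k (int p) w 0) \<longleftrightarrow> w \<in> Bad"
      proof cases
        case (2 u)
        hence u: "u \<in> ?U" using wU by auto
        have "\<not> unit_rep p k (int p) w 0"
          unfolding 2 using not_dvd_residue[OF u] pint
          by (auto simp: unit_rep_Cons prime_dvd_mult_iff dest: prime_dvd_power[OF pint])
        thus ?thesis using 2 u by (auto simp: Bad_def)
      next
        case (3 u v)
        hence "u \<in> ?U" "v \<in> ?U" using wU by auto
        thus ?thesis unfolding 3 by (auto simp: Bad_def N_def)
      next
        case 4
        hence "unit_rep p k (int p) r 0" using w by (intro unit_rep_three p k large) simp
        hence "unit_rep p k (int p) w 0" using unit_rep_filter[OF p1, of k r 0] w by simp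
        moreover have "w \<notin> Bad" using 4 by (auto simp: Bad_def)
        ultimately show ?thesis using 4 by auto
      qed (auto simp: Bad_def)
      thus ?thesis using T unfolding w_def [symmetric] by blast
    qed
    thus ?thesis by blast
  qed
  hence "card (tuples s ?X - ?T) = card (\<Union>w\<in>Bad. ?F w)" by simp
  also have "\<dots> = (\<Sum>w\<in>Bad. card (?F w))"
    using finBad by (intro card_UN_disjoint) (auto intro: finite_subset[OF _ finite_tuples[of ?X s]])
  also have "\<dots> = (\<Sum>w\<in>Bad. s choose length w)"
  proof (intro sum.cong refl card_filter_fibre)
    fix w assume "w \<in> Bad"
    thus "set w \<subseteq> ?X - {0}" by (auto simp: Bad_def N_def)
  qed (use p1 in auto)
  also have "\<dots> = 1 + s * (p - 1) + (s choose 2) * card N"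
  proof -
    have "(\<Sum>w\<in>Bad. s choose length w) = (\<Sum>w\<in>{[]} \<union> (\<lambda>u. [u]) ` ?U. s choose length w)
        + (\<Sum>w\<in>(\<lambda>(u, v). [u, v]) ` N. s choose length w)"
      unfolding Bad_def using finN by (intro sum.union_disjoint) auto
    also have "(\<Sum>w\<in>{[]} \<union> (\<lambda>u. [u]) ` ?U. s choose length w) = 1 + (\<Sum>w\<in>(\<lambda>u. [u]) ` ?U. s choose length w)"
      by (subst sum.union_disjoint) auto
    also have "(\<Sum>w\<in>(\<lambda>u. [u]) ` ?U. s choose length w) = s * (p - 1)"
      using p1 by (subst sum.reindex) (auto simp: inj_on_def nat_diff_distrib)
    also have "(\<Sum>w\<in>(\<lambda>(u, v). [u, v]) ` N. s choose length w) = (\<Sum>w\<in>N. s choose 2)"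
      by (subst sum.reindex) (auto simp: inj_on_def case_prod_unfold numeral_2_eq_2)
    finally show ?thesis by simp
  qed
  finally have card_bad: "card (tuples s ?X - ?T) = 1 + s * (p - 1) + (s choose 2) * card N" .
  have rN: "real (card N) = (real p - 1) ^ 2 * (1 - 1 / real (gcd (p - 1) k))"
  proof -
    have "card N + card ?G = card (?U \<times> ?U)"
    proof -
      have "?G \<subseteq> ?U \<times> ?U" by auto
      thus ?thesis unfolding N_def
        by (metis (no_types, lifting) card_Diff_subset card_mono finite_SigmaI finite_atLeastLessThan_int
            finite_subset le_add_diff_inverse2)
    qed
    also have "\<dots> = (p - 1) * (p - 1)" using p1 by (simp add: card_cartesian_product nat_diff_distrib)
    finally have "real (card N + card ?G) = real ((p - 1) * (p - 1))" by (rule arg_cong)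
    hence "real (card N) = real (p - 1) * real (p - 1) - real (card ?G)" by simp
    also have "real (card ?G) = real (p - 1) * (real (p - 1) / real (gcd (p - 1) k))"
      unfolding card_unit_pairs[OF p] by (simp add: real_of_nat_div)
    also have "real (p - 1) = real p - 1" using p1 by (simp add: of_nat_diff)
    finally show ?thesis by (simp add: power2_eq_square right_diff_distrib)
  qed
  have "card (tuples s ?X) = card (tuples s ?X \<inter> ?T) + card (tuples s ?X - ?T)"
    using finite_tuples[of ?X s] by (simp add: card_Int_Diff)
  hence "real (card (tuples s ?X \<inter> ?T)) = real (card (tuples s ?X)) - real (card (tuples s ?X - ?T))"
    by simp
  also have "real (card (tuples s ?X)) = real p ^ s" by (simp add: card_tuples)
  also have "real (card (tuples s ?X - ?T)) = 1 + real s * (real p - 1) + real (s choose 2) * real (card N)"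
    unfolding card_bad using p1 by (simp add: of_nat_diff)
  finally show ?thesis unfolding rN by simp
qed

text \<open>The recursion reads \<open>delta_p\<close> times (1 - p^(-s)) equals 1 - p^(-s) - b,
  where p^(-s) is the share of the zero residue tuple and \<open>b\<close> that of the other failing
  tuples.\<close>

lemma delta_p_formula:
  assumes p: "prime p" and k: "k > 0" and large: "p > 16 * k ^ 6" and s: "s \<ge> 2"
  shows "delta_p p k s = 1 - inverse (1 - 1 / real p ^ s) *
    (real s * (1 - 1 / real p) * (1 / real p ^ (s - 1))
      + real (s * (s - 1)) / 2 * (1 - 1 / real p) ^ 2
        * (1 - 1 / real (gcd (p - 1) k)) * (1 / real p ^ (s - 2)))"
proof -
  have p1: "p > 1" using p prime_gt_1_nat by blast
  define x where "x = 1 / real p ^ s"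
  define g where "g = 1 - 1 / real (gcd (p - 1) k)"
  define b where "b = real s * (1 - 1 / real p) * (1 / real p ^ (s - 1))
      + real (s * (s - 1)) / 2 * (1 - 1 / real p) ^ 2 * g * (1 / real p ^ (s - 2))"
  have ps: "real p ^ s = real p * real p ^ (s - 1)" "real p ^ s = (real p) ^ 2 * real p ^ (s - 2)"
  proof -
    obtain n where "s = Suc (Suc n)" using s by (cases s; cases "s - 1") auto
    thus "real p ^ s = real p * real p ^ (s - 1)" "real p ^ s = (real p) ^ 2 * real p ^ (s - 2)"
      by (simp_all add: power2_eq_square)
  qed
  have c2: "real (s choose 2) = real (s * (s - 1)) / 2"
    unfolding choose_two by (subst real_of_nat_div) auto
  have "approx_dens s p k 1 = (real p ^ s - 1 - real s * (real p - 1)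
      - real (s choose 2) * ((real p - 1) ^ 2 * g)) / real p ^ s"
    using card_approx_set_1[OF p k large, of s] multiplicity_large_prime[OF k large]
    by (simp add: approx_dens_def dens_def g_def)
  also have "\<dots> = 1 - x - (real s * (real p - 1) / real p ^ s + real (s * (s - 1)) / 2 * g * ((real p - 1) ^ 2 / real p ^ s))"
    using p1 unfolding c2 by (simp add: x_def diff_divide_distrib)
  also have "real s * (real p - 1) / real p ^ s = real s * (1 - 1 / real p) * (1 / real p ^ (s - 1))"
    unfolding ps(1) using p1 by (simp add: field_simps)
  also have "(real p - 1) ^ 2 / real p ^ s = (1 - 1 / real p) ^ 2 * (1 / real p ^ (s - 2))"
  proof -
    have "real p - 1 = real p * (1 - 1 / real p)" using p1 by (simp add: field_simps)
    hence "(real p - 1) ^ 2 = real p ^ 2 * (1 - 1 / real p) ^ 2" by (simp only: power_mult_distrib)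
    thus ?thesis unfolding ps(2) using p1 by simp
  qed
  finally have "approx_dens s p k 1 = 1 - x - b" by (simp add: b_def mult_ac)
  hence rec: "delta_p p k s * (1 - x) = 1 - x - b"
    using delta_p_recursion[OF p k, of s] s by (simp add: x_def algebra_simps)
  have "real p ^ s > 1" using p1 s by (intro one_less_power) auto
  hence "1 / real p ^ s < 1" by (subst divide_less_eq_1_pos) linarith+
  hence "1 - x > 0" by (simp add: x_def)
  hence "delta_p p k s = 1 - inverse (1 - x) * b" using rec by (simp add: field_simps)
  thus ?thesis unfolding x_def b_def g_def .
qed

section \<open>The real condition and the size of the modulus\<close>


text \<open>A one-signed sum of nonzero terms cannot vanish, and for mixed signs a solution is
  explicit.\<close>

lemma pos_real_solvable_iff:
  assumes k: "k > 0" and a: "a \<noteq> []" "\<And>b. b \<in> set a \<Longrightarrow> b \<noteq> 0"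
  shows "pos_real_solvable k a \<longleftrightarrow> (\<exists>b\<in>set a. b > 0) \<and> (\<exists>b\<in>set a. b < 0)"
proof
  assume "pos_real_solvable k a"
  then obtain x where x: "\<And>j. j < length a \<Longrightarrow> x j > (0::real)"
      "(\<Sum>j<length a. of_int (a ! j) * x j ^ k) = 0" by (auto simp: pos_real_solvable_def)
  have "0 \<in> {..<length a}" using a(1) by simp
  hence "{..<length a} \<noteq> {}" by blast
  have "\<exists>b\<in>set a. b < 0"
  proof (rule ccontr)
    assume "\<not> ?thesis"
    hence "a ! j > 0" if "j < length a" for j using a(2) that by (metis linorder_neqE nth_mem)
    hence "(\<Sum>j<length a. of_int (a ! j) * x j ^ k) > 0"
      using x(1) \<open>{..<length a} \<noteq> {}\<close> by (intro sum_pos mult_pos_pos zero_less_power) auto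
    thus False using x(2) by simp
  qed
  moreover have "\<exists>b\<in>set a. b > 0"
  proof (rule ccontr)
    assume "\<not> ?thesis"
    hence "a ! j < 0" if "j < length a" for j using a(2) that by (metis linorder_neqE nth_mem)
    hence "(\<Sum>j<length a. - (of_int (a ! j) * x j ^ k)) > 0"
      using x(1) \<open>{..<length a} \<noteq> {}\<close> by (intro sum_pos) (auto simp: mult_less_0_iff)
    thus False using x(2) by (simp add: sum_negf)
  qed
  ultimately show "(\<exists>b\<in>set a. b > 0) \<and> (\<exists>b\<in>set a. b < 0)" by blast
next
  assume "(\<exists>b\<in>set a. b > 0) \<and> (\<exists>b\<in>set a. b < 0)"
  then obtain i i' where i: "i < length a" "a ! i > 0" and i': "i' < length a" "a ! i' < 0"
    by (auto simp: in_set_conv_nth)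
  define P where "P = (\<Sum>j<length a. max (real_of_int (a ! j)) 0)"
  define N where "N = (\<Sum>j<length a. max (- real_of_int (a ! j)) 0)"
  have "P > 0" unfolding P_def using i by (intro sum_pos2[of _ i]) auto
  moreover have "N > 0" unfolding N_def using i' by (intro sum_pos2[of _ i']) auto
  ultimately have PN: "P > 0" "N > 0" by auto
  \<comment> \<open>Variables at positive coefficients satisfy x^k = N and those at negative ones
    x^k = P, so the two halves of the sum are P N and -N P.\<close>
  define x where "x = (\<lambda>j. root k (if a ! j > 0 then N else P))"
  have "\<forall>j<length a. x j > 0" using PN k by (simp add: x_def)
  moreover have "(\<Sum>j<length a. of_int (a ! j) * x j ^ k) = 0"
  proof -
    have "(\<Sum>j<length a. of_int (a ! j) * x j ^ k)
      = (\<Sum>j<length a. max (real_of_int (a ! j)) 0 * N - max (- real_of_int (a ! j)) 0 * P)"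
      using PN k by (intro sum.cong) (auto simp: x_def max_def)
    also have "\<dots> = P * N - N * P" by (simp add: P_def N_def sum_subtractf sum_distrib_right)
    finally show ?thesis by simp
  qed
  ultimately show "pos_real_solvable k a" unfolding pos_real_solvable_def by blast
qed

text \<open>With no entry zero, the real condition fails exactly for one-signed tuples, which fill
  two disjoint orthants.\<close>

lemma card_box_split_sign:
  assumes k: "k > 0" and s: "s > 0"
  shows "card (box s A \<inter> T) = card (box s A \<inter> ({a. pos_real_solvable k a} \<inter> T))
    + card (tuples s (signed_range True False A) \<inter> T) + card (tuples s (signed_range False True A) \<inter> T)"
proof -
  let ?M = "box s A \<inter> ({a. pos_real_solvable k a} \<inter> T)"
  let ?P = "tuples s (signed_range True False A) \<inter> T" and ?N = "tuples s (signed_range False True A) \<inter> T"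
  have nz: "a \<noteq> [] \<and> (\<forall>b\<in>set a. b \<noteq> 0)" if "a \<in> box s A" for a
    using that s by (auto simp: box_def)
  have iff: "pos_real_solvable k a \<longleftrightarrow> (\<exists>b\<in>set a. b > 0) \<and> (\<exists>b\<in>set a. b < 0)" if "a \<in> box s A" for a
    using nz[OF that] by (intro pos_real_solvable_iff k) auto
  have "b \<in> signed_range True False A \<longleftrightarrow> b \<in> signed_range True True A \<and> \<not> b < 0"
    "b \<in> signed_range False True A \<longleftrightarrow> b \<in> signed_range True True A \<and> \<not> b > 0" for b
    by (auto simp: signed_range_def)
  hence P: "tuples s (signed_range True False A) = {a \<in> box s A. \<not> (\<exists>b\<in>set a. b < 0)}"
    and N: "tuples s (signed_range False True A) = {a \<in> box s A. \<not> (\<exists>b\<in>set a. b > 0)}"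
    by (auto simp: box_eq tuples_def subset_iff)
  have disjPN: "?P \<inter> ?N = {}"
  proof -
    have False if a: "a \<in> box s A" "\<not> (\<exists>b\<in>set a. b < 0)" "\<not> (\<exists>b\<in>set a. b > 0)" for a
    proof -
      have "hd a \<in> set a" "hd a \<noteq> 0" using nz[OF a(1)] by auto
      thus False using a by (metis linorder_neqE)
    qed
    thus ?thesis unfolding P N by blast
  qed
  have "box s A \<inter> T = (?M \<union> ?P) \<union> ?N"
    unfolding P N using iff by blast
  moreover have "(?M \<union> ?P) \<inter> ?N = {}" "?M \<inter> ?P = {}"
    using disjPN iff unfolding P N by blast+
  ultimately show ?thesis
    by (metis (no_types, lifting) card_Un_disjoint finite_Int finite_Un finite_box finite_signed_range finite_tuples)
qed

text \<open>Of the 2^s sign patterns, all but two are mixed.\<close>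

lemma delta_inf_eq: "delta_inf s * (2 * A) ^ s = (2 ^ s - 2) * A ^ s"
proof -
  have "2 powr (1 - real s) = 2 / 2 ^ s"
    by (simp add: powr_diff powr_realpow)
  thus ?thesis by (simp add: delta_inf_def power_mult_distrib field_simps)
qed

lemma delta_inf_bounds: "s \<ge> 2 \<Longrightarrow> 0 < delta_inf s \<and> delta_inf s \<le> 1"
proof -
  assume "s \<ge> 2"
  hence "2 powr (1 - real s) < 2 powr 0" by (intro powr_less_mono) auto
  thus ?thesis by (simp add: delta_inf_def)
qed

text \<open>The box minus its two one-signed orthants: three periodic counts, whose error constants
  2 add up to 6.\<close>

lemma count_mixed_periodic:
  assumes k: "k > 0" and s: "s > 0" and Q: "Q > 0" "periodic Q T" "of_int Q \<le> A"
  shows "\<bar>real (card (box s A \<inter> ({a. pos_real_solvable k a} \<inter> T))) - dens s Q T * (delta_inf s * (2 * A) ^ s)\<bar>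
    \<le> 6 * real s * 6 ^ s * of_int Q * A ^ (s - 1)"
proof -
  let ?E = "2 * real s * 6 ^ s * of_int Q * A ^ (s - 1)"
  have 1: "\<bar>real (card (box s A \<inter> T)) - dens s Q T * (2 * A) ^ s\<bar> \<le> ?E"
    by (rule count_box_periodic[OF Q])
  have 2: "\<bar>real (card (tuples s (signed_range True False A) \<inter> T)) - dens s Q T * A ^ s\<bar> \<le> ?E"
    using count_periodic_signed[OF Q, of True False s] by simp
  have 3: "\<bar>real (card (tuples s (signed_range False True A) \<inter> T)) - dens s Q T * A ^ s\<bar> \<le> ?E"
    using count_periodic_signed[OF Q, of False True s] by simp
  have eq: "dens s Q T * (delta_inf s * (2 * A) ^ s)
      = dens s Q T * (2 * A) ^ s - dens s Q T * A ^ s - dens s Q T * A ^ s"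
    unfolding delta_inf_eq by (simp add: power_mult_distrib algebra_simps)
  have "real (card (box s A \<inter> ({a. pos_real_solvable k a} \<inter> T))) = real (card (box s A \<inter> T))
    - real (card (tuples s (signed_range True False A) \<inter> T)) - real (card (tuples s (signed_range False True A) \<inter> T))"
    using card_box_split_sign[OF k s, of A T] by simp
  thus ?thesis unfolding eq using 1 2 3 unfolding abs_le_iff by linarith
qed

lemma count_ratio_Cinf_tendsto:
  assumes k: "k > 0" and s: "s > 0"
  shows "(count_ratio s (Cinf k s) \<longlongrightarrow> delta_inf s) at_top"
proof (rule tendstoI)
  fix e :: real assume e: "e > 0"
  let ?c = "6 * real s * 3 ^ s"
  have "eventually (\<lambda>A. 1 \<le> (A::real)) at_top" by (rule eventually_ge_at_top)
  moreover have "eventually (\<lambda>A. ?c / A \<le> e / 2) at_top"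
    using e by (intro eventually_const_divide_le) auto
  ultimately show "eventually (\<lambda>A. dist (count_ratio s (Cinf k s) A) (delta_inf s) < e) at_top"
  proof eventually_elim
    case (elim A)
    have A: "A > 0" using elim by simp
    have "box s A \<inter> Cinf k s = box s A \<inter> ({a. pos_real_solvable k a} \<inter> UNIV)"
      by (auto simp: box_def Cinf_def)
    hence "\<bar>real (card (box s A \<inter> Cinf k s)) - delta_inf s * (2 * A) ^ s\<bar> \<le> 6 * real s * 6 ^ s * A ^ (s - 1)"
      using count_mixed_periodic[OF k s, of 1 UNIV A] elim by simp
    hence "\<bar>real (card (box s A \<inter> Cinf k s)) - delta_inf s * (2 * A) ^ s\<bar> / (2 * A) ^ s
        \<le> 6 * real s * 6 ^ s * A ^ (s - 1) / (2 * A) ^ s" using A by (intro divide_right_mono) auto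
    also have "\<bar>real (card (box s A \<inter> Cinf k s)) - delta_inf s * (2 * A) ^ s\<bar> / (2 * A) ^ s
        = \<bar>(real (card (box s A \<inter> Cinf k s)) - delta_inf s * (2 * A) ^ s) / (2 * A) ^ s\<bar>"
      using A by simp
    also have "(real (card (box s A \<inter> Cinf k s)) - delta_inf s * (2 * A) ^ s) / (2 * A) ^ s
        = count_ratio s (Cinf k s) A - delta_inf s"
      using A by (simp add: count_ratio_def diff_divide_distrib)
    also have "6 * real s * 6 ^ s * A ^ (s - 1) / (2 * A) ^ s = ?c / A"
    proof -
      have "(6::real) ^ s = 3 ^ s * 2 ^ s" by (simp flip: power_mult_distrib)
      moreover have "A ^ s = A * A ^ (s - 1)" using s by (cases s) auto
      ultimately show ?thesis using A by (simp add: power_mult_distrib field_simps)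
    qed
    finally show ?case using elim(2) e unfolding dist_real_def by linarith
  qed
qed

section \<open>Primorials, the size of the modulus, and tail sums\<close>

lemma prod_dvd_of_coprime:
  fixes f :: "nat \<Rightarrow> nat"
  assumes "finite P" "\<And>p. p \<in> P \<Longrightarrow> f p dvd n"
    "\<And>p q. p \<in> P \<Longrightarrow> q \<in> P \<Longrightarrow> p \<noteq> q \<Longrightarrow> coprime (f p) (f q)"
  shows "prod f P dvd n"
  using assms
proof (induction P rule: finite_induct)
  case (insert p P)
  have "coprime (f p) (prod f P)" using insert by (intro prod_coprime_right) auto
  thus ?case using insert by (auto intro: divides_mult)
qed simp

lemma primes_upto_finite [simp]: "finite {p::nat. prime p \<and> p \<le> n}"
  by (rule finite_subset[of _ "{..n}"]) auto

text \<open>Argument of Erdos: the primes in (m+1, 2m+1] divide the binomial coefficient of 2m+1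
  over m, which is at most 4^m because the left half of its row sums to 4^m. Even n > 2 reduce to n
  - 1.\<close>

lemma primorial_le: "(\<Prod>p\<in>{p. prime p \<and> p \<le> n}. p) \<le> 4 ^ n"
proof (induction n rule: less_induct)
  case (less n)
  let ?P = "\<lambda>n. {p::nat. prime p \<and> p \<le> n}"
  consider "n \<le> 2" | "n > 2" "even n" | "n > 2" "odd n" by linarith
  thus ?case
  proof cases
    case 1
    have "?P n \<subseteq> {2}" using 1 by (auto dest: prime_ge_2_nat)
    hence "(\<Prod>p\<in>?P n. p) dvd (\<Prod>p\<in>{2}. p)" by (intro prod_dvd_prod_subset) auto
    hence le: "(\<Prod>p\<in>?P n. p) \<le> 2" by (intro dvd_imp_le) auto
    show ?thesis
    proof (cases "n = 0")
      case True
      hence "?P n = {}" by auto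
      thus ?thesis by (simp only: prod.empty) simp
    next
      case False
      hence "(4::nat) ^ 1 \<le> 4 ^ n" by (intro power_increasing) auto
      thus ?thesis using le by simp
    qed
  next
    case 2
    have "\<not> prime n" using 2 by (auto dest: prime_odd_nat)
    hence "?P n = ?P (n - 1)" by (auto simp: le_less)
    hence "(\<Prod>p\<in>?P n. p) \<le> 4 ^ (n - 1)" using less[of "n - 1"] 2 by simp
    also have "\<dots> \<le> (4::nat) ^ n" by (intro power_increasing) auto
    finally show ?thesis .
  next
    case 3
    then obtain m where m: "n = 2 * m + 1" by (elim oddE)
    have m1: "m \<ge> 1" using 3 m by simp
    let ?R = "{p::nat. prime p \<and> m + 1 < p \<and> p \<le> n}"
    have finR: "finite ?R" by (rule finite_subset[of _ "?P n"]) auto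
    have "?P n = ?P (m + 1) \<union> ?R" using m by auto
    hence "(\<Prod>p\<in>?P n. p) = (\<Prod>p\<in>?P (m + 1). p) * (\<Prod>p\<in>?R. p)"
      using finR by (simp add: prod.union_disjoint disjoint_iff)
    also have "\<dots> \<le> 4 ^ (m + 1) * 4 ^ m"
    proof (rule mult_mono)
      show "(\<Prod>p\<in>?P (m + 1). p) \<le> 4 ^ (m + 1)" using less[of "m + 1"] m m1 by simp
      have "(\<Prod>p\<in>?R. p) dvd (n choose m)"
      proof (rule prod_dvd_of_coprime[OF finR])
        fix p assume p: "p \<in> ?R"
        have "fact m * fact (n - m) * (n choose m) = (fact n :: nat)"
          using m by (intro binomial_fact_lemma) simp
        moreover have "p dvd fact n" using p by (simp add: prime_dvd_fact_iff)
        ultimately have "p dvd fact m * fact (n - m) * (n choose m)" by simp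
        moreover have "\<not> p \<le> m" "\<not> p \<le> n - m" using p m by auto
        hence "\<not> p dvd (fact m :: nat)" "\<not> p dvd (fact (n - m) :: nat)"
          using p prime_dvd_fact_iff by blast+
        ultimately show "p dvd (n choose m)" using p by (simp add: prime_dvd_mult_iff)
      qed (auto intro: primes_coprime)
      hence "(\<Prod>p\<in>?R. p) \<le> (n choose m)" using m by (intro dvd_imp_le) auto
      also have "\<dots> \<le> (\<Sum>k\<le>m. (2 * m + 1 choose k))" unfolding m by (rule member_le_sum) auto
      also have "\<dots> = 4 ^ m" unfolding binomial_r_part_sum by (simp add: power_mult)
      finally show "(\<Prod>p\<in>?R. p) \<le> 4 ^ m" .
    qed auto
    also have "\<dots> = 4 ^ n" by (simp add: m mult_2 power_add)
    finally show ?thesis .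
  qed
qed

text \<open>\<open>l\<close> is the exponent of the first power of \<open>p\<close> above
  \<open>Z\<close>. For p > sqrt Z that power is p^2; for the few smaller primes the bound p Z is
  affordable.\<close>

lemma prime_power_exponent:
  fixes p Z :: nat
  assumes "prime p" "p \<le> Z"
  shows "\<exists>l. Z < p ^ l \<and> p ^ l \<le> p * (if p * p \<le> Z then Z else p)"
proof -
  have p2: "p \<ge> 2" using assms prime_ge_2_nat by blast
  obtain n where n: "p ^ n \<le> Z" "Z < p ^ (n + 1)" using ex_power_ivl1[OF p2, of Z] assms(2) p2 by auto
  have "p ^ n \<le> (if p * p \<le> Z then Z else p)"
  proof (cases "p * p \<le> Z")
    case False
    hence "p ^ n < p ^ 2" using n(1) by (simp add: power2_eq_square)
    hence "n \<le> 1" using p2 by (simp add: power_less_imp_less_exp)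
    hence "p ^ n \<le> p ^ 1" using p2 by (intro power_increasing) auto
    thus ?thesis using False by simp
  qed (use n in auto)
  thus ?thesis using n(2) by (intro exI[of _ "n + 1"]) auto
qed

text \<open>The multiplicities contribute a divisor of k^2. The powers p^(l p) contribute the
  primorial twice and an extra \<open>Z\<close> for each of the at most sqrt Z primes with p^2 \<le>
  Z. Here 10 = 4 + 2 + 4: each 4^Z is at most exp(4Z), and the powers of \<open>Z\<close> are at
  most exp(2Z).\<close>

lemma modulus_bound:
  fixes l :: "nat \<Rightarrow> nat" and Z k :: nat
  assumes k: "k > 0" and Z: "Z > 0"
    and l: "\<And>p. prime p \<Longrightarrow> p \<le> Z \<Longrightarrow> p ^ l p \<le> p * (if p * p \<le> Z then Z else p)"
  shows "real (\<Prod>p\<in>{p. prime p \<and> p \<le> Z}. p ^ (2 * multiplicity p k + l p)) \<le> real k ^ 2 * exp (10 * real Z)"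
proof -
  let ?P = "{p. prime p \<and> p \<le> Z}"
  let ?S = "{p\<in>?P. p * p \<le> Z}"
  have "(\<Prod>p\<in>?P. p ^ multiplicity p k) dvd k"
    by (rule prod_dvd_of_coprime) (auto simp: multiplicity_dvd intro: primes_coprime)
  hence 1: "(\<Prod>p\<in>?P. p ^ multiplicity p k) \<le> k" using k by (rule dvd_imp_le)
  have "(\<Prod>p\<in>?P. p ^ l p) \<le> (\<Prod>p\<in>?P. p * (if p * p \<le> Z then Z else p))"
    using l by (intro prod_mono) auto
  \<comment> \<open>An additional factor \<open>p\<close> at the small primes completes the second
    primorial.\<close>
  also have "\<dots> \<le> (\<Prod>p\<in>?P. p * ((if p * p \<le> Z then Z else 1) * p))"
    by (intro prod_mono) (auto simp: prime_ge_1_nat)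
  also have "\<dots> = (\<Prod>p\<in>?P. p) * ((\<Prod>p\<in>?P. if p * p \<le> Z then Z else 1) * (\<Prod>p\<in>?P. p))"
    by (simp only: prod.distrib)
  also have "(\<Prod>p\<in>?P. if p * p \<le> Z then Z else 1) = Z ^ card ?S"
    by (simp add: prod.If_cases Int_def)
  also have "(\<Prod>p\<in>?P. p) * (Z ^ card ?S * (\<Prod>p\<in>?P. p)) \<le> 4 ^ Z * (Z ^ card ?S * 4 ^ Z)"
    using primorial_le by (intro mult_mono mult_nonneg_nonneg) auto
  finally have 2: "real (\<Prod>p\<in>?P. p ^ l p) \<le> real (4 ^ Z * (Z ^ card ?S * 4 ^ Z))" by (rule of_nat_mono)
  have "real Z ^ card ?S \<le> exp (2 * real Z)"
  proof -
    have "?S \<subseteq> {1..nat \<lfloor>sqrt (real Z)\<rfloor>}"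
    proof
      fix p assume p: "p \<in> ?S"
      hence "real (p * p) \<le> real Z" by (simp only: mem_Collect_eq of_nat_le_iff)
      hence "real p ^ 2 \<le> real Z" by (simp add: power2_eq_square)
      hence "real p \<le> sqrt (real Z)" by (rule real_le_rsqrt)
      hence "p \<le> nat \<lfloor>sqrt (real Z)\<rfloor>" by (simp add: le_nat_floor)
      thus "p \<in> {1..nat \<lfloor>sqrt (real Z)\<rfloor>}" using p by (auto simp: Suc_le_eq dest: prime_gt_0_nat)
    qed
    hence "card ?S \<le> card {1..nat \<lfloor>sqrt (real Z)\<rfloor>}" by (intro card_mono) auto
    hence "card ?S \<le> nat \<lfloor>sqrt (real Z)\<rfloor>" by simp
    hence "real (card ?S) \<le> real (nat \<lfloor>sqrt (real Z)\<rfloor>)" by (rule of_nat_mono)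
    also have "\<dots> \<le> sqrt (real Z)" by simp
    finally have c: "real (card ?S) \<le> sqrt (real Z)" .
    have lnZ: "ln (real Z) \<le> 2 * sqrt (real Z)"
      using ln_le_minus_one[of "sqrt (real Z)"] Z by (simp add: ln_sqrt)
    have "real Z ^ card ?S = exp (real (card ?S) * ln (real Z))"
      using Z by (simp add: exp_of_nat_mult)
    also have "real (card ?S) * ln (real Z) \<le> sqrt (real Z) * (2 * sqrt (real Z))"
      using c lnZ Z by (intro mult_mono) auto
    also have "\<dots> = 2 * real Z" by simp
    finally show ?thesis by simp
  qed
  hence "real (4 ^ Z * (Z ^ card ?S * 4 ^ Z)) \<le> 4 ^ Z * (exp (2 * real Z) * 4 ^ Z)"
    by simp
  also have "\<dots> \<le> exp (4 * real Z) * (exp (2 * real Z) * exp (4 * real Z))"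
  proof -
    have "(4::real) \<le> exp 4" using exp_ge_add_one_self[of 4] by simp
    hence "(4::real) ^ Z \<le> exp 4 ^ Z" by (intro power_mono) auto
    also have "\<dots> = exp (4 * real Z)" by (simp add: mult.commute flip: exp_of_nat_mult)
    finally show ?thesis by (intro mult_mono) auto
  qed
  also have "\<dots> = exp (10 * real Z)" by (simp flip: exp_add)
  finally have 3: "real (\<Prod>p\<in>?P. p ^ l p) \<le> exp (10 * real Z)" using 2 by linarith
  have "(\<Prod>p\<in>?P. p ^ (2 * multiplicity p k + l p)) = (\<Prod>p\<in>?P. p ^ multiplicity p k) ^ 2 * (\<Prod>p\<in>?P. p ^ l p)"
    by (simp add: power_add power_mult prod.distrib mult.commute[of 2] flip: prod_power_distrib)
  hence "real (\<Prod>p\<in>?P. p ^ (2 * multiplicity p k + l p))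
      = real (\<Prod>p\<in>?P. p ^ multiplicity p k) ^ 2 * real (\<Prod>p\<in>?P. p ^ l p)"
    by (simp only: of_nat_mult of_nat_power)
  also have "\<dots> \<le> real k ^ 2 * exp (10 * real Z)"
    using 3 1 by (intro mult_mono power_mono) (auto simp del: of_nat_prod)
  finally show ?thesis .
qed

text \<open>Two of the \<open>t\<close> factors are summed by telescoping, the other t - 2 are
  bounded by their value at \<open>Z\<close>. With t = s - 2 this produces the exponent s -
  3.\<close>

lemma sum_inverse_powers_le:
  fixes S :: "nat set"
  assumes "finite S" "\<And>n. n \<in> S \<Longrightarrow> n > Z" "Z \<ge> 1" "t \<ge> 2"
  shows "(\<Sum>n\<in>S. 1 / real n ^ t) \<le> 1 / real Z ^ (t - 1)"
proof -
  define N where "N = Max (insert Z S)"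
  have "S \<subseteq> {Z<..N}" using assms(1,2) by (auto simp: N_def)
  have NZ: "N \<ge> Z" using assms(1) by (simp add: N_def)
  have tel: "(\<Sum>n\<in>{Z<..N}. 1 / real n ^ 2) \<le> 1 / real Z - 1 / real N"
    using NZ
  proof (induction N rule: dec_induct)
    case (step N)
    have N: "N > 0" using step.hyps assms(3) by simp
    have "{Z<..Suc N} = insert (Suc N) {Z<..N}" using step.hyps by auto
    hence "(\<Sum>n\<in>{Z<..Suc N}. 1 / real n ^ 2) = 1 / real (Suc N) ^ 2 + (\<Sum>n\<in>{Z<..N}. 1 / real n ^ 2)" by simp
    also have "\<dots> \<le> 1 / real (Suc N) ^ 2 + (1 / real Z - 1 / real N)" using step.IH by simp
    also have "1 / real (Suc N) ^ 2 \<le> 1 / (real N * real (Suc N))"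
      using N unfolding power2_eq_square by (intro divide_left_mono mult_right_mono) auto
    also have "1 / (real N * real (Suc N)) = 1 / real N - 1 / real (Suc N)"
      using N by (simp add: field_simps)
    finally show ?case by simp
  qed simp
  have "(\<Sum>n\<in>S. 1 / real n ^ t) \<le> (\<Sum>n\<in>S. 1 / real Z ^ (t - 2) * (1 / real n ^ 2))"
  proof (rule sum_mono)
    fix n assume "n \<in> S"
    hence n: "n > Z" using assms by blast
    have "real Z ^ (t - 2) * real n ^ 2 \<le> real n ^ (t - 2) * real n ^ 2"
      using n by (intro mult_right_mono power_mono) auto
    also have "\<dots> = real n ^ t" 
      using le_add_diff_inverse2[OF assms(4)] by (simp only: power_add [symmetric])
    finally have "real Z ^ (t - 2) * real n ^ 2 \<le> real n ^ t" .
    hence "1 / real n ^ t \<le> 1 / (real Z ^ (t - 2) * real n ^ 2)"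
      using n assms(3) by (intro divide_left_mono mult_pos_pos) auto
    thus "1 / real n ^ t \<le> 1 / real Z ^ (t - 2) * (1 / real n ^ 2)" by simp
  qed
  also have "\<dots> = 1 / real Z ^ (t - 2) * (\<Sum>n\<in>S. 1 / real n ^ 2)" by (simp only: sum_distrib_left)
  also have "\<dots> \<le> 1 / real Z ^ (t - 2) * (1 / real Z)"
  proof (intro mult_left_mono)
    have "(\<Sum>n\<in>S. 1 / real n ^ 2) \<le> (\<Sum>n\<in>{Z<..N}. 1 / real n ^ 2)"
      using \<open>S \<subseteq> _\<close> by (intro sum_mono2) auto
    also have "\<dots> \<le> 1 / real Z - 1 / real N" by (rule tel)
    also have "\<dots> \<le> 1 / real Z" by simp
    finally show "(\<Sum>n\<in>S. 1 / real n ^ 2) \<le> 1 / real Z" .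
  qed auto
  also have "\<dots> = 1 / real Z ^ (t - 1)"
  proof -
    have "t - 1 = Suc (t - 2)" using assms(4) by simp
    thus ?thesis by (simp add: mult.commute)
  qed
  finally show ?thesis .
qed

section \<open>The asymptotic formula\<close>


lemma primes_upto_split:
  "M \<le> N \<Longrightarrow> (\<Prod>p\<in>{p::nat. prime p \<and> p \<le> N}. f p)
    = (\<Prod>p\<in>{p. prime p \<and> p \<le> M}. f p) * (\<Prod>p\<in>{p. prime p \<and> M < p \<and> p \<le> N}. f p :: real)"
proof -
  assume "M \<le> N"
  hence "{p::nat. prime p \<and> p \<le> N} = {p. prime p \<and> p \<le> M} \<union> {p. prime p \<and> M < p \<and> p \<le> N}" by auto
  moreover have "finite {p::nat. prime p \<and> M < p \<and> p \<le> N}"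
    by (rule finite_subset[of _ "{..N}"]) auto
  ultimately show ?thesis by (simp add: prod.union_disjoint disjoint_iff)
qed

text \<open>Every factor lies in (0, 1], so the partial products decrease and stay nonnegative;
  convergence follows by monotonicity alone.\<close>

lemma euler_prod_convergent:
  assumes k: "k > 0" and s: "s \<ge> 2"
  shows "convergent (\<lambda>N. \<Prod>p\<in>{p. prime p \<and> p \<le> N}. delta_p p k s)"
proof -
  have nonneg: "0 \<le> delta_p p k s" and le1: "delta_p p k s \<le> 1" if "prime p" for p
    using delta_p_pos[OF that k s] delta_p_le_1[OF that k, of s] s by auto
  have "decseq (\<lambda>N. \<Prod>p\<in>{p. prime p \<and> p \<le> N}. delta_p p k s)"
  proof (rule decseq_SucI)
    fix N
    have "(\<Prod>p\<in>{p. prime p \<and> p \<le> Suc N}. delta_p p k s) = (\<Prod>p\<in>{p. prime p \<and> p \<le> N}. delta_p p k s)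
       * (\<Prod>p\<in>{p. prime p \<and> N < p \<and> p \<le> Suc N}. delta_p p k s)"
      by (rule primes_upto_split) simp
    also have "\<dots> \<le> (\<Prod>p\<in>{p. prime p \<and> p \<le> N}. delta_p p k s) * 1"
      by (intro mult_left_mono prod_le_1 prod_nonneg) (auto simp: nonneg le1)
    finally show "(\<Prod>p\<in>{p. prime p \<and> p \<le> Suc N}. delta_p p k s) \<le> (\<Prod>p\<in>{p. prime p \<and> p \<le> N}. delta_p p k s)"
      by simp
  qed
  moreover have "0 \<le> (\<Prod>p\<in>{p. prime p \<and> p \<le> N}. delta_p p k s)" for N
    by (intro prod_nonneg) (auto simp: nonneg)
  ultimately obtain L where "(\<lambda>N. \<Prod>p\<in>{p. prime p \<and> p \<le> N}. delta_p p k s) \<longlonglongrightarrow> L"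
    using decseq_convergent by blast
  thus ?thesis by (rule convergentI)
qed

text \<open>For factors in [0, 1] a difference of products is at most the sum of the differences,
  here at most 2^s times the sum of p^(2-s) over p > Z. The bound is uniform in the upper limit
  \<open>N\<close> and passes to the limit.\<close>

lemma euler_prod_tail:
  assumes k: "k > 0" and s: "s \<ge> 4" and Z: "Z \<ge> 16 * k ^ 6"
  shows "\<bar>(\<Prod>p\<in>{p. prime p \<and> p \<le> Z}. delta_p p k s) - euler_prod k s\<bar> \<le> 2 ^ s / real Z ^ (s - 3)"
proof -
  let ?E = "\<lambda>N. \<Prod>p\<in>{p. prime p \<and> p \<le> N}. delta_p p k s"
  have "k ^ 6 \<ge> 1" using k by simp
  hence Z1: "Z \<ge> 1" using Z by linarith
  have bnd: "0 \<le> delta_p p k s \<and> delta_p p k s \<le> 1" if "prime p" for p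
    using delta_p_pos[OF that k, of s] delta_p_le_1[OF that k, of s] s by auto
  have "?E \<longlonglongrightarrow> euler_prod k s"
    unfolding euler_prod_def using euler_prod_convergent[OF k, of s] s by (simp add: convergent_LIMSEQ_iff)
  hence "(\<lambda>N. \<bar>?E Z - ?E N\<bar>) \<longlonglongrightarrow> \<bar>?E Z - euler_prod k s\<bar>" by (intro tendsto_intros)
  moreover have "eventually (\<lambda>N. \<bar>?E Z - ?E N\<bar> \<le> 2 ^ s / real Z ^ (s - 3)) sequentially"
    using eventually_ge_at_top[of Z]
  proof eventually_elim
    case (elim N)
    let ?R = "{p. prime p \<and> Z < p \<and> p \<le> N}"
    have finR: "finite ?R" by (rule finite_subset[of _ "{..N}"]) auto
    have E0: "0 \<le> ?E Z" "?E Z \<le> 1" using bnd by (auto intro: prod_nonneg prod_le_1)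
    have "\<bar>?E Z - ?E N\<bar> = ?E Z * \<bar>(\<Prod>p\<in>?R. 1) - (\<Prod>p\<in>?R. delta_p p k s)\<bar>"
    proof -
      have "?E Z - ?E N = ?E Z * ((\<Prod>p\<in>?R. 1) - (\<Prod>p\<in>?R. delta_p p k s))"
        unfolding primes_upto_split[OF elim] by (simp add: right_diff_distrib)
      thus ?thesis using E0 by (simp only: abs_mult abs_of_nonneg)
    qed
    also have "\<dots> \<le> 1 * \<bar>(\<Prod>p\<in>?R. 1) - (\<Prod>p\<in>?R. delta_p p k s)\<bar>"
      using E0 by (intro mult_right_mono) auto
    also have "\<dots> \<le> (\<Sum>p\<in>?R. \<bar>1 - delta_p p k s\<bar>)"
      using norm_prod_diff[of ?R "\<lambda>_. 1::real" "\<lambda>p. delta_p p k s"] bnd by simp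
    also have "\<dots> \<le> (\<Sum>p\<in>?R. 2 ^ s * (1 / real p ^ (s - 2)))"
    proof (rule sum_mono)
      fix p assume "p \<in> ?R"
      hence "prime p" "p > 16 * k ^ 6" using Z by auto
      thus "\<bar>1 - delta_p p k s\<bar> \<le> 2 ^ s * (1 / real p ^ (s - 2))"
        using delta_p_ge[OF _ k, of p s] bnd[of p] s by simp
    qed
    also have "\<dots> = 2 ^ s * (\<Sum>p\<in>?R. 1 / real p ^ (s - 2))" by (simp only: sum_distrib_left)
    also have "\<dots> \<le> 2 ^ s * (1 / real Z ^ (s - 2 - 1))"
      using finR Z1 s by (intro mult_left_mono sum_inverse_powers_le) auto
    finally show ?case by (simp add: numeral_3_eq_3 numeral_2_eq_2)
  qed
  ultimately show ?thesis by (rule tendsto_upperbound) simp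
qed

text \<open>A nonzero entry of size at most A < p is prime to \<open>p\<close>, so at least three
  entries are units. Only finitely many primes can therefore exclude tuples of the box.\<close>

lemma box_large_prime_solvable:
  assumes p: "prime p" and k: "k > 0" and large: "p > 16 * k ^ 6" and s: "s \<ge> 3"
    and A: "real p > A" and a: "a \<in> box s A"
  shows "padic_unit_solvable p k a"
proof (rule ccontr)
  assume "\<not> ?thesis"
  hence len: "length (filter (\<lambda>b. \<not> int p dvd b) a) \<le> 2" by (rule not_solvable_imp_few[OF p k large])
  have "\<not> int p dvd b" if "b \<in> set a" for b
  proof
    assume "int p dvd b"
    moreover have b: "b \<noteq> 0" "real_of_int \<bar>b\<bar> \<le> A" using a that by (auto simp: box_def)
    ultimately have "int p \<le> \<bar>b\<bar>" using dvd_imp_le_int[of b "int p"] by simp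
    hence "real_of_int (int p) \<le> real_of_int \<bar>b\<bar>" by (rule of_int_le_iff[THEN iffD2])
    thus False using b A by simp
  qed
  hence "filter (\<lambda>b. \<not> int p dvd b) a = a" by (simp add: filter_id_conv)
  thus False using len a s by (simp add: box_def)
qed

text \<open>With \<open>X\<close> the count sought and \<open>Y\<close> the count under the real
  condition and the periodic conditions at p \<le> Z, three comparisons are made: X with Y, Y with
  its density \<rho>, and \<rho> with the Euler product. Apart from the cost of counting modulo
  \<open>Q\<close>, every error is a multiple of A^s Z^(3-s).\<close>

lemma count_Cprime_estimate:
  fixes l :: "nat \<Rightarrow> nat" and Z k s :: nat and A :: real
  defines "Q \<equiv> (\<Prod>p\<in>{p. prime p \<and> p \<le> Z}. p ^ (2 * multiplicity p k + l p))"
  assumes k: "k > 0" and s: "s \<ge> 4" and Z: "Z \<ge> 16 * k ^ 6"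
    and l: "\<And>p. prime p \<Longrightarrow> p \<le> Z \<Longrightarrow> Z < p ^ l p" and A: "real Q \<le> A"
  shows "\<bar>real (card (box s A \<inter> Cprime k s)) - frakD s k * (2 * A) ^ s\<bar>
    \<le> 6 * real s * 6 ^ s * real Q * A ^ (s - 1) + 4 * 4 ^ s * (A ^ s / real Z ^ (s - 3))"
proof -
  let ?P = "{p::nat. prime p \<and> p \<le> Z}"
  let ?T = "\<Inter>p\<in>?P. approx_set p k (l p)"
  let ?M = "{a. pos_real_solvable k a}"
  let ?B = "box s A"
  have "k ^ 6 \<ge> 1" using k by simp
  hence Z1: "Z \<ge> 1" using Z by linarith
  have Q0: "Q > 0" unfolding Q_def by (auto intro!: prod_pos simp: prime_gt_0_nat)
  have A0: "A > 0" using A Q0 by (meson less_le_trans of_nat_0_less_iff)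
  have s0: "s > 0" using s by simp
  define w where "w = 1 / real Z ^ (s - 3)"
  have w0: "w \<ge> 0" by (simp add: w_def)
  \<comment> \<open>Each p^(l p) exceeds \<open>Z\<close>, so there are at most \<open>Z\<close>
    terms of size at most Z^(-s), well within Z^(3-s).\<close>
  have small: "(\<Sum>p\<in>?P. 1 / real p ^ (l p * s)) \<le> w"
  proof -
    have "(\<Sum>p\<in>?P. 1 / real p ^ (l p * s)) \<le> (\<Sum>p\<in>?P. 1 / real Z ^ s)"
    proof (rule sum_mono)
      fix p assume p: "p \<in> ?P"
      have "real Z ^ s \<le> real (p ^ l p) ^ s" using l[of p] p by (intro power_mono) auto
      thus "1 / real p ^ (l p * s) \<le> 1 / real Z ^ s"
        using Z1 p prime_gt_0_nat[of p] by (intro divide_left_mono) (auto simp: power_mult)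
    qed
    also have "\<dots> = real (card ?P) * (1 / real Z ^ s)" by simp
    also have "\<dots> \<le> real Z * (1 / real Z ^ s)"
    proof (intro mult_right_mono)
      have "card ?P \<le> card {1..Z}" by (intro card_mono) (auto simp: Suc_le_eq dest: prime_gt_0_nat)
      thus "real (card ?P) \<le> real Z" by simp
    qed auto
    also have "\<dots> = 1 / real Z ^ (s - 1)" using Z1 s0 by (cases s) auto
    also have "\<dots> \<le> 1 / real Z ^ (s - 3)" using Z1 by (intro divide_left_mono power_increasing) auto
    finally show ?thesis by (simp add: w_def)
  qed
  have Cprime: "?B \<inter> Cprime k s = ?B \<inter> ?M \<inter> {a. \<forall>p. prime p \<longrightarrow> padic_unit_solvable p k a}"
    by (auto simp: box_def Cprime_def)
  define X where "X = real (card (?B \<inter> Cprime k s))"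
  define Y where "Y = real (card (?B \<inter> (?M \<inter> ?T)))"
  \<comment> \<open>Counted by \<open>X\<close> but not by \<open>Y\<close>: tuples divisible by
    p^(l p) throughout for some p \<le> Z.\<close>
  have XY: "X \<le> Y + (2 * A) ^ s * w"
  proof -
    let ?D = "\<lambda>p. ?B \<inter> {a. \<forall>b\<in>set a. int p ^ l p dvd b}"
    have "?B \<inter> Cprime k s \<subseteq> ?B \<inter> (?M \<inter> ?T) \<union> (\<Union>p\<in>?P. ?D p)"
    proof
      fix a assume a: "a \<in> ?B \<inter> Cprime k s"
      hence sol: "padic_unit_solvable p k a" if "prime p" for p using that Cprime by auto
      show "a \<in> ?B \<inter> (?M \<inter> ?T) \<union> (\<Union>p\<in>?P. ?D p)"
      proof (cases "\<exists>p\<in>?P. \<forall>b\<in>set a. int p ^ l p dvd b")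
        case True
        thus ?thesis using a by blast
      next
        case False
        hence "a \<in> approx_set p k (l p)" if "p \<in> ?P" for p
          using solvable_approx_set[OF sol, of p "l p"] that by blast
        thus ?thesis using a Cprime by blast
      qed
    qed
    hence "card (?B \<inter> Cprime k s) \<le> card (?B \<inter> (?M \<inter> ?T) \<union> (\<Union>p\<in>?P. ?D p))"
      by (intro card_mono) auto
    also have "\<dots> \<le> card (?B \<inter> (?M \<inter> ?T)) + (\<Sum>p\<in>?P. card (?D p))"
      by (intro order.trans[OF card_Un_le] add_left_mono card_UN_le) auto
    finally have "X \<le> real (card (?B \<inter> (?M \<inter> ?T)) + (\<Sum>p\<in>?P. card (?D p)))"
      unfolding X_def by (rule of_nat_mono)
    also have "\<dots> = Y + (\<Sum>p\<in>?P. real (card (?D p)))" by (simp add: Y_def)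
    also have "(\<Sum>p\<in>?P. real (card (?D p))) \<le> (\<Sum>p\<in>?P. (2 * A) ^ s * (1 / real p ^ (l p * s)))"
    proof (rule sum_mono)
      fix p assume p: "p \<in> ?P"
      have "real (card (?D p)) \<le> (2 * A / of_int (int p ^ l p)) ^ s"
        using A0 p by (intro card_box_all_dvd) (auto simp: prime_gt_0_nat)
      also have "\<dots> = (2 * A) ^ s * (1 / real p ^ (l p * s))" by (simp add: power_divide power_mult)
      finally show "real (card (?D p)) \<le> (2 * A) ^ s * (1 / real p ^ (l p * s))" .
    qed
    also have "\<dots> = (2 * A) ^ s * (\<Sum>p\<in>?P. 1 / real p ^ (l p * s))" by (simp only: sum_distrib_left)
    also have "\<dots> \<le> (2 * A) ^ s * w" using small A0 by (intro mult_left_mono) auto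
    finally show ?thesis by simp
  qed
  \<comment> \<open>Counted by \<open>Y\<close> but not by \<open>X\<close>: tuples failing at a
    prime between \<open>Z\<close> and A. At p \<le> Z the approximation is from inside, so nothing
    fails there.\<close>
  have YX: "Y \<le> X + (4 * A) ^ s * w"
  proof -
    let ?P2 = "{p::nat. prime p \<and> Z < p \<and> real p \<le> A}"
    let ?D = "\<lambda>p. ?B \<inter> {a. \<not> padic_unit_solvable p k a}"
    have "?P2 \<subseteq> {..nat \<lfloor>A\<rfloor>}" by (auto simp: le_nat_floor)
    hence finP2: "finite ?P2" by (rule finite_subset) simp
    have "?B \<inter> (?M \<inter> ?T) \<subseteq> ?B \<inter> Cprime k s \<union> (\<Union>p\<in>?P2. ?D p)"
    proof
      fix a assume a: "a \<in> ?B \<inter> (?M \<inter> ?T)"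
      show "a \<in> ?B \<inter> Cprime k s \<union> (\<Union>p\<in>?P2. ?D p)"
      proof (cases "\<exists>p\<in>?P2. \<not> padic_unit_solvable p k a")
        case True
        thus ?thesis using a by blast
      next
        case False
        have "padic_unit_solvable p k a" if p: "prime p" for p
        proof -
          consider "p \<le> Z" | "Z < p" "real p \<le> A" | "Z < p" "real p > A" by linarith
          thus ?thesis
          proof cases
            case 1
            hence "a \<in> approx_set p k (l p)" using a p by blast
            thus ?thesis by (rule approx_set_solvable[OF p k])
          next
            case 2
            thus ?thesis using False p by blast
          next
            case 3
            thus ?thesis using a p k Z s by (intro box_large_prime_solvable[of p k s A a]) auto
          qed
        qed
        thus ?thesis unfolding Cprime using a by blast
      qed
    qed
    hence "card (?B \<inter> (?M \<inter> ?T)) \<le> card (?B \<inter> Cprime k s \<union> (\<Union>p\<in>?P2. ?D p))"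
      using finP2 by (intro card_mono) auto
    also have "\<dots> \<le> card (?B \<inter> Cprime k s) + (\<Sum>p\<in>?P2. card (?D p))"
      using finP2 by (intro order.trans[OF card_Un_le] add_left_mono card_UN_le) auto
    finally have "Y \<le> real (card (?B \<inter> Cprime k s) + (\<Sum>p\<in>?P2. card (?D p)))"
      unfolding Y_def by (rule of_nat_mono)
    also have "\<dots> = X + (\<Sum>p\<in>?P2. real (card (?D p)))" by (simp add: X_def)
    also have "(\<Sum>p\<in>?P2. real (card (?D p))) \<le> (\<Sum>p\<in>?P2. (4 * A) ^ s * (1 / real p ^ (s - 2)))"
    proof (rule sum_mono)
      fix p assume "p \<in> ?P2"
      thus "real (card (?D p)) \<le> (4 * A) ^ s * (1 / real p ^ (s - 2))"
        using card_box_not_solvable[of p k s A] A0 k Z s by simp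
    qed
    also have "\<dots> = (4 * A) ^ s * (\<Sum>p\<in>?P2. 1 / real p ^ (s - 2))" by (simp only: sum_distrib_left)
    also have "\<dots> \<le> (4 * A) ^ s * (1 / real Z ^ (s - 2 - 1))"
      using finP2 Z1 s A0 by (intro mult_left_mono sum_inverse_powers_le) auto
    also have "1 / real Z ^ (s - 2 - 1) = w" by (simp add: w_def numeral_3_eq_3 numeral_2_eq_2)
    finally show ?thesis by simp
  qed
  let ?E = "\<lambda>N. \<Prod>p\<in>{p. prime p \<and> p \<le> N}. delta_p p k s"
  define \<rho> where "\<rho> = dens s (int Q) ?T"
  have Qint: "int Q = (\<Prod>p\<in>?P. int p ^ (2 * multiplicity p k + l p))" by (simp add: Q_def)
  have per: "periodic (int Q) ?T" and \<rho>: "\<rho> = (\<Prod>p\<in>?P. approx_dens s p k (l p))"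
  proof -
    have "periodic (int Q) ?T \<and> dens s (int Q) ?T = (\<Prod>p\<in>?P. approx_dens s p k (l p))"
      unfolding Qint approx_dens_def by (rule dens_INT_primes) (auto intro: periodic_approx_set)
    thus "periodic (int Q) ?T" "\<rho> = (\<Prod>p\<in>?P. approx_dens s p k (l p))" by (auto simp only: \<rho>_def)
  qed
  have Ymain: "\<bar>Y - \<rho> * (delta_inf s * (2 * A) ^ s)\<bar> \<le> 6 * real s * 6 ^ s * real Q * A ^ (s - 1)"
    using count_mixed_periodic[OF k s0 _ per, of A] Q0 A by (simp add: Y_def \<rho>_def)
  have \<rho>E: "\<bar>\<rho> - ?E Z\<bar> \<le> w"
  proof -
    have ad: "0 \<le> approx_dens s p k (l p) \<and> approx_dens s p k (l p) \<le> 1" if "p \<in> ?P" for p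
      using that prime_gt_0_nat[of p] by (simp add: approx_dens_nonneg approx_dens_le_1)
    have de: "0 \<le> delta_p p k s \<and> delta_p p k s \<le> 1" if "p \<in> ?P" for p
      using delta_p_pos[OF _ k, of p s] delta_p_le_1[OF _ k, of p s] that s by auto
    have "\<bar>\<rho> - ?E Z\<bar> \<le> (\<Sum>p\<in>?P. \<bar>approx_dens s p k (l p) - delta_p p k s\<bar>)"
      unfolding \<rho> using norm_prod_diff[of ?P "\<lambda>p. approx_dens s p k (l p)" "\<lambda>p. delta_p p k s"] ad de
      by simp
    also have "\<dots> \<le> (\<Sum>p\<in>?P. 1 / real p ^ (l p * s))"
    proof (rule sum_mono)
      fix p assume "p \<in> ?P"
      thus "\<bar>approx_dens s p k (l p) - delta_p p k s\<bar> \<le> 1 / real p ^ (l p * s)"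
        using delta_p_approx(2,3)[OF _ k s0, of p "l p"] by (simp add: abs_le_iff)
    qed
    finally show ?thesis using small by linarith
  qed
  have EE: "\<bar>?E Z - euler_prod k s\<bar> \<le> 2 ^ s * w"
    using euler_prod_tail[OF k s Z] by (simp add: w_def)
  have "\<bar>\<rho> - euler_prod k s\<bar> \<le> w + 2 ^ s * w" using \<rho>E EE by linarith
  moreover have di: "0 < delta_inf s" "delta_inf s \<le> 1" using delta_inf_bounds[of s] s by auto
  ultimately have "\<bar>\<rho> - euler_prod k s\<bar> * (delta_inf s * (2 * A) ^ s) \<le> (w + 2 ^ s * w) * (1 * (2 * A) ^ s)"
    using A0 w0 by (intro mult_mono) auto
  moreover have "\<bar>\<rho> * (delta_inf s * (2 * A) ^ s) - frakD s k * (2 * A) ^ s\<bar>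
      = \<bar>\<rho> - euler_prod k s\<bar> * (delta_inf s * (2 * A) ^ s)"
  proof -
    have "\<rho> * (delta_inf s * (2 * A) ^ s) - frakD s k * (2 * A) ^ s
      = (\<rho> - euler_prod k s) * (delta_inf s * (2 * A) ^ s)" by (simp add: frakD_def algebra_simps)
    thus ?thesis using di A0 by (simp add: abs_mult)
  qed
  ultimately have main: "\<bar>\<rho> * (delta_inf s * (2 * A) ^ s) - frakD s k * (2 * A) ^ s\<bar> \<le> (2 * A) ^ s * w + 2 ^ s * (2 * A) ^ s * w"
    by (simp add: algebra_simps)
  have p4: "2 ^ s * (2 * A) ^ s = (4 * A) ^ s" by (subst power_mult_distrib [symmetric]) simp
  have le4: "(2 * A) ^ s * w \<le> (4 * A) ^ s * w" using A0 w0 by (intro mult_right_mono power_mono) auto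
  have nn: "0 \<le> (2 * A) ^ s * w" "0 \<le> (4 * A) ^ s * w" using A0 w0 by auto
  have "\<bar>X - Y\<bar> \<le> (4 * A) ^ s * w" using XY YX le4 by linarith
  \<comment> \<open>The factor 3 is one for X against Y and two for \<rho> against the Euler
    product.\<close>
  hence "\<bar>X - frakD s k * (2 * A) ^ s\<bar> \<le> 6 * real s * 6 ^ s * real Q * A ^ (s - 1) + 3 * ((4 * A) ^ s * w)"
    using Ymain main le4 unfolding p4 by linarith
  also have "\<dots> \<le> 6 * real s * 6 ^ s * real Q * A ^ (s - 1) + 4 * ((4 * A) ^ s * w)" using nn by linarith
  also have "4 * ((4 * A) ^ s * w) = 4 * 4 ^ s * (A ^ s / real Z ^ (s - 3))"
    by (simp add: w_def power_mult_distrib)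
  finally show ?thesis by (simp only: X_def)
qed

text \<open>From (1 + x/n)^n \<le> e^x at x = (ln A)/2. It lets the error Q A^(s-1), of size
  A^(s-1/2), be absorbed into the logarithmic one.\<close>

lemma ln_power_le_sqrt:
  fixes A :: real
  assumes "A \<ge> 1" "n > 0"
  shows "ln A ^ n \<le> (2 * real n) ^ n * sqrt A"
proof -
  define y where "y = ln A"
  have y: "y \<ge> 0" using assms by (simp add: y_def)
  have "y ^ n = (2 * real n) ^ n * (y / 2 / real n) ^ n"
    using assms(2) by (subst power_mult_distrib [symmetric]) simp
  also have "\<dots> \<le> (2 * real n) ^ n * (1 + y / 2 / real n) ^ n"
    using y by (intro mult_left_mono power_mono) auto
  also have "\<dots> \<le> (2 * real n) ^ n * exp (y / 2)"
    using y assms(2) by (intro mult_left_mono exp_ge_one_plus_x_over_n_power_n) auto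
  also have "exp (y / 2) = sqrt A"
  proof (rule real_sqrt_unique [symmetric])
    show "exp (y / 2) ^ 2 = A" using assms(1) by (simp add: y_def flip: exp_double)
  qed simp
  finally show ?thesis by (simp add: y_def)
qed

text \<open>\<open>Lim\<close> and \<open>lim\<close> are total, so \<open>delta_p\<close>,
  \<open>euler_prod\<close> and \<open>frakD\<close> carry their meaning only together with the
  limits asserted here; these conjuncts express that the densities are well-defined.\<close>

theorem theorem1p4:
  fixes k s :: nat
  assumes "k \<ge> 2" and "s \<ge> 4"
  shows "delta_inf s > 0
    \<and> (count_ratio s (Cinf k s) \<longlongrightarrow> delta_inf s) at_top
    \<and> (\<forall>p. prime p \<longrightarrow> (count_ratio s (Cp p k s) \<longlongrightarrow> delta_p p k s) at_top \<and> delta_p p k s > 0)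
    \<and> convergent (\<lambda>N. \<Prod>p\<in>{p. prime p \<and> p \<le> N}. delta_p p k s)
    \<and> (\<lambda>A. real (card (box s A \<inter> Cprime k s)) - frakD s k * (2 * A) ^ s)
         \<in> O[at_top](\<lambda>A. A ^ s / ln A ^ (s - 3))
    \<and> (\<forall>\<^sub>F p in sequentially. prime p \<longrightarrow>
         delta_p p k s = 1 - inverse (1 - 1 / real p ^ s) *
           (real s * (1 - 1 / real p) * (1 / real p ^ (s - 1))
            + real (s * (s - 1)) / 2 * (1 - 1 / real p) ^ 2
              * (1 - 1 / real (gcd (p - 1) k)) * (1 / real p ^ (s - 2))))"
proof (intro conjI)
  have k: "k > 0" and s: "s > 0" "s \<ge> 2" using assms by auto
  show "delta_inf s > 0" using delta_inf_bounds[OF s(2)] by blast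
  show "(count_ratio s (Cinf k s) \<longlongrightarrow> delta_inf s) at_top" by (rule count_ratio_Cinf_tendsto[OF k s(1)])
  show "\<forall>p. prime p \<longrightarrow> (count_ratio s (Cp p k s) \<longlongrightarrow> delta_p p k s) at_top \<and> delta_p p k s > 0"
    using delta_p_approx(1)[OF _ k s(1)] delta_p_pos[OF _ k s(2)] by blast
  show "convergent (\<lambda>N. \<Prod>p\<in>{p. prime p \<and> p \<le> N}. delta_p p k s)"
    by (rule euler_prod_convergent[OF k s(2)])
  show "\<forall>\<^sub>F p in sequentially. prime p \<longrightarrow>
         delta_p p k s = 1 - inverse (1 - 1 / real p ^ s) *
           (real s * (1 - 1 / real p) * (1 / real p ^ (s - 1))
            + real (s * (s - 1)) / 2 * (1 - 1 / real p) ^ 2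
              * (1 - 1 / real (gcd (p - 1) k)) * (1 / real p ^ (s - 2)))"
    using eventually_gt_at_top[of "16 * k ^ 6"]
    by eventually_elim (use delta_p_formula[OF _ k _ s(2)] in blast)
  define n where "n = s - 3"
  have n: "n > 0" using assms by (simp add: n_def)
  \<comment> \<open>The first summand absorbs the error of counting modulo \<open>Q\<close>, the
    second the terms in Z^(3-s), where 40^n comes from Z \<ge> (ln A)/40.\<close>
  define C where "C = 6 * real s * 6 ^ s * real k ^ 2 * (2 * real n) ^ n + 4 * 4 ^ s * 40 ^ n"
  show "(\<lambda>A. real (card (box s A \<inter> Cprime k s)) - frakD s k * (2 * A) ^ s)
         \<in> O[at_top](\<lambda>A. A ^ s / ln A ^ (s - 3))"
  proof (rule bigoI)
    \<comment> \<open>The first threshold makes k^2 sqrt A \<le> A, so that Q \<le> A; the second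
      lifts (ln A)/40, a lower bound for \<open>Z\<close>, above 16 k^6.\<close>
    have "eventually (\<lambda>A. real k ^ 4 \<le> A) at_top" "eventually (\<lambda>A. exp (40 * real (16 * k ^ 6 + 1)) \<le> A) at_top"
      by (rule eventually_ge_at_top)+
    thus "eventually (\<lambda>A. norm (real (card (box s A \<inter> Cprime k s)) - frakD s k * (2 * A) ^ s)
        \<le> C * norm (A ^ s / ln A ^ (s - 3))) at_top"
    proof eventually_elim
      case (elim A)
      have ge40: "40 * real (16 * k ^ 6 + 1) \<ge> 40" by simp
      have "1 + 40 * real (16 * k ^ 6 + 1) \<le> A"
        using elim(2) exp_ge_add_one_self[of "40 * real (16 * k ^ 6 + 1)"] by linarith
      hence A1: "A > 1" using ge40 by linarith
      have lnA: "ln A \<ge> 40 * real (16 * k ^ 6 + 1)"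
        using elim(2) A1 by (subst ln_ge_iff) auto
      \<comment> \<open>The constant 20 is chosen so that exp(10 Z) \<le> sqrt A.\<close>
      define Z where "Z = nat \<lfloor>ln A / 20\<rfloor>"
      have Z_eq: "real Z = of_int \<lfloor>ln A / 20\<rfloor>" using A1 by (simp add: Z_def)
      have Zr: "real Z \<le> ln A / 20" "real Z > ln A / 20 - 1" unfolding Z_eq by linarith+
      have Zlow: "real Z \<ge> ln A / 40" using Zr(2) lnA ge40 by linarith
      have "real (16 * k ^ 6 + 1) \<le> real Z" using order.trans[OF lnA, of "40 * real Z"] Zlow
        by (simp only: mult_le_cancel_left_pos zero_less_numeral)
      hence "16 * k ^ 6 + 1 \<le> Z" by (simp only: of_nat_le_iff)
      hence Z: "Z \<ge> 16 * k ^ 6" "Z > 0" by linarith+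
      have "\<forall>p. \<exists>l. prime p \<longrightarrow> p \<le> Z \<longrightarrow> Z < p ^ l \<and> p ^ l \<le> p * (if p * p \<le> Z then Z else p)"
        using prime_power_exponent by blast
      then obtain l where l: "\<And>p. prime p \<Longrightarrow> p \<le> Z \<Longrightarrow> Z < p ^ l p"
          "\<And>p. prime p \<Longrightarrow> p \<le> Z \<Longrightarrow> p ^ l p \<le> p * (if p * p \<le> Z then Z else p)" by metis
      define Q where "Q = (\<Prod>p\<in>{p. prime p \<and> p \<le> Z}. p ^ (2 * multiplicity p k + l p))"
      have "real Q \<le> real k ^ 2 * exp (10 * real Z)"
        unfolding Q_def by (rule modulus_bound[OF k Z(2) l(2)])
      also have "exp (10 * real Z) \<le> exp (ln A / 2)" using Zr(1) by simp
      also have "exp (ln A / 2) = sqrt A"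
      proof (rule real_sqrt_unique [symmetric])
        show "exp (ln A / 2) ^ 2 = A" using A1 by (simp flip: exp_double)
      qed simp
      finally have Q: "real Q \<le> real k ^ 2 * sqrt A" by (simp add: mult_left_mono)
      have "real k ^ 2 \<le> sqrt A" using elim(1) by (intro real_le_rsqrt) (simp flip: power_mult)
      hence "real k ^ 2 * sqrt A \<le> sqrt A * sqrt A" using A1 by (intro mult_right_mono) auto
      hence QA: "real Q \<le> A" using Q A1 by simp
      have L: "ln A > 0" using A1 by simp
      have "\<bar>real (card (box s A \<inter> Cprime k s)) - frakD s k * (2 * A) ^ s\<bar>
        \<le> 6 * real s * 6 ^ s * real Q * A ^ (s - 1) + 4 * 4 ^ s * (A ^ s / real Z ^ n)"
        unfolding n_def Q_def
        by (rule count_Cprime_estimate[OF k assms(2) Z(1) l(1) QA[unfolded Q_def]])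
      also have "\<dots> = 6 * real s * 6 ^ s * (real Q * A ^ (s - 1)) + 4 * 4 ^ s * (A ^ s / real Z ^ n)"
        by simp
      also have "\<dots> \<le> 6 * real s * 6 ^ s * (real k ^ 2 * (2 * real n) ^ n * (A ^ s / ln A ^ n))
          + 4 * 4 ^ s * (40 ^ n * (A ^ s / ln A ^ n))"
      proof (intro add_mono mult_left_mono)
        show "real Q * A ^ (s - 1) \<le> real k ^ 2 * (2 * real n) ^ n * (A ^ s / ln A ^ n)"
        proof -
        have "real Q * A ^ (s - 1) \<le> real k ^ 2 * sqrt A * A ^ (s - 1)"
          using Q A1 by (intro mult_right_mono) auto
        also have "sqrt A \<le> (2 * real n) ^ n * (A / ln A ^ n)"
        proof -
          have "sqrt A * ln A ^ n \<le> sqrt A * ((2 * real n) ^ n * sqrt A)"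
            using ln_power_le_sqrt[of A n] A1 n by (intro mult_left_mono) auto
          also have "\<dots> = (2 * real n) ^ n * A" using A1 by simp
          finally show ?thesis using L by (simp add: field_simps)
        qed
        finally have "real Q * A ^ (s - 1) \<le> real k ^ 2 * ((2 * real n) ^ n * (A / ln A ^ n)) * A ^ (s - 1)"
          using A1 by (simp add: mult_left_mono mult_right_mono)
        also have "\<dots> = real k ^ 2 * (2 * real n) ^ n * (A * A ^ (s - 1) / ln A ^ n)" by simp
        also have "A * A ^ (s - 1) = A ^ s" using s(1) by (cases s) auto
        finally show ?thesis .
      qed
        show "A ^ s / real Z ^ n \<le> 40 ^ n * (A ^ s / ln A ^ n)"
      proof -
        have "A ^ s / real Z ^ n \<le> A ^ s / (ln A / 40) ^ n"
          using Zlow L Z A1 by (intro divide_left_mono power_mono mult_pos_pos zero_less_power) auto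
        thus ?thesis by (simp add: power_divide mult.commute)
        qed
      qed auto
      finally have "\<bar>real (card (box s A \<inter> Cprime k s)) - frakD s k * (2 * A) ^ s\<bar> \<le> C * (A ^ s / ln A ^ n)"
        by (simp add: C_def algebra_simps)
      moreover have "A ^ s / ln A ^ n \<ge> 0" using A1 L by simp
      ultimately show ?case unfolding n_def real_norm_def by (simp only: abs_of_nonneg)
    qed
  qed
qed

end
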